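(* Let $n\in\{1,2,\dots,\infty\}$. The even Clifford flow $\beta^n$ of rank $n$ has the same super product system as the Clifford flow $\alpha^n$ of rank $n$: realised as subspaces of the antisymmetric Fock space via $X\mapsto X\Omega$, one has $H^{\beta^n}_t\Omega=H^{\alpha^n}_t\Omega$ for all $t>0$, and the multiplication maps $X\Omega\otimes Y\Omega\mapsto XY\Omega$ of the two super product systems coincide.
   Context: Clifford and even Clifford flows: let $\mathrm{k}$ be a separable real Hilbert space of dimension $n$ with complexification $\mathrm{k}^{\mathbb{C}}$, and let $\Gamma_a$ be the antisymmetric Fock space over $L^2(\mathbb{R}_+;\mathrm{k}^{\mathbb{C}})$ with vacuum $\Omega$. Let $a^*(f)$ be the fermionic creation operators, $a^*(f)\Omega=f$, $a^*(f)(\xi_1\wedge\dots\wedge\xi_m)=f\wedge\xi_1\wedge\dots\wedge\xi_m$ (satisfying the canonical anticommutation relations), $a(f)=a^*(f)^*$, and $u(f)=(a(f)+a^*(f))/\sqrt2$ for $f\in L^2(\mathbb{R}_+;\mathrm{k})$. The von Neumann algebra $\mathcal{R}=\{u(f)\}''$ is the hyperfinite $\mathrm{II}_1$ factor, acting standardly on $\Gamma_a=L^2(\mathcal{R})$ with trace vector $\Omega$. With $(T_tf)(s)=0$ for $s<t$ and $(T_tf)(s)=f(s-t)$ for $s\ge t$, the Clifford flow $\alpha^n$ of rank $n$ is the semigroup of normal unital $*$-endomorphisms of $\mathcal{R}$ with $\alpha^n_t(u(f_1)\cdots u(f_k))=u(T_tf_1)\cdots u(T_tf_k)$. The von Neumann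 algebra $\mathcal{R}_e$ generated by the even products $u(f_1)\cdots u(f_{2m})$ is also the hyperfinite $\mathrm{II}_1$ factor; its standard space $L^2(\mathcal{R}_e)$ is identified with the closed subspace $\overline{\mathcal{R}_e\Omega}$ of $\Gamma_a$ spanned by the even particle spaces. The even Clifford flow $\beta^n$ of rank $n$ is the restriction of $\alpha^n$ to $\mathcal{R}_e$. Super product system: for a weak-$*$ continuous semigroup $\alpha$ of normal unital $*$-endomorphisms of a $\mathrm{II}_1$ factor $\mathrm{M}$ acting standardly on $L^2(\mathrm{M})$ with modular conjugation $J$ (for the trace vector $\Omega$), let $\alpha'_t(x')=J\alpha_t(Jx'J)J$ on $\mathrm{M}'$ and $$H^\alpha_t=\{T\in B(L^2(\mathrm{M})):\ \alpha_t(m)T=Tm,\ \alpha'_t(m')T=Tm'\ \ \forall m\in\mathrm{M},\,m'\in\mathrm{M}'\}.$$ For $S,T\in H^\alpha_t$, $T^*S$ is a scalar, $T^*S=\langle S,T\rangle_t1$, making $H^\alpha_t$ a Hilbert space, and $X\mapsto X\Omega$ is a unitary from $H^\alpha_t$ onto $H^\alpha_t\Omega=\{X\Omega:X\in H^\alpha_t\}\subseteq L^2(\mathrm{M})$. The super product system of $\alpha$ is $(H^\alpha_t)_{t>0}$ with multiplication $X\otimes Y\mapsto XY$, equivalently $(H^\alpha_t\Omega)_{t>0}$ with $X\Omega\otimes Y\Omega\mapsto XY\Omega$. *)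

theory Defs
  imports
    "HOL-Analysis.Analysis"
    "HOL-Library.Extended_Nat"
    "Jordan_Normal_Form.Determinant"
begin

section \<open>Complex Hilbert spaces and operators on closed subspaces\<close>

text \<open>Complex Hilbert spaces, with inner product linear in the first argument. The real inner
  product (hence norm and topology) is the real part of the complex one.\<close>

class chilbert_space = real_inner + banach +
  fixes scaleC :: "complex \<Rightarrow> 'a \<Rightarrow> 'a"
    and cinner :: "'a \<Rightarrow> 'a \<Rightarrow> complex"
  assumes scaleC_add_right: "scaleC c (x + y) = scaleC c x + scaleC c y"
    and scaleC_add_left: "scaleC (c + d) x = scaleC c x + scaleC d x"
    and scaleC_scaleC: "scaleC c (scaleC d x) = scaleC (c * d) x"
    and scaleR_scaleC: "scaleR r x = scaleC (complex_of_real r) x"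
    and cinner_commute: "cinner x y = cnj (cinner y x)"
    and cinner_add_left: "cinner (x + y) z = cinner x z + cinner y z"
    and cinner_scaleC_left: "cinner (scaleC c x) y = c * cinner x y"
    and inner_Re_cinner: "inner x y = Re (cinner x y)"

definition cspan :: "'h::chilbert_space set \<Rightarrow> 'h set" where
  "cspan S = {\<Sum>x\<in>F. scaleC (c x) x | F c. finite F \<and> F \<subseteq> S}"

definition ocomp :: "'h::chilbert_space set \<Rightarrow> 'h set" where
  "ocomp K = {x. \<forall>y\<in>K. cinner x y = 0}"

definition oproj :: "'h::chilbert_space set \<Rightarrow> 'h \<Rightarrow> 'h" where
  "oproj K x = (THE p. p \<in> K \<and> x - p \<in> ocomp K)"

text \<open>For a closed complex subspace \<open>K\<close> of the ambient space, an operator in \<open>B(K)\<close> is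
  represented by its extension by zero to the orthogonal complement of \<open>K\<close>. Products and
  adjoints are then those of the ambient space, and the unit of \<open>B(K)\<close> is \<open>oproj K\<close>.
  For \<open>K = UNIV\<close> one obtains all bounded operators.\<close>

definition bops :: "'h::chilbert_space set \<Rightarrow> ('h \<Rightarrow> 'h) set" where
  "bops K = {T. bounded_linear T \<and> (\<forall>c x. T (scaleC c x) = scaleC c (T x))
                \<and> range T \<subseteq> K \<and> (\<forall>x\<in>ocomp K. T x = 0)}"

definition cadj :: "('h::chilbert_space \<Rightarrow> 'h) \<Rightarrow> 'h \<Rightarrow> 'h" where
  "cadj T = (THE S. \<forall>x y. cinner (T x) y = cinner x (S y))"

definition commutant :: "'h::chilbert_space set \<Rightarrow> ('h \<Rightarrow> 'h) set \<Rightarrow> ('h \<Rightarrow> 'h) set" where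
  "commutant K S = {T \<in> bops K. \<forall>m\<in>S. T \<circ> m = m \<circ> T}"

definition restrict_op :: "'h::chilbert_space set \<Rightarrow> ('h \<Rightarrow> 'h) \<Rightarrow> ('h \<Rightarrow> 'h)" where
  "restrict_op K m = m \<circ> oproj K"

text \<open>The weak-* topology of \<open>B(K)\<close>, generated by the functionals
  \<open>T \<mapsto> \<Sum>n. \<langle>T x\<^sub>n, y\<^sub>n\<rangle>\<close> with square-summable sequences in \<open>K\<close>.\<close>

definition weak_star :: "'h::chilbert_space set \<Rightarrow> ('h \<Rightarrow> 'h) topology" where
  "weak_star K = topology_generated_by
     {{T \<in> bops K. (\<Sum>n. cinner (T (x n)) (y n)) \<in> U} | (x :: nat \<Rightarrow> 'h) y U.
        range x \<subseteq> K \<and> range y \<subseteq> K \<and> summable (\<lambda>n. (norm (x n))\<^sup>2)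
        \<and> summable (\<lambda>n. (norm (y n))\<^sup>2) \<and> open U}"


section \<open>Endomorphism semigroups and super product systems\<close>

text \<open>Flows are functions on all operators, but only their values on the algebra \<open>M\<close>
  matter.\<close>

definition normal_unital_endo ::
    "'h::chilbert_space set \<Rightarrow> ('h \<Rightarrow> 'h) set \<Rightarrow> (('h \<Rightarrow> 'h) \<Rightarrow> 'h \<Rightarrow> 'h) \<Rightarrow> bool" where
  "normal_unital_endo K M \<phi> \<longleftrightarrow>
     \<phi> ` M \<subseteq> M \<and> \<phi> (oproj K) = oproj K \<and>
     (\<forall>a\<in>M. \<forall>b\<in>M. \<phi> (\<lambda>x. a x + b x) = (\<lambda>x. \<phi> a x + \<phi> b x)) \<and>
     (\<forall>c. \<forall>a\<in>M. \<phi> (\<lambda>x. scaleC c (a x)) = (\<lambda>x. scaleC c (\<phi> a x))) \<and>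
     (\<forall>a\<in>M. \<forall>b\<in>M. \<phi> (a \<circ> b) = \<phi> a \<circ> \<phi> b) \<and>
     (\<forall>a\<in>M. \<phi> (cadj a) = cadj (\<phi> a)) \<and>
     continuous_map (subtopology (weak_star K) M) (subtopology (weak_star K) M) \<phi>"

definition endo_semigroup ::
    "'h::chilbert_space set \<Rightarrow> ('h \<Rightarrow> 'h) set \<Rightarrow> (real \<Rightarrow> ('h \<Rightarrow> 'h) \<Rightarrow> 'h \<Rightarrow> 'h) \<Rightarrow> bool" where
  "endo_semigroup K M \<alpha> \<longleftrightarrow>
     (\<forall>t\<ge>0. normal_unital_endo K M (\<alpha> t)) \<and>
     (\<forall>m\<in>M. \<alpha> 0 m = m) \<and>
     (\<forall>s\<ge>0. \<forall>t\<ge>0. \<forall>m\<in>M. \<alpha> (s + t) m = \<alpha> s (\<alpha> t m)) \<and>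
     (\<forall>m\<in>M. continuous_map (top_of_set {0..}) (weak_star K) (\<lambda>t. \<alpha> t m))"

text \<open>The modular conjugation for a cyclic and separating trace vector \<open>\<Omega>\<close>: the antiunitary
  of \<open>K\<close> (again extended by zero) with \<open>J m \<Omega> = m\<^sup>* \<Omega>\<close>.\<close>

definition modular_conj ::
    "'h::chilbert_space set \<Rightarrow> ('h \<Rightarrow> 'h) set \<Rightarrow> 'h \<Rightarrow> 'h \<Rightarrow> 'h" where
  "modular_conj K M \<Omega> = (THE J.
     (\<forall>x y. J (x + y) = J x + J y) \<and>
     (\<forall>c x. J (scaleC c x) = scaleC (cnj c) (J x)) \<and>
     (\<forall>x\<in>K. J x \<in> K \<and> norm (J x) = norm x) \<and>
     (\<forall>x\<in>ocomp K. J x = 0) \<and>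
     (\<forall>m\<in>M. J (m \<Omega>) = cadj m \<Omega>))"

definition dual_flow ::
    "'h::chilbert_space set \<Rightarrow> ('h \<Rightarrow> 'h) set \<Rightarrow> 'h \<Rightarrow> (real \<Rightarrow> ('h \<Rightarrow> 'h) \<Rightarrow> 'h \<Rightarrow> 'h)
      \<Rightarrow> real \<Rightarrow> ('h \<Rightarrow> 'h) \<Rightarrow> 'h \<Rightarrow> 'h" where
  "dual_flow K M \<Omega> \<alpha> t m' =
     (let J = modular_conj K M \<Omega> in J \<circ> \<alpha> t (J \<circ> m' \<circ> J) \<circ> J)"

text \<open>The spaces \<open>H\<^sub>t\<close> of intertwiners, for an algebra \<open>M \<subseteq> B(K)\<close> in standard form on \<open>K\<close>
  with trace vector \<open>\<Omega>\<close>.\<close>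

definition sps_space ::
    "'h::chilbert_space set \<Rightarrow> ('h \<Rightarrow> 'h) set \<Rightarrow> 'h \<Rightarrow> (real \<Rightarrow> ('h \<Rightarrow> 'h) \<Rightarrow> 'h \<Rightarrow> 'h)
      \<Rightarrow> real \<Rightarrow> ('h \<Rightarrow> 'h) set" where
  "sps_space K M \<Omega> \<alpha> t = {T \<in> bops K.
     (\<forall>m\<in>M. \<alpha> t m \<circ> T = T \<circ> m) \<and>
     (\<forall>m'\<in>commutant K M. dual_flow K M \<Omega> \<alpha> t m' \<circ> T = T \<circ> m')}"

definition sps_vectors ::
    "'h::chilbert_space set \<Rightarrow> ('h \<Rightarrow> 'h) set \<Rightarrow> 'h \<Rightarrow> (real \<Rightarrow> ('h \<Rightarrow> 'h) \<Rightarrow> 'h \<Rightarrow> 'h)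
      \<Rightarrow> real \<Rightarrow> 'h set" where
  "sps_vectors K M \<Omega> \<alpha> t = (\<lambda>X. X \<Omega>) ` sps_space K M \<Omega> \<alpha> t"

definition sps_op ::
    "'h::chilbert_space set \<Rightarrow> ('h \<Rightarrow> 'h) set \<Rightarrow> 'h \<Rightarrow> (real \<Rightarrow> ('h \<Rightarrow> 'h) \<Rightarrow> 'h \<Rightarrow> 'h)
      \<Rightarrow> real \<Rightarrow> 'h \<Rightarrow> ('h \<Rightarrow> 'h)" where
  "sps_op K M \<Omega> \<alpha> t = the_inv_into (sps_space K M \<Omega> \<alpha> t) (\<lambda>X. X \<Omega>)"

text \<open>The multiplication \<open>X \<Omega> \<otimes> Y \<Omega> \<mapsto> X Y \<Omega>\<close> for \<open>X \<in> H\<^sub>s\<close> and \<open>Y \<in> H\<^sub>t\<close>, given as a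
  bilinear map on pairs of vectors (its values on elementary tensors determine it).\<close>

definition sps_mult ::
    "'h::chilbert_space set \<Rightarrow> ('h \<Rightarrow> 'h) set \<Rightarrow> 'h \<Rightarrow> (real \<Rightarrow> ('h \<Rightarrow> 'h) \<Rightarrow> 'h \<Rightarrow> 'h)
      \<Rightarrow> real \<Rightarrow> real \<Rightarrow> 'h \<Rightarrow> 'h \<Rightarrow> 'h" where
  "sps_mult K M \<Omega> \<alpha> s t x y = (sps_op K M \<Omega> \<alpha> s x \<circ> sps_op K M \<Omega> \<alpha> t y) \<Omega>"


section \<open>The antisymmetric Fock space\<close>

text \<open>\<open>n\<close> is the Hilbert space dimension of the (separable) real Hilbert space \<open>'k\<close>.\<close>

definition hilbert_dim :: "'k::{real_inner,banach,second_countable_topology} itself \<Rightarrow> enat \<Rightarrow> bool"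
  where
  "hilbert_dim _ n \<longleftrightarrow> (\<exists>B :: 'k set. (\<forall>a\<in>B. \<forall>b\<in>B. inner a b = (if a = b then 1 else 0))
      \<and> closure (span B) = UNIV \<and> n = (if finite B then enat (card B) else \<infinity>))"

abbreviation halfline :: "real measure" where
  "halfline \<equiv> restrict_space lborel {0..}"

text \<open>Elements of \<open>L\<^sup>2\<close> are given by representatives; everything below depends only on their
  classes modulo null sets. The complexification of \<open>'k\<close> is \<open>'k \<times> 'k\<close>, with real part \<open>fst\<close>
  and imaginary part \<open>snd\<close>.\<close>

definition L2r :: "(real \<Rightarrow> 'k::{real_inner,banach,second_countable_topology}) set" where
  "L2r = {f. f \<in> borel_measurable halfline \<and> integrable halfline (\<lambda>s. (norm (f s))\<^sup>2)}"

definition L2c :: "(real \<Rightarrow> 'k::{real_inner,banach,second_countable_topology} \<times> 'k) set" where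
  "L2c = {f. (\<lambda>s. fst (f s)) \<in> L2r \<and> (\<lambda>s. snd (f s)) \<in> L2r}"

definition L2c_inner ::
    "(real \<Rightarrow> 'k::{real_inner,banach,second_countable_topology} \<times> 'k) \<Rightarrow> (real \<Rightarrow> 'k \<times> 'k) \<Rightarrow> complex"
  where
  "L2c_inner f g = Complex
     (LINT s|halfline. inner (fst (f s)) (fst (g s)) + inner (snd (f s)) (snd (g s)))
     (LINT s|halfline. inner (snd (f s)) (fst (g s)) - inner (fst (f s)) (snd (g s)))"

definition of_real_fun :: "(real \<Rightarrow> 'k::{real_inner,banach,second_countable_topology}) \<Rightarrow> real \<Rightarrow> 'k \<times> 'k"
  where
  "of_real_fun f s = (f s, 0)"

definition shift :: "real \<Rightarrow> (real \<Rightarrow> 'k::{real_inner,banach,second_countable_topology}) \<Rightarrow> real \<Rightarrow> 'k"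
  where
  "shift t f s = (if s < t then 0 else f (s - t))"

text \<open>The antisymmetric Fock space over \<open>L\<^sup>2(\<real>\<^sub>+; 'k\<^sup>\<complex>)\<close> is specified up to canonical unitary
  equivalence: a Hilbert space spanned by vectors \<open>w [f\<^sub>1, \<dots>, f\<^sub>m] = f\<^sub>1 \<and> \<dots> \<and> f\<^sub>m\<close> whose inner
  products are the Gram determinants. Multilinearity, antisymmetry and invariance under changing
  the \<open>f\<^sub>i\<close> on null sets follow. The vacuum is \<open>w []\<close>.\<close>

definition antisym_fock ::
    "((real \<Rightarrow> 'k::{real_inner,banach,second_countable_topology} \<times> 'k) list \<Rightarrow> 'h::chilbert_space) \<Rightarrow> bool"
  where
  "antisym_fock w \<longleftrightarrow>
     (\<forall>fs\<in>lists L2c. \<forall>gs\<in>lists L2c. cinner (w fs) (w gs) =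
        (if length fs = length gs
         then Determinant.det (Matrix.mat (length fs) (length fs) (\<lambda>(i, j). L2c_inner (fs ! i) (gs ! j)))
         else 0)) \<and>
     closure (cspan (w ` lists L2c)) = UNIV"

definition vac ::
    "((real \<Rightarrow> 'k::{real_inner,banach,second_countable_topology} \<times> 'k) list \<Rightarrow> 'h::chilbert_space) \<Rightarrow> 'h"
  where
  "vac w = w []"

definition creation ::
    "((real \<Rightarrow> 'k::{real_inner,banach,second_countable_topology} \<times> 'k) list \<Rightarrow> 'h::chilbert_space)
      \<Rightarrow> (real \<Rightarrow> 'k \<times> 'k) \<Rightarrow> 'h \<Rightarrow> 'h"
  where
  "creation w f = (THE A. A \<in> bops UNIV \<and> (\<forall>gs\<in>lists L2c. A (w gs) = w (f # gs)))"

definition annihilation ::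
    "((real \<Rightarrow> 'k::{real_inner,banach,second_countable_topology} \<times> 'k) list \<Rightarrow> 'h::chilbert_space)
      \<Rightarrow> (real \<Rightarrow> 'k \<times> 'k) \<Rightarrow> 'h \<Rightarrow> 'h"
  where
  "annihilation w f = cadj (creation w f)"

definition field_op ::
    "((real \<Rightarrow> 'k::{real_inner,banach,second_countable_topology} \<times> 'k) list \<Rightarrow> 'h::chilbert_space)
      \<Rightarrow> (real \<Rightarrow> 'k) \<Rightarrow> 'h \<Rightarrow> 'h"
  where
  "field_op w f = (\<lambda>x. (annihilation w (of_real_fun f) x + creation w (of_real_fun f) x) /\<^sub>R sqrt 2)"

definition field_prod ::
    "((real \<Rightarrow> 'k::{real_inner,banach,second_countable_topology} \<times> 'k) list \<Rightarrow> 'h::chilbert_space)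
      \<Rightarrow> (real \<Rightarrow> 'k) list \<Rightarrow> 'h \<Rightarrow> 'h"
  where
  "field_prod w fs = foldr (\<lambda>f A. field_op w f \<circ> A) fs id"


section \<open>The Clifford flow and the even Clifford flow\<close>

text \<open>Both generating sets below are closed under adjoints, so that the generated von Neumann
  algebras are their bicommutants.\<close>

definition cliff_alg ::
    "((real \<Rightarrow> 'k::{real_inner,banach,second_countable_topology} \<times> 'k) list \<Rightarrow> 'h::chilbert_space)
      \<Rightarrow> ('h \<Rightarrow> 'h) set"
  where
  "cliff_alg w = commutant UNIV (commutant UNIV (field_op w ` L2r))"

definition even_cliff_alg ::
    "((real \<Rightarrow> 'k::{real_inner,banach,second_countable_topology} \<times> 'k) list \<Rightarrow> 'h::chilbert_space)
      \<Rightarrow> ('h \<Rightarrow> 'h) set"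
  where
  "even_cliff_alg w =
     commutant UNIV (commutant UNIV (field_prod w ` {fs \<in> lists L2r. even (length fs)}))"

definition clifford_flow ::
    "((real \<Rightarrow> 'k::{real_inner,banach,second_countable_topology} \<times> 'k) list \<Rightarrow> 'h::chilbert_space)
      \<Rightarrow> (real \<Rightarrow> ('h \<Rightarrow> 'h) \<Rightarrow> 'h \<Rightarrow> 'h) \<Rightarrow> bool"
  where
  "clifford_flow w \<alpha> \<longleftrightarrow> endo_semigroup UNIV (cliff_alg w) \<alpha> \<and>
     (\<forall>t\<ge>0. \<forall>fs\<in>lists L2r. \<alpha> t (field_prod w fs) = field_prod w (map (shift t) fs))"

text \<open>The standard representation of the even algebra: its standard space as a subspace of the
  Fock space, the operators acting on that space, and the restricted flow transported to them.\<close>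

definition even_space ::
    "((real \<Rightarrow> 'k::{real_inner,banach,second_countable_topology} \<times> 'k) list \<Rightarrow> 'h::chilbert_space)
      \<Rightarrow> 'h set"
  where
  "even_space w = closure ((\<lambda>m. m (vac w)) ` even_cliff_alg w)"

definition even_cliff_std ::
    "((real \<Rightarrow> 'k::{real_inner,banach,second_countable_topology} \<times> 'k) list \<Rightarrow> 'h::chilbert_space)
      \<Rightarrow> ('h \<Rightarrow> 'h) set"
  where
  "even_cliff_std w = restrict_op (even_space w) ` even_cliff_alg w"

definition even_flow ::
    "((real \<Rightarrow> 'k::{real_inner,banach,second_countable_topology} \<times> 'k) list \<Rightarrow> 'h::chilbert_space)
      \<Rightarrow> (real \<Rightarrow> ('h \<Rightarrow> 'h) \<Rightarrow> 'h \<Rightarrow> 'h) \<Rightarrow> real \<Rightarrow> ('h \<Rightarrow> 'h) \<Rightarrow> 'h \<Rightarrow> 'h"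
  where
  "even_flow w \<alpha> t x = restrict_op (even_space w)
     (\<alpha> t (the_inv_into (even_cliff_alg w) (restrict_op (even_space w)) x))"

end

theory Submission
  imports Defs
begin

text \<open>With the parity \<open>G = (-1)^N\<close>, right multiplication by \<open>u f\<close> is the operator
  \<open>J u(f) J = (a\<^sup>*(f) - a(f)) G / sqrt 2\<close>. Both \<open>H\<^sub>t \<Omega>\<close> are identified with the space of even vectors
  \<open>\<xi>\<close> that are killed by all \<open>a(T\<^sub>t f)\<close>. An intertwiner for the Clifford flow gives a vector \<open>\<xi>\<close> on
  which left and right multiplication by every \<open>u(T\<^sub>t f)\<close> agree, that is, \<open>a(T\<^sub>t f)\<close> kills its even part and
  \<open>a\<^sup>*(T\<^sub>t f)\<close> its odd part \<open>\<eta>\<close>. For an orthonormal sequence \<open>f\<^sub>i\<close> the anticommutation relations give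
  \<open>\<parallel>a(f\<^sub>i) \<eta>\<parallel> = \<parallel>\<eta>\<parallel>\<close>, whereas \<open>a(f\<^sub>i)\<close> tends strongly to 0; so \<open>\<eta> = 0\<close>. An intertwiner for the even flow gives
  an even \<open>\<xi>\<close> with \<open>a\<^sup>*(f) a(g) \<xi> = a\<^sup>*(g) a(f) \<xi>\<close> for all shifted \<open>f\<close>, \<open>g\<close>, and \<open>f = f\<^sub>i\<close> yields \<open>a(g) \<xi> = 0\<close>.

  Conversely, for such a \<open>\<xi>\<close> the state \<open>m \<mapsto> \<langle>\<alpha>\<^sub>t(m) \<xi>, \<xi>\<rangle>\<close> is invariant under conjugation by the unitaries
  \<open>sqrt 2 u(f)\<close>, hence a multiple of the trace by an averaging argument and normality of \<open>\<alpha>\<^sub>t\<close>. Therefore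
  \<open>m \<Omega> \<mapsto> \<alpha>\<^sub>t(m) \<xi>\<close> extends to a bounded operator, which is the intertwiner of the Clifford flow; its
  restriction to the even space is the intertwiner of the even flow.\<close>

section \<open>Complex Hilbert spaces\<close>

text \<open>Rank 1 is no exception: one unit vector of the one-particle space, spread over disjoint
  intervals, already gives the infinite orthonormal sequence on which every vanishing argument
  rests.

  The averaging is a minimal-norm argument: the shortest vector in the closure of all admissible
  \<open>c \<Omega>\<close> is fixed by the unitaries \<open>2 u f ru f\<close>, so left and right
  multiplication agree on it. The lemma that describes intertwiner vectors, now used with unshifted
  functions, makes it a multiple of \<Omega>. Normality is stated through the weak-* topology, so
  the approximants keep a common norm bound; convergence at \<Omega> then spreads to all vectors
  through the commutant.

  The delicate side is the dual relation of the even flow. It runs over the commutant on the even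
  space, where a single \<open>ru f\<close> does not act. Necessity uses products of two fields.
  Sufficiency needs every such \<open>y\<close> to be \<open>J m J\<close> on even vectors with
  \<open>m\<close> in the even algebra, which follows by extending \<open>y\<close> to odd vectors
  through conjugation with one \<open>u f\<close>.

  Multiplications agree because a Clifford intertwiner \<open>X\<close> commutes with the even
  projection \<open>P\<close>, and \<open>X \<circ> P\<close> is the even intertwiner of the same
  vector.\<close>

lemma scaleC_zero_left [simp]: "scaleC 0 x = 0"
  and scaleC_one [simp]: "scaleC 1 x = x"
  using scaleR_scaleC[of 0 x] scaleR_scaleC[of 1 x] by simp_all

lemma scaleC_zero_right [simp]: "scaleC c 0 = 0"
  using scaleC_add_right[of c 0 0] by simp

lemma scaleC_minus_left: "scaleC (- c) x = - scaleC c x"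
  using scaleC_add_left[of c "- c" x] by (simp add: eq_neg_iff_add_eq_0 add.commute)

lemma scaleC_minus_right: "scaleC c (- x) = - scaleC c x"
  using scaleC_add_right[of c x "- x"] by (simp add: eq_neg_iff_add_eq_0 add.commute)

lemma scaleC_diff_right: "scaleC c (x - y) = scaleC c x - scaleC c y"
  using scaleC_add_right[of c x "- y"] by (simp add: scaleC_minus_right)

lemma scaleC_sum_right: "scaleC c (sum f A) = (\<Sum>i\<in>A. scaleC c (f i))"
  by (induction A rule: infinite_finite_induct) (auto simp: scaleC_add_right)

lemma cinner_add_right: "cinner x (y + z) = cinner x y + cinner x z"
  by (metis cinner_add_left cinner_commute complex_cnj_add)

lemma cinner_scaleC_right: "cinner x (scaleC c y) = cnj c * cinner x y"
  by (metis cinner_scaleC_left cinner_commute complex_cnj_mult)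

lemma cinner_zero_left [simp]: "cinner 0 y = 0"
  and cinner_zero_right [simp]: "cinner y 0 = 0"
  using cinner_add_left[of 0 0 y] cinner_add_right[of y 0 0] by simp_all

lemma cinner_minus_left: "cinner (- x) y = - cinner x y"
  and cinner_minus_right: "cinner x (- y) = - cinner x y"
  using cinner_scaleC_left[of "-1" x y] cinner_scaleC_right[of x "-1" y]
  by (simp_all add: scaleC_minus_left)

lemma cinner_diff_left: "cinner (x - y) z = cinner x z - cinner y z"
  and cinner_diff_right: "cinner z (x - y) = cinner z x - cinner z y"
  using cinner_add_left[of x "-y" z] cinner_add_right[of z x "-y"]
  by (simp_all add: cinner_minus_left cinner_minus_right)

lemma cinner_sum_left: "cinner (sum f A) y = (\<Sum>i\<in>A. cinner (f i) y)"
  by (induction A rule: infinite_finite_induct) (auto simp: cinner_add_left)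

lemma cinner_sum_right: "cinner y (sum f A) = (\<Sum>i\<in>A. cinner y (f i))"
  by (induction A rule: infinite_finite_induct) (auto simp: cinner_add_right)

lemma cinner_scaleR_left: "cinner (r *\<^sub>R x) y = of_real r * cinner x y"
  and cinner_scaleR_right: "cinner x (r *\<^sub>R y) = of_real r * cinner x y"
  by (simp_all add: scaleR_scaleC cinner_scaleC_left cinner_scaleC_right)

lemma cinner_self: "cinner x x = of_real ((norm x)\<^sup>2)"
proof -
  have "Im (cinner x x) = 0"
    using cinner_commute[of x x] by (metis cnj.simps(2) equal_neg_zero)
  moreover have "Re (cinner x x) = (norm x)\<^sup>2"
    by (metis inner_Re_cinner power2_norm_eq_inner)
  ultimately show ?thesis by (simp add: complex_eq_iff)
qed

lemma norm_scaleC: "norm (scaleC c x) = cmod c * norm x"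
proof -
  have "of_real ((norm (scaleC c x))\<^sup>2) = c * cnj c * of_real ((norm x)\<^sup>2)"
    using cinner_self[of "scaleC c x"]
    by (simp add: cinner_scaleC_left cinner_scaleC_right cinner_self[of x] algebra_simps)
  also have "\<dots> = of_real ((cmod c * norm x)\<^sup>2)"
    by (simp add: complex_norm_square[symmetric] power_mult_distrib)
  finally have "(norm (scaleC c x))\<^sup>2 = (cmod c * norm x)\<^sup>2"
    by (simp only: of_real_eq_iff)
  then show ?thesis by (simp add: power2_eq_iff_nonneg)
qed

lemma norm_cinner_le: "cmod (cinner x y) \<le> norm x * norm y"
proof (cases "cinner x y = 0")
  case False
  define c where "c = cinner x y"
  define d where "d = cnj c / of_real (cmod c)"
  have c0: "cmod c \<noteq> 0" using False by (simp add: c_def)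
  have d1: "cmod d = 1" using c0 by (simp add: d_def norm_divide)
  have "cinner (scaleC d x) y = of_real (cmod c)"
    using c0 by (simp add: cinner_scaleC_left c_def[symmetric] d_def field_simps
        complex_norm_square[symmetric] power2_eq_square)
  then have "cmod c = inner (scaleC d x) y" by (simp add: inner_Re_cinner)
  also have "\<dots> \<le> norm (scaleC d x) * norm y" by (rule norm_cauchy_schwarz)
  also have "\<dots> = norm x * norm y" by (simp add: norm_scaleC d1)
  finally show ?thesis by (simp add: c_def)
qed simp

lemma bounded_bilinear_cinner: "bounded_bilinear (cinner :: 'h::chilbert_space \<Rightarrow> _)"
proof
  show "\<exists>K. \<forall>x y :: 'h. cmod (cinner x y) \<le> norm x * norm y * K"
    by (intro exI[of _ 1]) (simp add: norm_cinner_le)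
qed (auto simp: cinner_add_left cinner_add_right cinner_scaleR_left cinner_scaleR_right scaleR_conv_of_real)

lemmas tendsto_cinner = bounded_bilinear.tendsto[OF bounded_bilinear_cinner]
lemmas continuous_on_cinner = bounded_bilinear.continuous_on[OF bounded_bilinear_cinner]

lemma bounded_linear_scaleC: "bounded_linear (scaleC c)"
  by (rule bounded_linear_intro[where K = "cmod c"])
    (auto simp: scaleC_add_right scaleR_scaleC scaleC_scaleC norm_scaleC mult.commute)

lemma cinner_ext: "(\<And>y. cinner x y = cinner x' y) \<Longrightarrow> x = x'"
  using cinner_self[of "x - x'"] cinner_diff_left[of x x' "x - x'"] by simp

text \<open>Evaluating the real identity at \<open>-\<i> x\<close> recovers the imaginary part.
  Adjoints can therefore be built from the real Riesz theorem.\<close>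

lemma cinner_eq_if_inner_eq:
  assumes "\<And>x. inner (T x) y = inner x z" "\<And>c x. T (scaleC c x) = scaleC c (T x)"
  shows "cinner (T x) y = cinner x z"
proof -
  have "Re (cinner (T x) y) = Re (cinner x z)" using assms(1)[of x] by (simp add: inner_Re_cinner)
  moreover have "Im (cinner (T x) y) = Im (cinner x z)"
    using assms(1)[of "scaleC (-\<i>) x"] by (simp add: inner_Re_cinner assms(2) cinner_scaleC_left)
  ultimately show ?thesis by (simp add: complex_eq_iff)
qed

definition csubspace :: "'h::chilbert_space set \<Rightarrow> bool" where
  "csubspace V \<longleftrightarrow> 0 \<in> V \<and> (\<forall>x\<in>V. \<forall>y\<in>V. x + y \<in> V) \<and> (\<forall>c. \<forall>x\<in>V. scaleC c x \<in> V)"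

lemma csubspace_diff: "csubspace V \<Longrightarrow> x \<in> V \<Longrightarrow> y \<in> V \<Longrightarrow> x - y \<in> V"
  unfolding csubspace_def using scaleC_minus_left[of 1 y]
  by (metis diff_conv_add_uminus scaleC_one)

lemma csubspace_sum: "csubspace V \<Longrightarrow> (\<And>i. i \<in> A \<Longrightarrow> f i \<in> V) \<Longrightarrow> sum f A \<in> V"
  by (induction A rule: infinite_finite_induct) (auto simp: csubspace_def)

lemma cspan_subset: "csubspace V \<Longrightarrow> D \<subseteq> V \<Longrightarrow> cspan D \<subseteq> V"
  unfolding cspan_def by (auto intro!: csubspace_sum) (auto simp: csubspace_def)

text \<open>The density principle used throughout: a property that defines a closed complex subspace
  needs to be tested on generators only.\<close>

lemma cspan_closure_induct:
  assumes "closure (cspan D) = UNIV" "csubspace V" "closed V" "D \<subseteq> V"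
  shows "x \<in> V"
  using closure_minimal[OF cspan_subset[OF assms(2,4)] assms(3)] assms(1) by auto

lemma cspan_superset: "D \<subseteq> cspan D"
proof
  fix x assume "x \<in> D"
  then have "x = (\<Sum>y\<in>{x}. scaleC 1 y) \<and> finite {x} \<and> {x} \<subseteq> D" by simp
  then show "x \<in> cspan D" unfolding cspan_def by fastforce
qed

lemma csubspace_cspan: "csubspace (cspan D)"
  unfolding csubspace_def
proof (intro conjI ballI allI)
  show "0 \<in> cspan D"
    unfolding cspan_def by (rule CollectI, intro exI[of _ "{}"]) auto
next
  fix x y assume "x \<in> cspan D" "y \<in> cspan D"
  then obtain F c G d where F: "finite F" "F \<subseteq> D" "x = (\<Sum>v\<in>F. scaleC (c v) v)"
    and G: "finite G" "G \<subseteq> D" "y = (\<Sum>v\<in>G. scaleC (d v) v)"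
    unfolding cspan_def by blast
  define c' where "c' = (\<lambda>v. if v \<in> F then c v else 0)"
  define d' where "d' = (\<lambda>v. if v \<in> G then d v else 0)"
  have "x = (\<Sum>v\<in>F \<union> G. scaleC (c' v) v)" unfolding F(3)
    by (rule sum.mono_neutral_cong_left) (auto simp: F G c'_def)
  moreover have "y = (\<Sum>v\<in>F \<union> G. scaleC (d' v) v)" unfolding G(3)
    by (rule sum.mono_neutral_cong_left) (auto simp: F G d'_def)
  ultimately have "x + y = (\<Sum>v\<in>F \<union> G. scaleC (c' v + d' v) v)"
    by (simp add: scaleC_add_left sum.distrib)
  then show "x + y \<in> cspan D" unfolding cspan_def
    using F G by (intro CollectI exI[of _ "F \<union> G"] exI[of _ "\<lambda>v. c' v + d' v"]) auto
next
  fix a x assume "x \<in> cspan D"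
  then obtain F c where F: "finite F" "F \<subseteq> D" "x = (\<Sum>v\<in>F. scaleC (c v) v)"
    unfolding cspan_def by blast
  then have "scaleC a x = (\<Sum>v\<in>F. scaleC (a * c v) v)"
    by (simp add: scaleC_sum_right scaleC_scaleC)
  then show "scaleC a x \<in> cspan D" unfolding cspan_def
    using F by (intro CollectI exI[of _ F] exI[of _ "\<lambda>v. a * c v"]) auto
qed

lemma csubspace_closure:
  assumes "csubspace V" shows "csubspace (closure V)"
  unfolding csubspace_def
proof (intro conjI ballI allI)
  show "0 \<in> closure V" using assms closure_subset[of V] by (auto simp: csubspace_def)
next
  fix x y assume "x \<in> closure V" "y \<in> closure V"
  then obtain f g where "\<And>n. f n \<in> V" "f \<longlonglongrightarrow> x" "\<And>n. g n \<in> V" "g \<longlonglongrightarrow> y"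
    unfolding closure_sequential by blast
  then show "x + y \<in> closure V" unfolding closure_sequential
    using assms by (intro exI[of _ "\<lambda>n. f n + g n"]) (auto simp: csubspace_def intro: tendsto_add)
next
  fix c x assume "x \<in> closure V"
  then obtain f where "\<And>n. f n \<in> V" "f \<longlonglongrightarrow> x" unfolding closure_sequential by blast
  then show "scaleC c x \<in> closure V" unfolding closure_sequential
    using assms by (intro exI[of _ "\<lambda>n. scaleC c (f n)"])
      (auto simp: csubspace_def intro: bounded_linear.tendsto[OF bounded_linear_scaleC])
qed

lemma csubspace_UNIV: "csubspace UNIV"
  by (simp add: csubspace_def)

text \<open>The squared coefficients have partial sums bounded by the squared norm of
  \<open>x\<close>, hence are summable and tend to 0.\<close>

lemma bessel:
  fixes v :: "nat \<Rightarrow> 'h::chilbert_space"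
  assumes "\<And>i j. cinner (v i) (v j) = (if i = j then 1 else 0)"
  shows "(\<lambda>i. cinner x (v i)) \<longlonglongrightarrow> 0"
proof -
  define c where "c i = cinner x (v i)" for i
  have "(\<Sum>i<n. (cmod (c i))\<^sup>2) \<le> (norm x)\<^sup>2" for n
  proof -
    define y where "y = (\<Sum>i<n. scaleC (c i) (v i))"
    define s where "s = (\<Sum>i<n. (cmod (c i))\<^sup>2)"
    have "(\<Sum>i<n. c i * cnj (c i)) = of_real s"
      unfolding s_def of_real_sum by (rule sum.cong) (simp_all only: complex_norm_square)
    moreover have "cinner y x = (\<Sum>i<n. c i * cnj (c i))"
      unfolding y_def by (simp add: cinner_sum_left cinner_scaleC_left c_def cinner_commute[of "v _" x] mult.commute)
    moreover have "cinner y y = (\<Sum>i<n. c i * cnj (c i))"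
      unfolding y_def
      by (simp add: cinner_sum_left cinner_sum_right cinner_scaleC_left cinner_scaleC_right assms if_distrib mult.commute cong: if_cong)
    ultimately have yx: "cinner y x = of_real s" "cinner y y = of_real s" by simp_all
    then have "cinner x y = of_real s" by (metis cinner_commute complex_cnj_complex_of_real)
    with yx have "cinner (x - y) (x - y) = cinner x x - of_real s"
      by (simp add: cinner_diff_left cinner_diff_right)
    then have "(of_real ((norm (x - y))\<^sup>2) :: complex) = of_real ((norm x)\<^sup>2 - s)"
      by (simp only: cinner_self of_real_diff)
    then have "(norm (x - y))\<^sup>2 = (norm x)\<^sup>2 - s" by (simp only: of_real_eq_iff)
    then show ?thesis unfolding s_def using zero_le_power2[of "norm (x - y)"] by linarith
  qed
  then have "summable (\<lambda>i. (cmod (c i))\<^sup>2)"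
    by (intro summableI_nonneg_bounded[where x = "(norm x)\<^sup>2"]) auto
  then have "(\<lambda>i. (cmod (c i))\<^sup>2) \<longlonglongrightarrow> 0" by (rule summable_LIMSEQ_zero)
  then have "(\<lambda>i. sqrt ((cmod (c i))\<^sup>2)) \<longlonglongrightarrow> sqrt 0" by (rule tendsto_real_sqrt)
  then show ?thesis unfolding c_def by (simp add: tendsto_norm_zero_iff)
qed

section \<open>Projections and adjoints\<close>

text \<open>Serves projections, the Riesz theorem and the averaging argument; the last one depends
  on the uniqueness clause, which turns invariance of the set under an isometry into a fixed
  point.\<close>

lemma ex_min_norm:
  fixes S :: "'h::{real_inner,banach} set"
  assumes "closed S" "convex S" "S \<noteq> {}"
  obtains p where "p \<in> S" "\<And>y. y \<in> S \<Longrightarrow> norm p \<le> norm y" "\<And>q. q \<in> S \<Longrightarrow> norm q = norm p \<Longrightarrow> q = p"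
proof -
  define d where "d = Inf (norm ` S)"
  have bdd: "bdd_below (norm ` S)" by (rule bdd_belowI[of _ 0]) auto
  have d_le: "d \<le> norm y" if "y \<in> S" for y
    unfolding d_def using bdd that by (simp add: cInf_lower)
  have d0: "d \<ge> 0" unfolding d_def using assms(3) by (intro cInf_greatest) auto
  \<comment> \<open>Parallelogram law, with the midpoint in \<open>S\<close> and therefore of norm
    at least \<open>d\<close>. It gives both the Cauchy property of a minimising sequence and
    uniqueness.\<close>
  have par: "(norm (x - y))\<^sup>2 \<le> 2 * (norm x)\<^sup>2 + 2 * (norm y)\<^sup>2 - 4 * d\<^sup>2" if "x \<in> S" "y \<in> S" for x y
  proof -
    have "(1/2) *\<^sub>R x + (1/2) *\<^sub>R y \<in> S" using assms(2) that by (intro convexD) auto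
    then have "d \<le> norm ((1/2) *\<^sub>R (x + y))" using d_le by (simp add: scaleR_add_right)
    then have "2 * d \<le> norm (x + y)" by simp
    then have "(2 * d)\<^sup>2 \<le> (norm (x + y))\<^sup>2" using d0 by (intro power_mono) auto
    moreover have "(norm (x - y))\<^sup>2 + (norm (x + y))\<^sup>2 = 2 * (norm x)\<^sup>2 + 2 * (norm y)\<^sup>2"
      by (simp add: power2_norm_eq_inner inner_simps inner_commute)
    ultimately show ?thesis by (simp add: power_mult_distrib)
  qed
  have "\<exists>y\<in>S. norm y < d + 1 / real (Suc n)" for n
  proof -
    have "Inf (norm ` S) < d + 1 / real (Suc n)" by (simp add: d_def)
    then show ?thesis using cInf_lessD[of "norm ` S" "d + 1 / real (Suc n)"] assms(3) by auto
  qed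
  then obtain y where y: "\<And>n. y n \<in> S" "\<And>n. norm (y n) < d + 1 / real (Suc n)" by metis
  have yd: "(\<lambda>n. norm (y n)) \<longlonglongrightarrow> d"
  proof (rule real_tendsto_sandwich[of "\<lambda>_. d" _ _ "\<lambda>n. d + 1 / real (Suc n)"])
    show "(\<lambda>n. d + 1 / real (Suc n)) \<longlonglongrightarrow> d"
      using tendsto_add[OF tendsto_const LIMSEQ_Suc[OF lim_1_over_n], of d] by simp
  qed (use d_le y in \<open>auto simp: less_imp_le\<close>)
  have "Cauchy y"
  proof (rule metric_CauchyI)
    fix e :: real assume e: "e > 0"
    have "(\<lambda>n. (norm (y n))\<^sup>2 - d\<^sup>2) \<longlonglongrightarrow> 0" using tendsto_diff[OF tendsto_power[OF yd, of 2] tendsto_const[of "d\<^sup>2"]] by simp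
    then have "\<forall>\<^sub>F n in sequentially. (norm (y n))\<^sup>2 - d\<^sup>2 < e\<^sup>2 / 4"
      using e by (intro order_tendstoD) auto
    then obtain M where M: "\<And>n. n \<ge> M \<Longrightarrow> (norm (y n))\<^sup>2 - d\<^sup>2 < e\<^sup>2 / 4"
      unfolding eventually_sequentially by blast
    show "\<exists>M. \<forall>m\<ge>M. \<forall>n\<ge>M. dist (y m) (y n) < e"
    proof (intro exI allI impI)
      fix m n assume "m \<ge> M" "n \<ge> M"
      have "(norm (y m - y n))\<^sup>2 < e\<^sup>2"
        using par[OF y(1) y(1), of m n] M[OF \<open>m \<ge> M\<close>] M[OF \<open>n \<ge> M\<close>] by linarith
      then show "dist (y m) (y n) < e" using e by (simp add: dist_norm power2_less_imp_less)
    qed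
  qed
  then obtain p where p: "y \<longlonglongrightarrow> p" using Cauchy_convergent convergent_def by blast
  have pS: "p \<in> S" using closed_sequentially[OF assms(1)] y(1) p by blast
  have np: "norm p = d" using LIMSEQ_unique[OF tendsto_norm[OF p] yd] .
  show thesis
  proof (rule that[OF pS])
    show "norm p \<le> norm z" if "z \<in> S" for z using d_le[OF that] np by simp
    show "q = p" if "q \<in> S" "norm q = norm p" for q
      using par[OF that(1) pS] that np by simp
  qed
qed

lemma min_norm_orthogonal:
  fixes p k :: "'h::real_inner"
  assumes "\<And>t::real. norm p \<le> norm (p + t *\<^sub>R k)"
  shows "inner p k = 0"
proof (rule ccontr)
  assume ne: "inner p k \<noteq> 0"
  then have k: "inner k k > 0" by auto
  \<comment> \<open>This \<open>t\<close> minimises the quadratic polynomial that expresses the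
    squared norm of \<open>p + t k\<close>.\<close>
  define t where "t = - inner p k / inner k k"
  have "(norm p)\<^sup>2 \<le> (norm (p + t *\<^sub>R k))\<^sup>2" using assms by (intro power_mono) auto
  also have "\<dots> = (norm p)\<^sup>2 + 2 * t * inner p k + t\<^sup>2 * inner k k"
    unfolding power2_norm_eq_inner
    by (simp add: inner_simps inner_commute algebra_simps power2_eq_square)
  also have "\<dots> = (norm p)\<^sup>2 - (inner p k)\<^sup>2 / inner k k"
    using k by (simp add: t_def power2_eq_square field_simps)
  finally show False using ne k by (simp add: divide_le_0_iff)
qed

lemma ocomp_iff_inner:
  assumes "csubspace K" "\<And>k. k \<in> K \<Longrightarrow> inner x k = 0"
  shows "x \<in> ocomp K"
  unfolding ocomp_def
proof (intro CollectI ballI)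
  fix k assume k: "k \<in> K"
  then have "scaleC \<i> k \<in> K" using assms(1) by (auto simp: csubspace_def)
  then have "Im (cinner x k) = 0" using assms(2)[of "scaleC \<i> k"]
    by (simp add: inner_Re_cinner cinner_scaleC_right)
  moreover have "Re (cinner x k) = 0" using assms(2)[OF k] by (simp add: inner_Re_cinner)
  ultimately show "cinner x k = 0" by (simp add: complex_eq_iff)
qed

text \<open>The shortest vector \<open>x + k0\<close> of the translate of \<open>K\<close> by
  \<open>x\<close> is orthogonal to \<open>K\<close>, so \<open>- k0\<close> is the
  projection.\<close>

lemma ex_oproj:
  fixes K :: "'h::chilbert_space set"
  assumes "closed K" "csubspace K"
  shows "\<exists>!p. p \<in> K \<and> x - p \<in> ocomp K"
proof (rule ex_ex1I)
  let ?S = "(+) x ` K"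
  have "convex K" unfolding convex_def using assms(2) by (simp add: csubspace_def scaleR_scaleC)
  then have cv: "convex ?S" by (simp add: convex_translation)
  have "closed ?S" using assms(1) by (simp add: closed_translation)
  moreover note cv
  moreover have "?S \<noteq> {}" using assms(2) by (auto simp: csubspace_def)
  ultimately have "\<exists>q\<in>?S. \<forall>y\<in>?S. norm q \<le> norm y"
    by (rule ex_min_norm) blast
  then obtain q where q: "q \<in> ?S" "\<And>y. y \<in> ?S \<Longrightarrow> norm q \<le> norm y" by blast
  then obtain k0 where k0: "k0 \<in> K" "q = x + k0" by auto
  have "q \<in> ocomp K"
  proof (rule ocomp_iff_inner[OF assms(2)], rule min_norm_orthogonal)
    fix k t assume "k \<in> K"
    then have "k0 + t *\<^sub>R k \<in> K" using assms(2) k0 by (simp add: csubspace_def scaleR_scaleC)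
    then have "q + t *\<^sub>R k \<in> ?S" using k0 by (simp add: add.assoc)
    then show "norm q \<le> norm (q + t *\<^sub>R k)" by (rule q(2))
  qed
  then show "\<exists>p. p \<in> K \<and> x - p \<in> ocomp K"
    using k0 csubspace_diff[OF assms(2), of 0 k0] assms(2)
    by (intro exI[of _ "- k0"]) (auto simp: csubspace_def)
next
  fix p q assume p: "p \<in> K \<and> x - p \<in> ocomp K" and q: "q \<in> K \<and> x - q \<in> ocomp K"
  have "p - q \<in> K" using csubspace_diff[OF assms(2)] p q by blast
  then have "cinner (p - q) (p - q) = cinner (x - q) (p - q) - cinner (x - p) (p - q)"
    "cinner (x - q) (p - q) = 0" "cinner (x - p) (p - q) = 0"
    using p q by (auto simp: ocomp_def cinner_diff_left)
  then show "p = q" by (simp add: cinner_self)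
qed

lemma oproj_eqI:
  assumes "csubspace K" "p \<in> K" "x - p \<in> ocomp K"
  shows "oproj K x = p"
  unfolding oproj_def
proof (rule the_equality)
  fix q assume q: "q \<in> K \<and> x - q \<in> ocomp K"
  have "q - p \<in> K" using csubspace_diff[OF assms(1)] assms q by blast
  then have "cinner (q - p) (q - p) = cinner (x - p) (q - p) - cinner (x - q) (q - p)"
    "cinner (x - q) (q - p) = 0" "cinner (x - p) (q - p) = 0"
    using assms q by (auto simp: ocomp_def cinner_diff_left)
  then show "q = p" by (simp add: cinner_self)
qed (use assms in auto)

lemma oproj_UNIV: "oproj UNIV = id"
  by (rule ext, simp, rule oproj_eqI) (auto simp: csubspace_UNIV ocomp_def)

lemma ocomp_UNIV: "ocomp UNIV = {0}"
proof -
  have "x = 0" if "\<forall>y. cinner x y = 0" for x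
    using that[rule_format, of x] by (simp add: cinner_self)
  then show ?thesis unfolding ocomp_def by auto
qed

text \<open>The shortest vector on the hyperplane where the functional equals 1 is orthogonal to the
  kernel, and represents the functional after rescaling.\<close>

lemma ex_real_riesz:
  fixes \<phi> :: "'h::{real_inner,banach} \<Rightarrow> real"
  assumes "bounded_linear \<phi>"
  shows "\<exists>z. \<forall>x. \<phi> x = inner x z"
proof (cases "\<forall>x. \<phi> x = 0")
  case True
  then show ?thesis by (intro exI[of _ 0]) simp
next
  case False
  interpret bounded_linear \<phi> by fact
  obtain x0 where x0: "\<phi> x0 \<noteq> 0" using False by blast
  let ?S = "{x. \<phi> x = 1}"
  have "closed ?S" by (intro closed_Collect_eq continuous_intros bounded_linear.continuous_on[OF assms])
  moreover have "convex ?S" unfolding convex_def by (auto simp: add scaleR)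
  moreover have "?S \<noteq> {}" using x0 by (auto simp: scaleR intro!: exI[of _ "(1 / \<phi> x0) *\<^sub>R x0"])
  ultimately have "\<exists>p\<in>?S. \<forall>y\<in>?S. norm p \<le> norm y"
    by (rule ex_min_norm) blast
  then obtain p where p: "p \<in> ?S" "\<And>y. y \<in> ?S \<Longrightarrow> norm p \<le> norm y" by blast
  have ker: "inner p k = 0" if "\<phi> k = 0" for k
    using that p by (intro min_norm_orthogonal p(2)) (simp add: add scaleR)
  have "p \<noteq> 0" using p(1) zero by auto
  then have pp: "inner p p \<noteq> 0" by simp
  show ?thesis
  proof (intro exI allI)
    fix x
    have "\<phi> (x - \<phi> x *\<^sub>R p) = 0" using p(1) by (simp add: diff scaleR)
    then have "inner p (x - \<phi> x *\<^sub>R p) = 0" by (rule ker)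
    then have "inner p x = \<phi> x * inner p p" by (simp add: inner_simps)
    then show "\<phi> x = inner x ((1 / inner p p) *\<^sub>R p)" using pp by (simp add: inner_commute)
  qed
qed

text \<open>\<open>\<sigma>\<close> is the identity for linear and the conjugation for antilinear maps.\<close>

definition semilin :: "(complex \<Rightarrow> complex) \<Rightarrow> ('h::chilbert_space \<Rightarrow> 'h) \<Rightarrow> bool" where
  "semilin \<sigma> T \<longleftrightarrow> bounded_linear T \<and> (\<forall>c x. T (scaleC c x) = scaleC (\<sigma> c) (T x))"

abbreviation "clin \<equiv> semilin (\<lambda>c. c)"

lemma bops_UNIV: "bops UNIV = Collect clin"
  unfolding bops_def semilin_def ocomp_UNIV by (auto simp: bounded_linear.linear linear_0)

lemma semilinD:
  assumes "semilin \<sigma> T"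
  shows "bounded_linear T" "T (x + y) = T x + T y" "T (x - y) = T x - T y" "T (- x) = - T x"
    "T 0 = 0" "T (scaleC c x) = scaleC (\<sigma> c) (T x)" "T (r *\<^sub>R x) = r *\<^sub>R T x"
    "T (sum f A) = (\<Sum>i\<in>A. T (f i))"
  using assms unfolding semilin_def
  by (auto simp: bounded_linear.linear linear_add linear_diff linear_neg linear_0 linear_cmul linear_sum)

lemma semilin_tendsto: "semilin \<sigma> T \<Longrightarrow> (f \<longlongrightarrow> l) F \<Longrightarrow> ((\<lambda>i. T (f i)) \<longlongrightarrow> T l) F"
  unfolding semilin_def using bounded_linear.tendsto by blast

lemma semilin_continuous_on: "semilin \<sigma> T \<Longrightarrow> continuous_on A T"
  unfolding semilin_def using linear_continuous_on by blast

lemma semilin_comp: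
  assumes "semilin \<sigma> S" "semilin \<tau> T" "\<And>c. \<rho> c = \<sigma> (\<tau> c)"
  shows "semilin \<rho> (\<lambda>x. S (T x))"
  using assms unfolding semilin_def by (auto intro: bounded_linear_compose)

lemma semilin_id: "clin (\<lambda>x. x)"
  unfolding semilin_def by (simp add: bounded_linear_ident)

lemma semilin_add: "semilin \<sigma> S \<Longrightarrow> semilin \<sigma> T \<Longrightarrow> semilin \<sigma> (\<lambda>x. S x + T x)"
  unfolding semilin_def by (auto intro: bounded_linear_add simp: scaleC_add_right)

lemma semilin_diff: "semilin \<sigma> S \<Longrightarrow> semilin \<sigma> T \<Longrightarrow> semilin \<sigma> (\<lambda>x. S x - T x)"
  unfolding semilin_def by (auto intro: bounded_linear_sub simp: scaleC_diff_right)

lemma semilin_scaleC: "semilin \<sigma> T \<Longrightarrow> semilin \<sigma> (\<lambda>x. scaleC c (T x))"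
  unfolding semilin_def
  by (auto intro: bounded_linear_compose[OF bounded_linear_scaleC] simp: scaleC_scaleC mult.commute)

lemma semilin_scaleR: "semilin \<sigma> T \<Longrightarrow> semilin \<sigma> (\<lambda>x. r *\<^sub>R T x)"
  using semilin_scaleC[of \<sigma> T "of_real r"] by (simp add: scaleR_scaleC)

lemma semilin_zero: "semilin \<sigma> (\<lambda>x. 0)"
  unfolding semilin_def by (simp add: bounded_linear_zero)

lemma semilin_bound:
  assumes "semilin \<sigma> T" obtains B where "B \<ge> 0" "\<And>x. norm (T x) \<le> B * norm x"
  using bounded_linear.nonneg_bounded[of T] assms
  unfolding semilin_def by (metis mult.commute)

lemma semilin_eq_on_dense:
  assumes "semilin \<sigma> S" "semilin \<sigma> T" "closure (cspan D) = UNIV" "\<And>x. x \<in> D \<Longrightarrow> S x = T x"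
  shows "S x = T x"
proof -
  have "x \<in> {x. S x = T x}"
  proof (rule cspan_closure_induct[OF assms(3)])
    show "csubspace {x. S x = T x}"
      by (simp add: csubspace_def semilinD[OF assms(1)] semilinD[OF assms(2)])
    show "closed {x. S x = T x}"
      by (intro closed_Collect_eq semilin_continuous_on[OF assms(1)] semilin_continuous_on[OF assms(2)])
  qed (use assms(4) in auto)
  then show ?thesis by simp
qed

text \<open>Under a common bound the set of vectors where convergence holds is closed, by the usual
  splitting of the error into three parts.\<close>

lemma bounded_tendsto_on_dense:
  fixes c :: "nat \<Rightarrow> 'h::chilbert_space \<Rightarrow> 'h"
  assumes c: "\<And>k. clin (c k)" and l: "clin l" and B: "\<And>k x. norm (c k x) \<le> B * norm x"
    and dense: "closure (cspan D) = UNIV" and lim: "\<And>x. x \<in> D \<Longrightarrow> (\<lambda>k. c k x) \<longlonglongrightarrow> l x"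
  shows "(\<lambda>k. c k x) \<longlonglongrightarrow> l x"
proof -
  obtain B' where B': "B' \<ge> 0" "\<And>x. norm (l x) \<le> B' * norm x" using semilin_bound[OF l] by blast
  \<comment> \<open>The summand 1 keeps \<open>M\<close> positive, so that dividing by it is
    safe.\<close>
  define M where "M = \<bar>B\<bar> + B' + 1"
  have M: "M > 0" using B' by (simp add: M_def)
  let ?V = "{x. (\<lambda>k. c k x) \<longlonglongrightarrow> l x}"
  have "x \<in> ?V"
  proof (rule cspan_closure_induct[OF dense])
    have "(\<lambda>k. scaleC a (c k x)) \<longlonglongrightarrow> scaleC a (l x)" if "(\<lambda>k. c k x) \<longlonglongrightarrow> l x" for a x
      using bounded_linear.tendsto[OF bounded_linear_scaleC that, of a] .
    then show "csubspace ?V"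
      by (auto simp: csubspace_def semilinD[OF c] semilinD[OF l] intro: tendsto_add)
    show "closed ?V"
      unfolding closed_sequential_limits
    proof (intro allI impI)
      fix y z assume "(\<forall>n. y n \<in> ?V) \<and> y \<longlonglongrightarrow> z"
      then have y: "\<And>n. (\<lambda>k. c k (y n)) \<longlonglongrightarrow> l (y n)" "y \<longlonglongrightarrow> z" by auto
      have "(\<lambda>k. c k z) \<longlonglongrightarrow> l z"
      proof (rule LIMSEQ_I)
        fix r :: real assume r: "r > 0"
        then obtain n where n: "norm (y n - z) < r / (2 * M)"
          using LIMSEQ_D[OF y(2), of "r / (2 * M)"] M by auto
        obtain k0 where k0: "\<And>k. k \<ge> k0 \<Longrightarrow> norm (c k (y n) - l (y n)) < r / 2"
          using LIMSEQ_D[OF y(1)[of n], of "r / 2"] r by auto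
        have "norm (c k z - l z) < r" if "k \<ge> k0" for k
        proof -
          have "c k z - l z = (c k (y n) - l (y n)) - (c k (y n - z) - l (y n - z))"
            by (simp add: semilinD[OF c] semilinD[OF l])
          then have "norm (c k z - l z) \<le> norm (c k (y n) - l (y n)) + norm (c k (y n - z) - l (y n - z))"
            by (metis norm_triangle_ineq4)
          also have "norm (c k (y n - z) - l (y n - z)) \<le> B * norm (y n - z) + B' * norm (y n - z)"
            by (rule order_trans[OF norm_triangle_ineq4]) (intro add_mono B B')
          also have "\<dots> \<le> M * norm (y n - z)"
            using mult_right_mono[OF abs_ge_self[of B] norm_ge_zero[of "y n - z"]]
            by (simp add: M_def distrib_right add_increasing2)
          also have "\<dots> < r / 2" using n M by (simp add: field_simps)
          finally show ?thesis using k0[OF that] by linarith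
        qed
        then show "\<exists>k0. \<forall>k\<ge>k0. norm (c k z - l z) < r" by blast
      qed
      then show "z \<in> ?V" by simp
    qed
  qed (use lim in auto)
  then show ?thesis by simp
qed

lemma cinner_eq_on_dense:
  assumes "closure (cspan D) = UNIV" "\<And>y. y \<in> D \<Longrightarrow> cinner x y = cinner x' y"
  shows "x = x'"
proof (rule cinner_ext)
  fix y
  have "y \<in> {y. cinner x y = cinner x' y}"
  proof (rule cspan_closure_induct[OF assms(1)])
    show "csubspace {y. cinner x y = cinner x' y}"
      by (simp add: csubspace_def cinner_add_right cinner_scaleC_right)
    show "closed {y. cinner x y = cinner x' y}"
      by (intro closed_Collect_eq continuous_on_cinner continuous_intros)
  qed (use assms(2) in auto)
  then show "cinner x y = cinner x' y" by simp
qed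

lemma ex_adjoint:
  assumes "clin T"
  obtains S where "clin S" "\<And>x y. cinner (T x) y = cinner x (S y)"
proof -
  obtain B where B: "B \<ge> 0" "\<And>x. norm (T x) \<le> B * norm x" using semilin_bound[OF assms] by blast
  have "\<exists>z. \<forall>x. inner (T x) y = inner x z" for y
    using bounded_linear_compose[OF bounded_linear_inner_left semilinD(1)[OF assms]]
    by (intro ex_real_riesz)
  then obtain S where "\<And>x y. inner (T x) y = inner x (S y)" by metis
  then have S: "cinner (T x) y = cinner x (S y)" for x y
    by (rule cinner_eq_if_inner_eq) (rule semilinD(6)[OF assms])
  then have S': "cinner (S y) x = cinner y (T x)" for x y by (metis cinner_commute)
  have add: "S (x + y) = S x + S y" for x y
    by (rule cinner_ext) (simp add: S' cinner_add_left)
  have scale: "S (scaleC c x) = scaleC c (S x)" for c x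
    by (rule cinner_ext) (simp add: S' cinner_scaleC_left)
  have "norm (S y) \<le> norm y * B" for y
  proof (cases "S y = 0")
    case False
    have "of_real ((norm (S y))\<^sup>2) = cinner y (T (S y))" by (metis S' cinner_self)
    then have "(norm (S y))\<^sup>2 = cmod (cinner y (T (S y)))"
      by (metis abs_of_nonneg norm_of_real zero_le_power2)
    also have "\<dots> \<le> norm y * (B * norm (S y))"
      by (rule order_trans[OF norm_cinner_le]) (intro mult_left_mono B, simp)
    finally show ?thesis using False by (simp add: power2_eq_square mult.assoc[symmetric])
  qed (use B in simp)
  then have "clin S" unfolding semilin_def
    by (intro conjI bounded_linear_intro[where K = B]) (auto simp: add scale scaleR_scaleC)
  then show thesis using that S by blast
qed

lemma cadj_eqI:
  assumes "\<And>x y. cinner (T x) y = cinner x (S y)"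
  shows "cadj T = S"
  unfolding cadj_def
proof (rule the_equality)
  fix S' assume "\<forall>x y. cinner (T x) y = cinner x (S' y)"
  then show "S' = S" using assms by (intro ext cinner_ext) (metis cinner_commute)
qed (use assms in auto)

lemma
  assumes "clin T"
  shows clin_cadj: "clin (cadj T)" and cinner_cadj_right: "cinner x (cadj T y) = cinner (T x) y"
    and cinner_cadj_left: "cinner (cadj T y) x = cinner y (T x)"
proof -
  obtain S where S: "clin S" "\<And>x y. cinner (T x) y = cinner x (S y)" using ex_adjoint[OF assms] by blast
  have eq: "cadj T = S" using S(2) by (rule cadj_eqI)
  show "clin (cadj T)" "cinner x (cadj T y) = cinner (T x) y" using S eq by auto
  then show "cinner (cadj T y) x = cinner y (T x)" by (metis cinner_commute)
qed

lemma cadj_cadj: "clin T \<Longrightarrow> cadj (cadj T) = T"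
  by (rule cadj_eqI) (simp add: cinner_cadj_left)

lemma cadj_comp: "clin S \<Longrightarrow> clin T \<Longrightarrow> cadj (S \<circ> T) = cadj T \<circ> cadj S"
  by (rule cadj_eqI) (simp add: cinner_cadj_right)

section \<open>Extension from total families\<close>

text \<open>Lists of coefficients and indices, rather than functions on a set of vectors: the family
  may take a value more than once, and a map prescribed on indices acts on such lists without any
  question of well-definedness.\<close>

definition lincomb :: "('i \<Rightarrow> 'h::chilbert_space) \<Rightarrow> (complex \<times> 'i) list \<Rightarrow> 'h" where
  "lincomb w l = sum_list (map (\<lambda>(c, i). scaleC c (w i)) l)"

lemma lincomb_simps [simp]:
  "lincomb w [] = 0" "lincomb w ((c, i) # l) = scaleC c (w i) + lincomb w l"
  "lincomb w (l @ l') = lincomb w l + lincomb w l'"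
  by (simp_all add: lincomb_def)

lemma cinner_lincomb:
  "cinner (lincomb w l) (lincomb w l') =
     (\<Sum>(c, i)\<leftarrow>l. \<Sum>(d, j)\<leftarrow>l'. c * cnj d * cinner (w i) (w j))"
proof (induction l)
  case (Cons p l)
  obtain c i where p: "p = (c, i)" by fastforce
  have "cinner (scaleC c (w i)) (lincomb w l') = (\<Sum>(d, j)\<leftarrow>l'. c * cnj d * cinner (w i) (w j))"
    by (induction l') (auto simp: cinner_add_right cinner_scaleC_left cinner_scaleC_right algebra_simps)
  then show ?case using Cons by (simp add: p cinner_add_left)
qed simp

lemma cspan_subset_lincomb:
  "cspan (w ` I) \<subseteq> {lincomb w l | l. snd ` set l \<subseteq> I}"
proof (rule cspan_subset)
  show "csubspace {lincomb w l |l. snd ` set l \<subseteq> I}"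
    unfolding csubspace_def
  proof (intro conjI ballI allI)
    show "0 \<in> {lincomb w l |l. snd ` set l \<subseteq> I}" by (intro CollectI exI[of _ "[]"]) simp
  next
    fix x y assume "x \<in> {lincomb w l |l. snd ` set l \<subseteq> I}" "y \<in> {lincomb w l |l. snd ` set l \<subseteq> I}"
    then obtain l l' where "x = lincomb w l" "y = lincomb w l'" "snd ` set l \<subseteq> I" "snd ` set l' \<subseteq> I" by blast
    then show "x + y \<in> {lincomb w l |l. snd ` set l \<subseteq> I}"
      by (intro CollectI exI[of _ "l @ l'"]) auto
  next
    fix c x assume "x \<in> {lincomb w l |l. snd ` set l \<subseteq> I}"
    then obtain l where l: "x = lincomb w l" "snd ` set l \<subseteq> I" by blast
    have "scaleC c (lincomb w l) = lincomb w (map (\<lambda>(d, i). (c * d, i)) l)"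
      by (induction l) (auto simp: scaleC_add_right scaleC_scaleC)
    then show "scaleC c x \<in> {lincomb w l |l. snd ` set l \<subseteq> I}"
      using l by (intro CollectI exI[of _ "map (\<lambda>(d, i). (c * d, i)) l"]) force
  qed
  show "w ` I \<subseteq> {lincomb w l |l. snd ` set l \<subseteq> I}"
  proof
    fix x assume "x \<in> w ` I"
    then obtain i where "i \<in> I" "x = w i" by blast
    then show "x \<in> {lincomb w l |l. snd ` set l \<subseteq> I}" by (intro CollectI exI[of _ "[(1, i)]"]) simp
  qed
qed

text \<open>The summand with \<open>u\<close> allows for operators that are not isometric: for the creation operators
  it is the annihilation part in the anticommutation relations.\<close>

lemma ex_semilin_extension:
  fixes w v u :: "'i \<Rightarrow> 'h::chilbert_space"
  assumes dense: "closure (cspan (w ` I)) = UNIV"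
    and \<sigma>: "\<sigma> = (\<lambda>c. c) \<or> \<sigma> = cnj" and N: "N \<ge> 0"
    and gram: "\<And>i j. i \<in> I \<Longrightarrow> j \<in> I \<Longrightarrow>
      cinner (v i) (v j) + cinner (u i) (u j) = of_real N * \<sigma> (cinner (w i) (w j))"
  obtains T where "semilin \<sigma> T" "\<And>i. i \<in> I \<Longrightarrow> T (w i) = v i" "\<And>x. norm (T x) \<le> sqrt N * norm x"
proof -
  have \<sigma>_simps: "\<sigma> (a + b) = \<sigma> a + \<sigma> b" "\<sigma> (a * b) = \<sigma> a * \<sigma> b" "\<sigma> (cnj a) = cnj (\<sigma> a)"
    "\<sigma> 0 = 0" "\<sigma> 1 = 1" "\<sigma> (of_real r) = of_real r" for a b r using \<sigma> by auto
  define lv where "lv y l = lincomb y (map (\<lambda>(c, i). (\<sigma> c, i)) l)" for y :: "'i \<Rightarrow> 'h" and l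
  have gram_l: "cinner (lv v l) (lv v l') + cinner (lv u l) (lv u l')
      = of_real N * \<sigma> (cinner (lincomb w l) (lincomb w l'))"
    if "snd ` set l \<subseteq> I" "snd ` set l' \<subseteq> I" for l l'
    unfolding lv_def cinner_lincomb using that(1)
  proof (induction l)
    case (Cons p l)
    obtain c i where p: "p = (c, i)" by fastforce
    have i: "i \<in> I" using Cons.prems p by auto
    have "(\<Sum>(d, j)\<leftarrow>map (\<lambda>(c, i). (\<sigma> c, i)) l'. \<sigma> c * cnj d * cinner (v i) (v j))
       + (\<Sum>(d, j)\<leftarrow>map (\<lambda>(c, i). (\<sigma> c, i)) l'. \<sigma> c * cnj d * cinner (u i) (u j))
       = of_real N * \<sigma> (\<Sum>(d, j)\<leftarrow>l'. c * cnj d * cinner (w i) (w j))"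
      using that(2)
    proof (induction l')
      case (Cons q l')
      obtain d j where q: "q = (d, j)" by fastforce
      have j: "j \<in> I" using Cons.prems q by auto
      have "\<sigma> c * cnj (\<sigma> d) * cinner (v i) (v j) + \<sigma> c * cnj (\<sigma> d) * cinner (u i) (u j)
        = \<sigma> c * cnj (\<sigma> d) * (of_real N * \<sigma> (cinner (w i) (w j)))"
        by (subst gram[OF i j, symmetric]) (simp add: algebra_simps)
      then show ?case using Cons by (simp add: q \<sigma>_simps algebra_simps)
    qed (simp add: \<sigma>_simps)
    then show ?case using Cons by (simp add: p \<sigma>_simps algebra_simps)
  qed (simp add: \<sigma>_simps)
  have lv_bound: "norm (lv v l) \<le> sqrt N * norm (lincomb w l)" if "snd ` set l \<subseteq> I" for l
  proof -
    have "of_real ((norm (lv v l))\<^sup>2 + (norm (lv u l))\<^sup>2) = (of_real (N * (norm (lincomb w l))\<^sup>2) :: complex)"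
      using gram_l[OF that that] by (simp only: cinner_self \<sigma>_simps of_real_add of_real_mult)
    then have "(norm (lv v l))\<^sup>2 + (norm (lv u l))\<^sup>2 = N * (norm (lincomb w l))\<^sup>2"
      by (simp only: of_real_eq_iff)
    then have "(norm (lv v l))\<^sup>2 \<le> N * (norm (lincomb w l))\<^sup>2" using zero_le_power2[of "norm (lv u l)"] by linarith
    then show ?thesis by (metis norm_ge_zero real_sqrt_le_mono real_sqrt_mult real_sqrt_abs abs_of_nonneg)
  qed
  define G where "G = {(lincomb w l, lv v l) | l. snd ` set l \<subseteq> I}"
  have G_add: "(x + x', y + y') \<in> G" if xy: "(x, y) \<in> G" "(x', y') \<in> G" for x y x' y'
  proof -
    obtain l l' where "(x, y) = (lincomb w l, lv v l)" "(x', y') = (lincomb w l', lv v l')"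
      "snd ` set l \<subseteq> I" "snd ` set l' \<subseteq> I" using xy unfolding G_def by blast
    then show ?thesis unfolding G_def
      by (intro CollectI exI[of _ "l @ l'"]) (auto simp: lv_def)
  qed
  have G_scale: "(scaleC c x, scaleC (\<sigma> c) y) \<in> G" if xy: "(x, y) \<in> G" for c x y
  proof -
    obtain l where l: "x = lincomb w l" "y = lv v l" "snd ` set l \<subseteq> I" using xy unfolding G_def by blast
    have "scaleC c (lincomb w l) = lincomb w (map (\<lambda>(d, i). (c * d, i)) l)"
      "scaleC (\<sigma> c) (lv v l) = lv v (map (\<lambda>(d, i). (c * d, i)) l)"
      unfolding lv_def by (induction l) (auto simp: scaleC_add_right scaleC_scaleC \<sigma>_simps)
    then show ?thesis using l unfolding G_def
      by (intro CollectI exI[of _ "map (\<lambda>(d, i). (c * d, i)) l"]) force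
  qed
  \<comment> \<open>The closure of the graph \<open>G\<close>. The norm bound applied to differences
    makes it single-valued, and completeness together with density makes it total.\<close>
  define R where "R x y \<longleftrightarrow> (\<exists>f g. (\<forall>n. (f n, g n) \<in> G) \<and> f \<longlonglongrightarrow> x \<and> g \<longlonglongrightarrow> y)" for x y
  have G_bound: "norm y \<le> sqrt N * norm x" if "(x, y) \<in> G" for x y
    using that lv_bound unfolding G_def by auto
  have R_bound: "norm y \<le> sqrt N * norm x" if "R x y" for x y
  proof -
    obtain f g where fg: "\<And>n. (f n, g n) \<in> G" "f \<longlonglongrightarrow> x" "g \<longlonglongrightarrow> y" using \<open>R x y\<close> unfolding R_def by blast
    show ?thesis
      by (rule LIMSEQ_le[OF tendsto_norm[OF fg(3)] tendsto_mult_left[OF tendsto_norm[OF fg(2)]]])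
        (use fg(1) G_bound in auto)
  qed
  have R_add: "R (x + x') (y + y')" if "R x y" "R x' y'" for x y x' y'
  proof -
    obtain f g where fg: "\<And>n. (f n, g n) \<in> G" "f \<longlonglongrightarrow> x" "g \<longlonglongrightarrow> y" using \<open>R x y\<close> unfolding R_def by blast
    obtain f' g' where fg': "\<And>n. (f' n, g' n) \<in> G" "f' \<longlonglongrightarrow> x'" "g' \<longlonglongrightarrow> y'" using \<open>R x' y'\<close> unfolding R_def by blast
    show ?thesis unfolding R_def
      by (rule exI[of _ "\<lambda>n. f n + f' n"], rule exI[of _ "\<lambda>n. g n + g' n"])
        (use fg fg' G_add in \<open>auto intro: tendsto_add\<close>)
  qed
  have R_scale: "R (scaleC c x) (scaleC (\<sigma> c) y)" if "R x y" for c x y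
  proof -
    obtain f g where fg: "\<And>n. (f n, g n) \<in> G" "f \<longlonglongrightarrow> x" "g \<longlonglongrightarrow> y" using \<open>R x y\<close> unfolding R_def by blast
    show ?thesis unfolding R_def
      by (rule exI[of _ "\<lambda>n. scaleC c (f n)"], rule exI[of _ "\<lambda>n. scaleC (\<sigma> c) (g n)"])
        (use fg G_scale in \<open>auto intro: bounded_linear.tendsto[OF bounded_linear_scaleC]\<close>)
  qed
  have R_unique: "y = y'" if "R x y" "R x y'" for x y y'
  proof -
    have "R (scaleC (-1) x) (scaleC (-1) y')" using R_scale[OF that(2), of "-1"] \<sigma> by auto
    from R_bound[OF R_add[OF that(1) this]] show ?thesis by (simp add: scaleC_minus_left)
  qed
  have R_ex: "\<exists>y. R x y" for x
  proof -
    have "x \<in> closure {lincomb w l | l. snd ` set l \<subseteq> I}"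
      using dense closure_mono[OF cspan_subset_lincomb[of w I]] by auto
    then obtain f where f: "\<And>n. f n \<in> {lincomb w l | l. snd ` set l \<subseteq> I}" "f \<longlonglongrightarrow> x"
      unfolding closure_sequential by blast
    then have "\<forall>n. \<exists>l. f n = lincomb w l \<and> snd ` set l \<subseteq> I" by blast
    then obtain l where l: "\<And>n. f n = lincomb w (l n)" "\<And>n. snd ` set (l n) \<subseteq> I" by metis
    define g where "g n = lv v (l n)" for n
    have G: "(f n, g n) \<in> G" for n unfolding G_def g_def l(1) using l(2) by blast
    have diff: "norm (g m - g n) \<le> sqrt N * norm (f m - f n)" for m n
    proof -
      have "(f m + scaleC (-1) (f n), g m + scaleC (-1) (g n)) \<in> G"
        using G_add[OF G[of m] G_scale[OF G[of n], of "-1"]] \<sigma> by auto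
      then show ?thesis using G_bound by (fastforce simp: scaleC_minus_left)
    qed
    have "Cauchy g"
    proof (rule CauchyI)
      fix e :: real assume e: "e > 0"
      have "Cauchy f" using f(2) LIMSEQ_imp_Cauchy by blast
      then obtain M where M: "\<And>m n. m \<ge> M \<Longrightarrow> n \<ge> M \<Longrightarrow> norm (f m - f n) < e / (sqrt N + 1)"
        using CauchyD[of f "e / (sqrt N + 1)"] e N by (auto simp: add_nonneg_pos)
      have "norm (g m - g n) < e" if "m \<ge> M" "n \<ge> M" for m n
      proof -
        have "norm (g m - g n) \<le> (sqrt N + 1) * norm (f m - f n)"
          using diff[of m n] by (simp add: algebra_simps add.commute add_increasing)
        also have "\<dots> < e" using M[OF that] N by (simp add: pos_less_divide_eq add_nonneg_pos mult.commute)
        finally show ?thesis .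
      qed
      then show "\<exists>M. \<forall>m\<ge>M. \<forall>n\<ge>M. norm (g m - g n) < e" by blast
    qed
    then obtain y where "g \<longlonglongrightarrow> y" using Cauchy_convergent convergent_def by blast
    then have "R x y" unfolding R_def using G f(2) by blast
    then show ?thesis by blast
  qed
  then obtain T where T: "\<And>x. R x (T x)" by metis
  have T_add: "T (x + y) = T x + T y" for x y using R_unique[OF T R_add[OF T T]] .
  have T_scale: "T (scaleC c x) = scaleC (\<sigma> c) (T x)" for c x using R_unique[OF T R_scale[OF T]] .
  have T_bound: "norm (T x) \<le> sqrt N * norm x" for x using R_bound[OF T] .
  have "semilin \<sigma> T" unfolding semilin_def
    by (intro conjI bounded_linear_intro[where K = "sqrt N"])
      (use T_bound in \<open>auto simp: T_add T_scale scaleR_scaleC \<sigma>_simps mult.commute\<close>)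
  moreover have "T (w i) = v i" if "i \<in> I" for i
  proof (rule R_unique[OF T])
    have "(w i, v i) \<in> G" unfolding G_def
      by (rule CollectI, rule exI[of _ "[(1, i)]"]) (simp add: lv_def \<sigma>_simps that)
    then show "R (w i) (v i)" unfolding R_def
      by (intro exI[of _ "\<lambda>_. w i"] exI[of _ "\<lambda>_. v i"]) auto
  qed
  ultimately show thesis using that T_bound by blast
qed

section \<open>Square-integrable functions\<close>

lemma L2r_integrable_inner:
  assumes "f \<in> L2r" "g \<in> L2r"
  shows "integrable halfline (\<lambda>s. inner (f s) (g s))"
proof (rule Bochner_Integration.integrable_bound)
  show "integrable halfline (\<lambda>s. (norm (f s))\<^sup>2 + (norm (g s))\<^sup>2)"
    using assms by (auto simp: L2r_def)
  show "(\<lambda>s. inner (f s) (g s)) \<in> borel_measurable halfline"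
    using assms by (auto simp: L2r_def intro: borel_measurable_inner)
  show "AE s in halfline. norm (inner (f s) (g s)) \<le> norm ((norm (f s))\<^sup>2 + (norm (g s))\<^sup>2)"
  proof (rule AE_I2)
    fix s
    have "0 \<le> (norm (f s) - norm (g s))\<^sup>2" by simp
    then have "2 * (norm (f s) * norm (g s)) \<le> (norm (f s))\<^sup>2 + (norm (g s))\<^sup>2"
      by (simp add: power2_diff)
    moreover have "\<bar>inner (f s) (g s)\<bar> \<le> norm (f s) * norm (g s)" by (rule Cauchy_Schwarz_ineq2)
    moreover have "0 \<le> norm (f s) * norm (g s)" by simp
    ultimately show "norm (inner (f s) (g s)) \<le> norm ((norm (f s))\<^sup>2 + (norm (g s))\<^sup>2)" by simp
  qed
qed

lemma L2r_zero: "(\<lambda>s. 0) \<in> L2r"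
  by (simp add: L2r_def)

lemma L2r_scaleR: "f \<in> L2r \<Longrightarrow> (\<lambda>s. r *\<^sub>R f s) \<in> L2r"
  by (auto simp: L2r_def power_mult_distrib)

lemma L2c_of_real_fun: "f \<in> L2r \<Longrightarrow> of_real_fun f \<in> L2c"
  by (simp add: L2c_def of_real_fun_def L2r_zero)

definition re_part :: "(real \<Rightarrow> 'k::{real_inner,banach,second_countable_topology} \<times> 'k) \<Rightarrow> real \<Rightarrow> 'k" where
  "re_part f s = fst (f s)"

definition im_part :: "(real \<Rightarrow> 'k::{real_inner,banach,second_countable_topology} \<times> 'k) \<Rightarrow> real \<Rightarrow> 'k" where
  "im_part f s = snd (f s)"

definition cconj :: "(real \<Rightarrow> 'k::{real_inner,banach,second_countable_topology} \<times> 'k) \<Rightarrow> real \<Rightarrow> 'k \<times> 'k" where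
  "cconj f s = (fst (f s), - snd (f s))"

lemma L2r_re_part: "f \<in> L2c \<Longrightarrow> re_part f \<in> L2r"
  and L2r_im_part: "f \<in> L2c \<Longrightarrow> im_part f \<in> L2r"
  by (simp_all add: L2c_def re_part_def[abs_def] im_part_def[abs_def])

lemma L2c_cconj: "f \<in> L2c \<Longrightarrow> cconj f \<in> L2c"
  using L2r_scaleR[of "\<lambda>s. snd (f s)" "-1"] by (simp add: L2c_def cconj_def)

lemma cconj_cconj [simp]: "cconj (cconj f) = f"
  by (rule ext) (simp add: cconj_def)

lemma cconj_of_real_fun [simp]: "cconj (of_real_fun f) = of_real_fun f"
  by (rule ext) (simp add: cconj_def of_real_fun_def)

lemma L2c_inner_commute: "L2c_inner g f = cnj (L2c_inner f g)"
proof -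
  have "(LINT s|halfline. inner (snd (g s)) (fst (f s)) - inner (fst (g s)) (snd (f s)))
      = (LINT s|halfline. - (inner (snd (f s)) (fst (g s)) - inner (fst (f s)) (snd (g s))))"
    by (rule Bochner_Integration.integral_cong) (simp_all add: inner_commute)
  also have "\<dots> = - (LINT s|halfline. inner (snd (f s)) (fst (g s)) - inner (fst (f s)) (snd (g s)))"
    by (rule integral_minus)
  finally show ?thesis unfolding L2c_inner_def by (simp add: complex_eq_iff inner_commute)
qed

lemma L2c_inner_cconj: "L2c_inner (cconj f) (cconj g) = cnj (L2c_inner f g)"
proof -
  have "(LINT s|halfline. - inner (snd (f s)) (fst (g s)) + inner (fst (f s)) (snd (g s)))
      = (LINT s|halfline. - (inner (snd (f s)) (fst (g s)) - inner (fst (f s)) (snd (g s))))"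
    by (rule Bochner_Integration.integral_cong) simp_all
  also have "\<dots> = - (LINT s|halfline. inner (snd (f s)) (fst (g s)) - inner (fst (f s)) (snd (g s)))"
    by (rule integral_minus)
  finally show ?thesis unfolding L2c_inner_def cconj_def by (simp add: complex_eq_iff)
qed

lemma L2c_inner_self:
  obtains N where "N \<ge> 0" "L2c_inner f f = of_real N"
proof
  show "0 \<le> (LINT s|halfline. inner (fst (f s)) (fst (f s)) + inner (snd (f s)) (snd (f s)))"
    by (rule integral_nonneg_AE) simp
  show "L2c_inner f f = of_real (LINT s|halfline. inner (fst (f s)) (fst (f s)) + inner (snd (f s)) (snd (f s)))"
    unfolding L2c_inner_def by (simp add: complex_eq_iff inner_commute)
qed

lemma L2c_inner_of_real_fun:
  "L2c_inner (of_real_fun f) (of_real_fun g) = of_real (LINT s|halfline. inner (f s) (g s))"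
  unfolding L2c_inner_def of_real_fun_def by (simp add: complex_eq_iff)

lemma L2c_inner_of_real_fun_commute:
  "L2c_inner (of_real_fun f) (of_real_fun g) = L2c_inner (of_real_fun g) (of_real_fun f)"
  by (simp add: L2c_inner_of_real_fun inner_commute)

lemma L2c_inner_re_im:
  assumes "f \<in> L2c" "k \<in> L2c"
  shows "L2c_inner f k = L2c_inner (of_real_fun (re_part f)) k + \<i> * L2c_inner (of_real_fun (im_part f)) k"
proof -
  have "integrable halfline (\<lambda>s. inner (fst (f s)) (fst (k s)))"
    "integrable halfline (\<lambda>s. inner (snd (f s)) (fst (k s)))"
    "integrable halfline (\<lambda>s. inner (fst (f s)) (snd (k s)))"
    "integrable halfline (\<lambda>s. inner (snd (f s)) (snd (k s)))"
    using assms by (auto simp: L2c_def intro!: L2r_integrable_inner)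
  then show ?thesis
    unfolding L2c_inner_def of_real_fun_def re_part_def im_part_def by (simp add: complex_eq_iff)
qed

lemma L2c_inner_scaleR:
  "L2c_inner (of_real_fun (\<lambda>s. r *\<^sub>R f s)) k = of_real r * L2c_inner (of_real_fun f) k"
proof -
  have "(LINT s|halfline. - (r * inner (f s) (snd (k s)))) = - (r * (LINT s|halfline. inner (f s) (snd (k s))))"
    by simp
  then show ?thesis unfolding L2c_inner_def of_real_fun_def by (simp add: complex_eq_iff)
qed

text \<open>The function is extended by zero to the whole line, where its shift is a translation
  that preserves Lebesgue measure.\<close>

lemma shift_L2r:
  fixes f :: "real \<Rightarrow> 'k::{real_inner,banach,second_countable_topology}"
  assumes "f \<in> L2r" "t \<ge> 0"
  shows "shift t f \<in> L2r"
proof -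
  define F where "F x = indicator {0..} x *\<^sub>R f x" for x
  have shift: "indicator {0..} s *\<^sub>R shift t f s = F (s - t)" for s
    using assms(2) by (auto simp: F_def shift_def indicator_def)
  have F: "F \<in> borel_measurable lborel"
    using assms(1) unfolding L2r_def F_def by (simp add: borel_measurable_restrict_space_iff)
  then have "(\<lambda>s. F (s - t)) \<in> borel_measurable lborel" by simp
  then have meas: "shift t f \<in> borel_measurable halfline"
    by (simp add: borel_measurable_restrict_space_iff shift)
  have "integrable lborel (\<lambda>x. indicator {0..} x *\<^sub>R (norm (f x))\<^sup>2)"
    using assms(1) unfolding L2r_def by (simp add: integrable_restrict_space)
  moreover have "indicator {0..} x *\<^sub>R (norm (f x))\<^sup>2 = (norm (F x))\<^sup>2" for x
    by (simp add: F_def indicator_def)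
  ultimately have "integrable lborel (\<lambda>x. (norm (F x))\<^sup>2)" by simp
  from lborel_integrable_real_affine[OF this, of 1 "- t"]
  have "integrable lborel (\<lambda>x. (norm (F (x - t)))\<^sup>2)" by (simp add: add.commute)
  moreover have "indicator {0..} x *\<^sub>R (norm (shift t f x))\<^sup>2 = (norm (F (x - t)))\<^sup>2" for x
    unfolding shift[symmetric] by (simp add: indicator_def)
  ultimately have "integrable halfline (\<lambda>x. (norm (shift t f x))\<^sup>2)"
    by (simp add: integrable_restrict_space)
  with meas show ?thesis by (simp add: L2r_def)
qed

text \<open>Multiples of \<open>e\<close> by indicators of disjoint unit intervals: shifting only
  moves the intervals, so the sequence is infinite whatever the dimension of the one-particle
  space.\<close>

lemma shifted_orthonormal_sequence:
  fixes e :: "'k::{real_inner,banach,second_countable_topology}"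
  assumes "norm e = 1" "t \<ge> 0"
  obtains f :: "nat \<Rightarrow> real \<Rightarrow> 'k" where "\<And>i. f i \<in> L2r"
    "\<And>i j. L2c_inner (of_real_fun (shift t (f i))) (of_real_fun (shift t (f j))) = (if i = j then 1 else 0)"
proof
  define f where "f i s = indicator {real i..<real i + 1} s *\<^sub>R e" for i s
  have int: "integrable halfline (indicator {a..<a + 1} :: real \<Rightarrow> real)" if "a \<ge> 0" for a :: real
  proof -
    have "(\<lambda>x. indicator {0..} x *\<^sub>R indicator {a..<a + 1} x) = (indicator {a..<a + 1} :: real \<Rightarrow> real)"
      using that by (auto simp: indicator_def)
    moreover have "integrable lborel (indicator {a..<a + 1} :: real \<Rightarrow> real)"
      by (rule integrable_real_indicator) auto
    ultimately show ?thesis by (simp add: integrable_restrict_space)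
  qed
  show "f i \<in> L2r" for i
  proof -
    have "(\<lambda>s. (norm (f i s))\<^sup>2) = indicator {real i..<real i + 1}"
      by (auto simp: f_def indicator_def assms(1))
    moreover have "f i \<in> borel_measurable borel" unfolding f_def[abs_def] by simp
    then have "f i \<in> borel_measurable halfline"
      by (intro measurable_restrict_space1) simp
    ultimately show ?thesis using int[of "real i"] by (simp add: L2r_def)
  qed
  fix i j
  have ee: "inner e e = 1" using assms(1) by (simp add: norm_eq_1)
  show "L2c_inner (of_real_fun (shift t (f i))) (of_real_fun (shift t (f j))) = (if i = j then 1 else 0)"
  proof (cases "i = j")
    case True
    have "(LINT s|halfline. inner (shift t (f i) s) (shift t (f i) s))
        = (LINT s|lborel. indicator {0..} s *\<^sub>R inner (shift t (f i) s) (shift t (f i) s))"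
      by (simp add: integral_restrict_space)
    also have "(\<lambda>s. indicator {0..} s *\<^sub>R inner (shift t (f i) s) (shift t (f i) s))
        = (indicator {t + real i..<t + real i + 1} :: real \<Rightarrow> real)"
      using assms(2) by (intro ext) (auto simp: f_def shift_def indicator_def ee)
    finally show ?thesis using True by (simp add: L2c_inner_of_real_fun)
  next
    case False
    then have "real i + 1 \<le> real j \<or> real j + 1 \<le> real i" by linarith
    then have "(\<lambda>s. inner (shift t (f i) s) (shift t (f j) s)) = (\<lambda>s. 0)"
      by (auto simp: f_def shift_def indicator_def)
    then show ?thesis using False by (simp add: L2c_inner_of_real_fun)
  qed
qed

lemma ex_unit_vector:
  assumes "hilbert_dim TYPE('k::{real_inner,banach,second_countable_topology}) n" "n \<ge> 1"
  obtains e :: "'k::{real_inner,banach,second_countable_topology}" where "norm e = 1"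
proof -
  obtain B :: "'k::{real_inner,banach,second_countable_topology} set" where B: "\<forall>a\<in>B. \<forall>b\<in>B. inner a b = (if a = b then 1 else 0)"
    "n = (if finite B then enat (card B) else \<infinity>)"
    using assms(1) unfolding hilbert_dim_def by blast
  have "B \<noteq> {}" using B(2) assms(2) by (auto simp: one_enat_def zero_enat_def)
  then obtain e where "e \<in> B" by blast
  then have "inner e e = 1" using B(1) by simp
  then show thesis using that by (simp add: norm_eq_1)
qed

section \<open>Operators on the antisymmetric Fock space\<close>

definition delete_nth :: "nat \<Rightarrow> 'a list \<Rightarrow> 'a list" where
  "delete_nth j xs = take j xs @ drop (Suc j) xs"

lemma delete_nth_simps [simp]:
  "delete_nth 0 (x # xs) = xs" "delete_nth (Suc j) (x # xs) = x # delete_nth j xs"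
  by (simp_all add: delete_nth_def)

lemma length_delete_nth [simp]: "j < length xs \<Longrightarrow> length (delete_nth j xs) = length xs - 1"
  by (simp add: delete_nth_def)

lemma nth_delete_nth:
  "j < length xs \<Longrightarrow> k < length xs - 1 \<Longrightarrow> delete_nth j xs ! k = xs ! (if k < j then k else Suc k)"
  by (auto simp: delete_nth_def nth_append min_def)

lemma delete_nth_lists: "xs \<in> lists X \<Longrightarrow> delete_nth j xs \<in> lists X"
  unfolding delete_nth_def by (metis append_in_lists_conv append_take_drop_id)

text \<open>The sign of the reversal of \<open>m\<close> letters.\<close>

fun rev_sign :: "nat \<Rightarrow> complex" where
  "rev_sign 0 = 1"
| "rev_sign (Suc m) = (-1) ^ m * rev_sign m"

lemma rev_sign_square [simp]: "rev_sign m * rev_sign m = 1"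
  by (induction m) (simp_all add: algebra_simps power_mult_distrib[symmetric] flip: mult.assoc power_add mult_2)

lemma rev_sign_cancel [simp]: "rev_sign m * (rev_sign m * x) = x"
  by (simp flip: mult.assoc)

lemma cnj_rev_sign [simp]: "cnj (rev_sign m) = rev_sign m"
  by (induction m) simp_all

locale fock =
  fixes w :: "(real \<Rightarrow> 'k::{real_inner,banach,second_countable_topology} \<times> 'k) list \<Rightarrow> 'h::chilbert_space"
  assumes fock: "antisym_fock w"
begin

declare in_listsD [rule del] in_listsI [rule del]

lemma total: "closure (cspan (w ` lists L2c)) = UNIV"
  using fock by (simp add: antisym_fock_def)

lemma gram: "fs \<in> lists L2c \<Longrightarrow> gs \<in> lists L2c \<Longrightarrow> length fs = length gs \<Longrightarrow>
    cinner (w fs) (w gs) = Determinant.det (Matrix.mat (length gs) (length gs) (\<lambda>(i, j). L2c_inner (fs ! i) (gs ! j)))"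
  and gram_zero: "fs \<in> lists L2c \<Longrightarrow> gs \<in> lists L2c \<Longrightarrow> length fs \<noteq> length gs \<Longrightarrow> cinner (w fs) (w gs) = 0"
  using fock unfolding antisym_fock_def by auto

text \<open>Laplace expansion of the Gram determinant along the row of \<open>f\<close>; if the
  particle numbers do not match, both sides vanish.\<close>

lemma cinner_w_Cons:
  assumes f: "f \<in> L2c" and gs: "gs \<in> lists L2c" and hs: "hs \<in> lists L2c"
  shows "cinner (w (f # gs)) (w hs) =
    (\<Sum>j<length hs. (-1) ^ j * L2c_inner f (hs ! j) * cinner (w gs) (w (delete_nth j hs)))"
proof (cases "length hs = Suc (length gs)")
  case False
  have "cinner (w gs) (w (delete_nth j hs)) = 0" if "j < length hs" for j
    using False that by (intro gram_zero gs delete_nth_lists hs) auto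
  then show ?thesis using gram_zero[of "f # gs" hs] False f gs hs by auto
next
  case True
  let ?n = "length gs"
  define M where "M = Matrix.mat (Suc ?n) (Suc ?n) (\<lambda>(i, j). L2c_inner ((f # gs) ! i) (hs ! j))"
  have M: "M \<in> carrier_mat (Suc ?n) (Suc ?n)" by (simp add: M_def)
  have "cinner (w (f # gs)) (w hs) = Determinant.det M"
    using gram[of "f # gs" hs] f gs hs True by (simp add: M_def)
  also have "\<dots> = (\<Sum>j<Suc ?n. M $$ (0, j) * cofactor M 0 j)"
    by (rule laplace_expansion_row[OF M]) simp
  also have "\<dots> = (\<Sum>j<Suc ?n. (-1) ^ j * L2c_inner f (hs ! j) * cinner (w gs) (w (delete_nth j hs)))"
  proof (rule sum.cong[OF refl])
    fix j assume "j \<in> {..<Suc ?n}"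
    then have j: "j < Suc ?n" by simp
    have "mat_delete M 0 j = Matrix.mat ?n ?n (\<lambda>(i, k). L2c_inner (gs ! i) (delete_nth j hs ! k))"
      using j True by (intro eq_matI) (auto simp: mat_delete_def M_def nth_delete_nth)
    then have "Determinant.det (mat_delete M 0 j) = cinner (w gs) (w (delete_nth j hs))"
      using gram[OF gs delete_nth_lists[OF hs, of j]] j True by simp
    then show "M $$ (0, j) * cofactor M 0 j = (-1) ^ j * L2c_inner f (hs ! j) * cinner (w gs) (w (delete_nth j hs))"
      using j by (simp add: cofactor_def M_def)
  qed
  finally show ?thesis using True by simp
qed

text \<open>The familiar formula for \<open>a(f)\<close> on a wedge product, written down before any
  operator is known to exist.\<close>

definition contract :: "(real \<Rightarrow> 'k \<times> 'k) \<Rightarrow> (real \<Rightarrow> 'k \<times> 'k) list \<Rightarrow> 'h" where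
  "contract f hs = (\<Sum>j<length hs. scaleC ((-1) ^ j * L2c_inner (hs ! j) f) (w (delete_nth j hs)))"

lemma cinner_w_Cons_contract:
  assumes "f \<in> L2c" "gs \<in> lists L2c" "hs \<in> lists L2c"
  shows "cinner (w (f # gs)) (w hs) = cinner (w gs) (contract f hs)"
  unfolding cinner_w_Cons[OF assms] contract_def cinner_sum_right
  by (rule sum.cong) (auto simp: cinner_scaleC_right L2c_inner_commute[of _ f])

lemma contract_Cons: "contract f (g # hs) = scaleC (L2c_inner g f) (w hs)
   - (\<Sum>j<length hs. scaleC ((-1) ^ j * L2c_inner (hs ! j) f) (w (g # delete_nth j hs)))"
  unfolding contract_def length_Cons sum.lessThan_Suc_shift
  by (simp add: scaleC_minus_left sum_negf)

text \<open>The mixed anticommutation relation in weak form. It has exactly the shape that the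
  extension lemma requires, so it yields boundedness of the creation operators and later becomes an
  operator identity.\<close>

lemma gram_Cons_Cons:
  assumes f: "f \<in> L2c" and g: "g \<in> L2c" and gs: "gs \<in> lists L2c" and hs: "hs \<in> lists L2c"
  shows "cinner (w (f # gs)) (w (g # hs)) + cinner (contract g gs) (contract f hs)
    = L2c_inner f g * cinner (w gs) (w hs)"
proof -
  have "cinner (w gs) (w (g # delete_nth j hs)) = cinner (contract g gs) (w (delete_nth j hs))" for j
    using cinner_w_Cons_contract[OF g delete_nth_lists[OF hs] gs, of j] by (metis cinner_commute)
  then have "cinner (w gs) (\<Sum>j<length hs. scaleC ((-1) ^ j * L2c_inner (hs ! j) f) (w (g # delete_nth j hs)))
    = cinner (contract g gs) (contract f hs)"
    unfolding contract_def[of f hs] by (simp add: cinner_sum_right cinner_scaleC_right)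
  then show ?thesis using assms
    by (simp add: cinner_w_Cons_contract contract_Cons cinner_diff_right cinner_scaleC_right
        L2c_inner_commute[of g f])
qed

lemma ex_creation:
  assumes "f \<in> L2c"
  shows "\<exists>!T. T \<in> bops UNIV \<and> (\<forall>gs\<in>lists L2c. T (w gs) = w (f # gs))"
proof (rule ex_ex1I)
  obtain N where N: "N \<ge> 0" "L2c_inner f f = of_real N" by (rule L2c_inner_self)
  obtain T where "clin T" "\<And>gs. gs \<in> lists L2c \<Longrightarrow> T (w gs) = w (f # gs)"
  proof (rule ex_semilin_extension[OF total, of "\<lambda>c. c" N "\<lambda>gs. w (f # gs)" "contract f"])
    show "cinner (w (f # gs)) (w (f # hs)) + cinner (contract f gs) (contract f hs)
        = of_real N * cinner (w gs) (w hs)" if "gs \<in> lists L2c" "hs \<in> lists L2c" for gs hs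
      using gram_Cons_Cons[OF assms assms that] N by simp
  qed (use N in auto)
  then show "\<exists>T. T \<in> bops UNIV \<and> (\<forall>gs\<in>lists L2c. T (w gs) = w (f # gs))"
    by (auto simp: bops_UNIV)
next
  fix S T
  assume *: "S \<in> bops UNIV \<and> (\<forall>gs\<in>lists L2c. S (w gs) = w (f # gs))"
    "T \<in> bops UNIV \<and> (\<forall>gs\<in>lists L2c. T (w gs) = w (f # gs))"
  then have "clin S" "clin T" by (auto simp: bops_UNIV)
  then show "S = T" using *
    by (intro ext) (rule semilin_eq_on_dense[OF \<open>clin S\<close> \<open>clin T\<close> total], auto)
qed

section \<open>Creation and annihilation operators and the anticommutation relations\<close>

abbreviation "cr \<equiv> creation w"
abbreviation "an \<equiv> annihilation w"
abbreviation "\<Omega> \<equiv> w []"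

lemma
  assumes "f \<in> L2c"
  shows clin_cr: "clin (cr f)" and cr_w: "gs \<in> lists L2c \<Longrightarrow> cr f (w gs) = w (f # gs)"
  using theI'[OF ex_creation[OF assms]] by (auto simp: creation_def bops_UNIV)

lemma clin_an: "f \<in> L2c \<Longrightarrow> clin (an f)"
  unfolding annihilation_def by (intro clin_cadj clin_cr)

lemma cinner_an_right: "f \<in> L2c \<Longrightarrow> cinner x (an f y) = cinner (cr f x) y"
  and cinner_an_left: "f \<in> L2c \<Longrightarrow> cinner (an f x) y = cinner x (cr f y)"
  unfolding annihilation_def using cinner_cadj_right cinner_cadj_left clin_cr by blast+

lemma an_w:
  assumes "f \<in> L2c" "hs \<in> lists L2c"
  shows "an f (w hs) = contract f hs"
proof (rule cinner_eq_on_dense[OF total])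
  fix y assume "y \<in> w ` lists L2c"
  then obtain gs where "gs \<in> lists L2c" "y = w gs" by blast
  then have "cinner y (an f (w hs)) = cinner y (contract f hs)"
    using assms by (simp add: cinner_an_right cr_w cinner_w_Cons_contract)
  then show "cinner (an f (w hs)) y = cinner (contract f hs) y" by (metis cinner_commute)
qed

lemma an_vac [simp]: "f \<in> L2c \<Longrightarrow> an f \<Omega> = 0"
  by (simp add: an_w contract_def)

lemma car_mixed:
  assumes f: "f \<in> L2c" and g: "g \<in> L2c"
  shows "an g (cr f x) + cr f (an g x) = scaleC (L2c_inner f g) x"
proof -
  have lin: "clin (\<lambda>x. an g (cr f x) + cr f (an g x))" "clin (scaleC (L2c_inner f g))"
    using assms semilin_scaleC[OF semilin_id]
    by (auto intro!: semilin_add semilin_comp[OF clin_an clin_cr] semilin_comp[OF clin_cr clin_an])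
  show ?thesis
  proof (rule semilin_eq_on_dense[OF lin total])
    fix x assume "x \<in> w ` lists L2c"
    then obtain gs where gs: "gs \<in> lists L2c" "x = w gs" by blast
    show "an g (cr f x) + cr f (an g x) = scaleC (L2c_inner f g) x"
    proof (rule cinner_eq_on_dense[OF total])
      fix y assume "y \<in> w ` lists L2c"
      then obtain hs where hs: "hs \<in> lists L2c" "y = w hs" by blast
      have "cinner (an g (cr f x)) y = cinner (w (f # gs)) (w (g # hs))"
        using assms gs hs by (simp add: cinner_an_left cr_w)
      moreover have "cinner (cr f (an g x)) y = cinner (contract g gs) (contract f hs)"
        using assms gs hs by (simp add: an_w flip: cinner_an_right)
      ultimately show "cinner (an g (cr f x) + cr f (an g x)) y = cinner (scaleC (L2c_inner f g) x) y"
        using gram_Cons_Cons[OF f g gs(1) hs(1)] gs hs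
        by (simp add: cinner_add_left cinner_scaleC_left)
    qed
  qed
qed

text \<open>Testing against \<open>w (h # hs)\<close> moves \<open>an h\<close> to the other side,
  where it passes both creation operators; the scalar terms cancel and the induction descends to
  \<open>hs\<close>. At the vacuum the annihilation operators vanish.\<close>

lemma car_cr:
  assumes f: "f \<in> L2c" and g: "g \<in> L2c"
  shows "cr f (cr g x) + cr g (cr f x) = 0"
proof -
  have "\<forall>x. cinner (cr f (cr g x) + cr g (cr f x)) (w hs) = 0" if "hs \<in> lists L2c" for hs
    using that
  proof (induction hs)
    case Nil
    show ?case using assms by (simp add: cinner_add_left flip: cinner_an_right)
  next
    case (Cons h hs)
    have h: "h \<in> L2c" and hs: "hs \<in> lists L2c" using Cons.hyps by auto
    have cr_an: "an h (cr f x) = scaleC (L2c_inner f h) x - cr f (an h x)" if "f \<in> L2c" for f x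
      using car_mixed[OF that h, of x] by (simp add: eq_diff_eq)
    have "an h (cr f (cr g x) + cr g (cr f x)) = cr f (cr g (an h x)) + cr g (cr f (an h x))" for x
      using assms h by (simp add: semilinD[OF clin_an[OF h]] cr_an semilinD[OF clin_cr[OF f]] semilinD[OF clin_cr[OF g]])
    moreover have "cinner y (w (h # hs)) = cinner (an h y) (w hs)" for y
      using h hs by (simp add: cinner_an_left cr_w)
    ultimately show ?case using Cons.IH by simp
  qed
  then show ?thesis by (intro cinner_eq_on_dense[OF total]) auto
qed

lemma car_an:
  assumes f: "f \<in> L2c" and g: "g \<in> L2c"
  shows "an f (an g x) + an g (an f x) = 0"
proof (rule cinner_ext)
  fix y
  have "cinner x (cr g (cr f y) + cr f (cr g y)) = 0" by (simp add: car_cr[OF g f])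
  then show "cinner (an f (an g x) + an g (an f x)) y = cinner 0 y"
    using assms by (simp add: cinner_add_left cinner_add_right cinner_an_left)
qed

text \<open>A creation operator sees its function through inner products only, so linear relations
  may be stated there, insensitive to changes on null sets.\<close>

lemma cr_linear:
  assumes "f \<in> L2c" "g \<in> L2c" "h \<in> L2c"
    and eq: "\<And>k. k \<in> L2c \<Longrightarrow> L2c_inner f k = c * L2c_inner g k + d * L2c_inner h k"
  shows "cr f x = scaleC c (cr g x) + scaleC d (cr h x)"
proof -
  have lin: "clin (cr f)" "clin (\<lambda>x. scaleC c (cr g x) + scaleC d (cr h x))"
    by (intro semilin_add semilin_scaleC clin_cr assms(1-3))+
  show ?thesis
  proof (rule semilin_eq_on_dense[OF lin total])
    fix x assume "x \<in> w ` lists L2c"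
    then obtain gs where gs: "gs \<in> lists L2c" "x = w gs" by blast
    show "cr f x = scaleC c (cr g x) + scaleC d (cr h x)"
    proof (rule cinner_eq_on_dense[OF total])
      fix y assume "y \<in> w ` lists L2c"
      then obtain hs where hs: "hs \<in> lists L2c" "y = w hs" by blast
      have "L2c_inner f (hs ! j) = c * L2c_inner g (hs ! j) + d * L2c_inner h (hs ! j)"
        if "j < length hs" for j using hs(1) that by (intro eq) (auto simp: in_lists_conv_set)
      then show "cinner (cr f x) y = cinner (scaleC c (cr g x) + scaleC d (cr h x)) y"
        using assms gs hs
        by (simp add: cr_w cinner_add_left cinner_scaleC_left cinner_w_Cons sum_distrib_left sum.distrib[symmetric])
          (rule sum.cong, auto simp: algebra_simps)
    qed
  qed
qed

lemma cr_re_im: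
  assumes "f \<in> L2c"
  shows "cr f x = cr (of_real_fun (re_part f)) x + scaleC \<i> (cr (of_real_fun (im_part f)) x)"
proof -
  have "cr f x = scaleC 1 (cr (of_real_fun (re_part f)) x) + scaleC \<i> (cr (of_real_fun (im_part f)) x)"
    by (rule cr_linear[OF assms L2c_of_real_fun[OF L2r_re_part[OF assms]] L2c_of_real_fun[OF L2r_im_part[OF assms]]])
      (simp add: L2c_inner_re_im[OF assms])
  then show ?thesis by simp
qed

lemma cr_scaleR:
  assumes "f \<in> L2r"
  shows "cr (of_real_fun (\<lambda>s. r *\<^sub>R f s)) x = r *\<^sub>R cr (of_real_fun f) x"
  using cr_linear[of "of_real_fun (\<lambda>s. r *\<^sub>R f s)" "of_real_fun f" "of_real_fun f" "of_real r" 0 x] assms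
  by (simp add: L2c_of_real_fun L2r_scaleR L2c_inner_scaleR scaleR_scaleC)

text \<open>The mixed relation with \<open>g = f\<close>, paired with \<open>x\<close>. For a unit
  \<open>f\<close> it bounds both operators by 1 and forbids both from being small on the same
  vector, which drives the vanishing arguments.\<close>

lemma norm_cr_an:
  assumes "f \<in> L2c" "L2c_inner f f = of_real N"
  shows "(norm (cr f x))\<^sup>2 + (norm (an f x))\<^sup>2 = N * (norm x)\<^sup>2"
proof -
  have "cinner (an f (cr f x) + cr f (an f x)) x = of_real N * cinner x x"
    by (simp add: car_mixed assms cinner_scaleC_left)
  then have "(of_real ((norm (cr f x))\<^sup>2 + (norm (an f x))\<^sup>2) :: complex) = of_real (N * (norm x)\<^sup>2)"
    by (simp add: cinner_add_left cinner_an_left[OF assms(1)] cinner_self flip: cinner_an_right[OF assms(1)])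
  then show ?thesis by (simp only: of_real_eq_iff)
qed

section \<open>Parity and the modular involution\<close>

definition parity :: "'h \<Rightarrow> 'h" where
  "parity = (SOME T. clin T \<and> (\<forall>gs\<in>lists L2c. T (w gs) = scaleC ((-1) ^ length gs) (w gs)))"

text \<open>Wedges of different length are orthogonal, so signs that depend on the length alone
  leave the Gram matrix unchanged.\<close>

lemma ex_parity: "\<exists>T. clin T \<and> (\<forall>gs\<in>lists L2c. T (w gs) = scaleC ((-1) ^ length gs) (w gs))"
proof -
  obtain T where "clin T" "\<And>gs. gs \<in> lists L2c \<Longrightarrow> T (w gs) = scaleC ((-1) ^ length gs) (w gs)"
  proof (rule ex_semilin_extension[OF total, of "\<lambda>c. c" 1 "\<lambda>gs. scaleC ((-1) ^ length gs) (w gs)" "\<lambda>_. 0"])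
    show "cinner (scaleC ((-1) ^ length gs) (w gs)) (scaleC ((-1) ^ length hs) (w hs)) + cinner 0 0
        = of_real 1 * cinner (w gs) (w hs)" if "gs \<in> lists L2c" "hs \<in> lists L2c" for gs hs
      using gram_zero[OF that]
      by (cases "length gs = length hs") (auto simp: cinner_scaleC_left cinner_scaleC_right simp flip: mult.assoc power_add mult_2)
  qed auto
  then show ?thesis by blast
qed

lemma clin_parity: "clin parity"
  and parity_w: "gs \<in> lists L2c \<Longrightarrow> parity (w gs) = scaleC ((-1) ^ length gs) (w gs)"
  using someI_ex[OF ex_parity] unfolding parity_def by blast+

lemmas parity_simps [simp] = semilinD(2-6)[OF clin_parity]

lemma parity_parity [simp]: "parity (parity x) = x"
  by (rule semilin_eq_on_dense[OF semilin_comp[OF clin_parity clin_parity] semilin_id total])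
    (auto simp: parity_w scaleC_scaleC simp flip: power_add mult_2)

lemma parity_vac [simp]: "parity \<Omega> = \<Omega>"
  by (simp add: parity_w)

lemma parity_cr: "f \<in> L2c \<Longrightarrow> parity (cr f x) = - cr f (parity x)"
  by (rule semilin_eq_on_dense[OF semilin_comp[OF clin_parity clin_cr]
      semilin_comp[OF semilin_scaleC[OF semilin_id, of "-1"] semilin_comp[OF clin_cr clin_parity], simplified scaleC_minus_left scaleC_one] total])
    (auto simp: cr_w parity_w semilinD[OF clin_cr] scaleC_minus_left)

lemma cinner_parity: "cinner (parity x) y = cinner x (parity y)"
proof -
  have "cadj parity y = parity y" for y
    by (rule semilin_eq_on_dense[OF clin_cadj[OF clin_parity] clin_parity total], rule cinner_eq_on_dense[OF total])
      (auto simp: cinner_cadj_left[OF clin_parity] parity_w cinner_scaleC_left cinner_scaleC_right,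
       metis gram_zero)
  then show ?thesis using cinner_cadj_right[OF clin_parity] by metis
qed

lemma parity_an: "f \<in> L2c \<Longrightarrow> parity (an f x) = - an f (parity x)"
  by (rule cinner_ext) (simp add: cinner_parity cinner_an_left cinner_minus_left cinner_minus_right parity_cr)

lemma map_cconj_lists: "gs \<in> lists L2c \<Longrightarrow> map cconj gs \<in> lists L2c"
  using L2c_cconj by (auto simp: lists_eq_set)

lemma cinner_w_cconj:
  assumes gh: "gs \<in> lists L2c" "hs \<in> lists L2c"
  shows "cinner (w (map cconj gs)) (w (map cconj hs)) = cnj (cinner (w gs) (w hs))"
proof (cases "length gs = length hs")
  case True
  let ?n = "length hs"
  have "cinner (w (map cconj gs)) (w (map cconj hs))
    = Determinant.det (Matrix.mat ?n ?n (\<lambda>(i, j). cnj (L2c_inner (gs ! i) (hs ! j))))"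
    using True gram[OF map_cconj_lists[OF gh(1)] map_cconj_lists[OF gh(2)]]
    by (auto simp: L2c_inner_cconj intro!: arg_cong[of _ _ Determinant.det])
  also have "\<dots> = cnj (Determinant.det (Matrix.mat ?n ?n (\<lambda>(i, j). L2c_inner (gs ! i) (hs ! j))))"
    unfolding det_def'[OF mat_carrier] by (simp add: cnj_sum cnj_prod)
  finally show ?thesis using gram[OF gh True] by simp
qed (use gram_zero[OF gh] gram_zero[OF map_cconj_lists[OF gh(1)] map_cconj_lists[OF gh(2)]] in simp)

lemma ex_modular: "\<exists>T. semilin cnj T \<and> (\<forall>gs\<in>lists L2c. T (w gs) = scaleC (rev_sign (length gs)) (w (map cconj gs)))"
proof -
  obtain T where "semilin cnj T" "\<And>gs. gs \<in> lists L2c \<Longrightarrow> T (w gs) = scaleC (rev_sign (length gs)) (w (map cconj gs))"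
  proof (rule ex_semilin_extension[OF total, of cnj 1 "\<lambda>gs. scaleC (rev_sign (length gs)) (w (map cconj gs))" "\<lambda>_. 0"])
    show "cinner (scaleC (rev_sign (length gs)) (w (map cconj gs))) (scaleC (rev_sign (length hs)) (w (map cconj hs))) + cinner 0 0
        = of_real 1 * cnj (cinner (w gs) (w hs))" if "gs \<in> lists L2c" "hs \<in> lists L2c" for gs hs
      using cinner_w_cconj[OF that] gram_zero[OF that]
      by (cases "length gs = length hs") (auto simp: cinner_scaleC_left cinner_scaleC_right simp flip: mult.assoc)
  qed auto
  then show ?thesis by blast
qed

text \<open>The involution \<open>f\<^sub>1 \<and> \<dots> \<and> f\<^sub>m \<mapsto> f\<^sub>m\<^sup>* \<and> \<dots> \<and> f\<^sub>1\<^sup>*\<close>, with the reversal expressed by its sign.\<close>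

definition modular :: "'h \<Rightarrow> 'h" where
  "modular = (SOME T. semilin cnj T \<and> (\<forall>gs\<in>lists L2c. T (w gs) = scaleC (rev_sign (length gs)) (w (map cconj gs))))"

abbreviation "J \<equiv> modular"

lemma semilin_J: "semilin cnj J"
  and J_w: "gs \<in> lists L2c \<Longrightarrow> J (w gs) = scaleC (rev_sign (length gs)) (w (map cconj gs))"
  using someI_ex[OF ex_modular] unfolding modular_def by blast+

lemmas J_simps [simp] = semilinD(2-6)[OF semilin_J]

lemma J_J [simp]: "J (J x) = x"
  by (rule semilin_eq_on_dense[OF semilin_comp[OF semilin_J semilin_J] semilin_id total])
    (auto simp: J_w map_cconj_lists scaleC_scaleC comp_def)

lemma J_vac [simp]: "J \<Omega> = \<Omega>"
  by (simp add: J_w)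

lemma J_parity: "J (parity x) = parity (J x)"
  by (rule semilin_eq_on_dense[OF semilin_comp[OF semilin_J clin_parity] semilin_comp[OF clin_parity semilin_J] total])
    (auto simp: J_w parity_w map_cconj_lists scaleC_scaleC mult.commute)

text \<open>On \<open>m\<close> letters the two reversal signs multiply to
  \<open>rev_sign (Suc m) * rev_sign m = (-1) ^ m\<close>. This is the origin of the parity in the
  formula for right multiplication.\<close>

lemma J_cr: "f \<in> L2r \<Longrightarrow> J (cr (of_real_fun f) (J x)) = cr (of_real_fun f) (parity x)"
  by (rule semilin_eq_on_dense[OF semilin_comp[OF semilin_J semilin_comp[OF clin_cr semilin_J]] semilin_comp[OF clin_cr clin_parity] total])
    (auto simp: L2c_of_real_fun J_w parity_w map_cconj_lists scaleC_scaleC cr_w semilinD[OF clin_cr] comp_def algebra_simps)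

end

section \<open>Commutants\<close>

lemma commutant_UNIV: "T \<in> commutant UNIV S \<longleftrightarrow> clin T \<and> (\<forall>m\<in>S. \<forall>x. T (m x) = m (T x))"
  unfolding commutant_def bops_UNIV by (auto simp: fun_eq_iff)

lemma commutant_clin: "commutant UNIV S \<subseteq> Collect clin"
  by (auto simp: commutant_UNIV)

lemma commutant_comp: "a \<in> commutant UNIV S \<Longrightarrow> b \<in> commutant UNIV S \<Longrightarrow> a \<circ> b \<in> commutant UNIV S"
  by (auto simp: commutant_UNIV comp_def intro: semilin_comp)

lemma commutant_id: "id \<in> commutant UNIV S"
  by (auto simp: commutant_UNIV id_def semilin_id)

lemma commutant_add:
  "S \<subseteq> Collect clin \<Longrightarrow> a \<in> commutant UNIV S \<Longrightarrow> b \<in> commutant UNIV S \<Longrightarrow> (\<lambda>x. a x + b x) \<in> commutant UNIV S"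
  by (auto simp: commutant_UNIV subset_eq intro!: semilin_add simp: semilinD)

lemma commutant_scaleC:
  "S \<subseteq> Collect clin \<Longrightarrow> a \<in> commutant UNIV S \<Longrightarrow> (\<lambda>x. scaleC c (a x)) \<in> commutant UNIV S"
  by (auto simp: commutant_UNIV subset_eq intro!: semilin_scaleC simp: semilinD)

lemma commutant_cadj:
  assumes "S \<subseteq> Collect clin" "\<And>m. m \<in> S \<Longrightarrow> cadj m \<in> S" "a \<in> commutant UNIV S"
  shows "cadj a \<in> commutant UNIV S"
  unfolding commutant_UNIV
proof (intro conjI ballI allI)
  have a: "clin a" "\<And>m x. m \<in> S \<Longrightarrow> a (m x) = m (a x)" using assms(3) by (auto simp: commutant_UNIV)
  then show "clin (cadj a)" by (intro clin_cadj)
  fix m x assume m: "m \<in> S"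
  then have m': "clin m" using assms(1) by auto
  show "cadj a (m x) = m (cadj a x)"
  proof (rule cinner_ext)
    fix y
    have "cinner (cadj a (m x)) y = cinner x (cadj m (a y))"
      using a m' by (simp add: cinner_cadj_left cinner_cadj_right)
    also have "\<dots> = cinner (m (cadj a x)) y"
      using a m' assms(2)[OF m] by (simp add: cinner_cadj_left[OF a(1)] cinner_cadj_right[OF m', symmetric] flip: a(2))
    finally show "cinner (cadj a (m x)) y = cinner (m (cadj a x)) y" .
  qed
qed

lemma bicommutant_superset: "S \<subseteq> Collect clin \<Longrightarrow> S \<subseteq> commutant UNIV (commutant UNIV S)"
  by (auto simp: commutant_UNIV)

lemma commutant_antimono: "S \<subseteq> T \<Longrightarrow> commutant UNIV T \<subseteq> commutant UNIV S"
  by (auto simp: commutant_UNIV) blast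

lemma triple_commutant:
  "S \<subseteq> Collect clin \<Longrightarrow> commutant UNIV (commutant UNIV (commutant UNIV S)) = commutant UNIV S"
  using bicommutant_superset[of S] bicommutant_superset[of "commutant UNIV S"] commutant_clin[of S]
    commutant_antimono[of S "commutant UNIV (commutant UNIV S)"] by blast

section \<open>Field operators and right multiplication\<close>

context fock
begin

text \<open>Follows from conjugation of Gram determinants on wedges and is extended to all vectors
  in one argument after the other.\<close>

lemma cinner_J: "cinner (J x) y = cinner (J y) x"
proof -
  have base: "cinner (J (w gs)) (w hs) = cinner (J (w hs)) (w gs)" if "gs \<in> lists L2c" "hs \<in> lists L2c" for gs hs
  proof (cases "length gs = length hs")
    case True
    have "cinner (w (map cconj gs)) (w hs) = cnj (cinner (w gs) (w (map cconj hs)))"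
      using cinner_w_cconj[OF that(1) map_cconj_lists[OF that(2)]] by (simp add: comp_def)
    then show ?thesis using that True by (simp add: J_w cinner_scaleC_left flip: cinner_commute)
  next
    case False
    then show ?thesis using that by (simp add: J_w cinner_scaleC_left gram_zero map_cconj_lists)
  qed
  have half: "cinner (J x) (w hs) = cinner (J (w hs)) x" if "hs \<in> lists L2c" for hs x
  proof -
    have "x \<in> {x. cinner (J x) (w hs) = cinner (J (w hs)) x}"
    proof (rule cspan_closure_induct[OF total])
      show "csubspace {x. cinner (J x) (w hs) = cinner (J (w hs)) x}"
        by (simp add: csubspace_def cinner_add_left cinner_add_right cinner_scaleC_left cinner_scaleC_right)
      show "closed {x. cinner (J x) (w hs) = cinner (J (w hs)) x}"
        by (intro closed_Collect_eq continuous_on_cinner continuous_intros semilin_continuous_on[OF semilin_J])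
    qed (use base that in auto)
    then show ?thesis by simp
  qed
  have "y \<in> {y. cinner (J x) y = cinner (J y) x}"
  proof (rule cspan_closure_induct[OF total])
    show "csubspace {y. cinner (J x) y = cinner (J y) x}"
      by (simp add: csubspace_def cinner_add_left cinner_add_right cinner_scaleC_left cinner_scaleC_right)
    show "closed {y. cinner (J x) y = cinner (J y) x}"
      by (intro closed_Collect_eq continuous_on_cinner continuous_intros semilin_continuous_on[OF semilin_J])
  qed (use half in auto)
  then show ?thesis by simp
qed

lemma norm_J: "norm (J x) = norm x"
proof -
  have "cinner (J x) (J x) = cinner x x" by (simp add: cinner_J[of x "J x"])
  then have "(norm (J x))\<^sup>2 = (norm x)\<^sup>2" by (simp only: cinner_self of_real_eq_iff)
  then show ?thesis by (simp add: power2_eq_iff_nonneg)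
qed

text \<open>The transpose of \<open>J_cr\<close>: both involutions are moved across the inner
  product.\<close>

lemma J_an:
  assumes "f \<in> L2r" shows "J (an (of_real_fun f) (J x)) = parity (an (of_real_fun f) x)"
proof (rule cinner_ext)
  fix y
  have "cinner (J (an (of_real_fun f) (J x))) y = cinner (J y) (an (of_real_fun f) (J x))"
    by (rule cinner_J)
  also have "\<dots> = cinner (cr (of_real_fun f) (J y)) (J x)"
    using assms by (simp add: cinner_an_right L2c_of_real_fun)
  also have "\<dots> = cinner x (J (cr (of_real_fun f) (J y)))"
    by (metis cinner_J cinner_commute J_J)
  also have "\<dots> = cinner (parity (an (of_real_fun f) x)) y"
    using assms by (simp add: J_cr cinner_parity cinner_an_left L2c_of_real_fun)
  finally show "cinner (J (an (of_real_fun f) (J x))) y = cinner (parity (an (of_real_fun f) x)) y" .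
qed

abbreviation "u \<equiv> field_op w"

definition ru :: "(real \<Rightarrow> 'k) \<Rightarrow> 'h \<Rightarrow> 'h" where
  "ru f x = J (u f (J x))"

lemma u_eq: "u f x = (an (of_real_fun f) x + cr (of_real_fun f) x) /\<^sub>R sqrt 2"
  by (simp add: field_op_def)

lemma ru_eq:
  assumes "f \<in> L2r"
  shows "ru f x = (cr (of_real_fun f) (parity x) - an (of_real_fun f) (parity x)) /\<^sub>R sqrt 2"
  using assms
  by (simp add: ru_def u_eq semilinD(7)[OF semilin_J] J_an J_cr parity_an L2c_of_real_fun)

lemma clin_u: "f \<in> L2r \<Longrightarrow> clin (u f)"
  unfolding u_eq[abs_def] by (intro semilin_scaleR semilin_add clin_cr clin_an L2c_of_real_fun)

lemma clin_ru: "f \<in> L2r \<Longrightarrow> clin (ru f)"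
  unfolding ru_def[abs_def] by (rule semilin_comp[OF semilin_J semilin_comp[OF clin_u semilin_J]]) auto

lemma cinner_u: "f \<in> L2r \<Longrightarrow> cinner (u f x) y = cinner x (u f y)"
  by (simp add: u_eq cinner_scaleR_left cinner_scaleR_right cinner_add_left cinner_add_right
      cinner_an_left cinner_an_right L2c_of_real_fun)

lemma cinner_ru: "f \<in> L2r \<Longrightarrow> cinner (ru f x) y = cinner x (ru f y)"
  unfolding ru_def by (metis J_J cinner_J cinner_u)

lemma parity_u: "f \<in> L2r \<Longrightarrow> parity (u f x) = - u f (parity x)"
  by (simp add: u_eq semilinD(7)[OF clin_parity] parity_an parity_cr L2c_of_real_fun
      scaleR_add_right scaleR_diff_right)

text \<open>Merges two normalising factors into one, so that products of two fields can be compared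
  without square roots.\<close>

lemma u_half:
  assumes "f \<in> L2r"
  shows "u f (y /\<^sub>R sqrt 2) = (an (of_real_fun f) y + cr (of_real_fun f) y) /\<^sub>R 2"
proof -
  have f: "of_real_fun f \<in> L2c" using assms by (rule L2c_of_real_fun)
  have "inverse (sqrt 2) * inverse (sqrt 2) = (inverse 2 :: real)" by (simp flip: inverse_mult_distrib)
  then show ?thesis
    by (simp only: u_eq semilinD(7)[OF clin_an[OF f]] semilinD(7)[OF clin_cr[OF f]] scaleR_scaleR
        flip: scaleR_add_right)
qed

lemma ru_half:
  assumes "f \<in> L2r"
  shows "ru f (y /\<^sub>R sqrt 2) = (cr (of_real_fun f) (parity y) - an (of_real_fun f) (parity y)) /\<^sub>R 2"
proof -
  have f: "of_real_fun f \<in> L2c" using assms by (rule L2c_of_real_fun)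
  have "inverse (sqrt 2) * inverse (sqrt 2) = (inverse 2 :: real)" by (simp flip: inverse_mult_distrib)
  then show ?thesis
    by (simp only: ru_eq[OF assms] semilinD(7)[OF clin_parity] semilinD(7)[OF clin_an[OF f]]
        semilinD(7)[OF clin_cr[OF f]] scaleR_scaleR flip: scaleR_diff_right)
qed

lemma an_cr:
  assumes "f \<in> L2c" "g \<in> L2c"
  shows "an g (cr f x) = scaleC (L2c_inner f g) x - cr f (an g x)"
  using car_mixed[OF assms, of x] by (simp add: eq_diff_eq)

lemma cr_cr: "f \<in> L2c \<Longrightarrow> g \<in> L2c \<Longrightarrow> cr g (cr f x) = - cr f (cr g x)"
  using car_cr[of g f x] by (simp add: eq_neg_iff_add_eq_0)

lemma an_an: "f \<in> L2c \<Longrightarrow> g \<in> L2c \<Longrightarrow> an g (an f x) = - an f (an g x)"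
  using car_an[of g f x] by (simp add: eq_neg_iff_add_eq_0)

text \<open>Terms with two creation or two annihilation operators cancel by anticommutation. The
  scalars left over from the mixed terms cancel because inner products of real functions are
  symmetric; the remaining sign is absorbed by the parity.\<close>

lemma u_ru_commute:
  assumes f: "f \<in> L2r" and g: "g \<in> L2r"
  shows "u f (ru g x) = ru g (u f x)"
proof -
  let ?f = "of_real_fun f" and ?g = "of_real_fun g" and ?p = "parity x"
  have fg: "?f \<in> L2c" "?g \<in> L2c" using f g by (auto intro: L2c_of_real_fun)
  note lin = semilinD[OF clin_an[OF fg(1)]] semilinD[OF clin_an[OF fg(2)]]
    semilinD[OF clin_cr[OF fg(1)]] semilinD[OF clin_cr[OF fg(2)]]
  have "an ?f (cr ?g ?p - an ?g ?p) + cr ?f (cr ?g ?p - an ?g ?p)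
     = - (cr ?g (an ?f ?p + cr ?f ?p) - an ?g (an ?f ?p + cr ?f ?p))"
    by (simp add: lin an_cr[OF fg] an_cr[OF fg(2,1)] cr_cr[OF fg] an_an[OF fg]
        L2c_inner_of_real_fun_commute[of g f])
  moreover have "parity (an ?f x + cr ?f x) = - (an ?f ?p + cr ?f ?p)"
    by (simp add: parity_an parity_cr fg)
  ultimately show ?thesis
    by (simp only: ru_eq[OF g, of x] u_half[OF f] u_eq[of f x] ru_half[OF g])
      (simp add: lin)
qed

lemma ru_vac: "f \<in> L2r \<Longrightarrow> ru f \<Omega> = u f \<Omega>"
  by (simp add: ru_eq u_eq L2c_of_real_fun)

text \<open>The Clifford relation: \<open>sqrt 2 u f\<close> is a selfadjoint unitary for a unit
  function \<open>f\<close>.\<close>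

lemma u_u:
  assumes f: "f \<in> L2r" "L2c_inner (of_real_fun f) (of_real_fun f) = 1"
  shows "u f (u f x) = x /\<^sub>R 2"
proof -
  let ?f = "of_real_fun f"
  have F: "?f \<in> L2c" using f by (auto intro: L2c_of_real_fun)
  have "cr ?f (cr ?f x) = 0" "an ?f (an ?f x) = 0" using car_cr[OF F F, of x] car_an[OF F F, of x]
    by (simp_all flip: scaleR_2)
  then show ?thesis
    unfolding u_eq[of f x] u_half[OF f(1)]
    by (simp add: semilinD[OF clin_an[OF F]] semilinD[OF clin_cr[OF F]] an_cr[OF F F] f)
qed

lemma ru_ru:
  assumes f: "f \<in> L2r" "L2c_inner (of_real_fun f) (of_real_fun f) = 1"
  shows "ru f (ru f x) = x /\<^sub>R 2"
  by (simp add: ru_def u_u[OF assms] semilinD(7)[OF semilin_J])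

section \<open>Vectors on which left and right multiplication agree\<close>

lemma cinner_vac [simp]: "cinner \<Omega> \<Omega> = 1"
  using gram[of "[]" "[]"] by simp

lemma cinner_w_single: "f \<in> L2c \<Longrightarrow> g \<in> L2c \<Longrightarrow> cinner (w [f]) (w [g]) = L2c_inner f g"
  using cinner_w_Cons[of f "[]" "[g]"] by simp

text \<open>On a wedge this is a finite sum whose coefficients vanish in the limit by Bessel; the
  bound by 1 from the anticommutation relation carries the limit to all vectors.\<close>

lemma an_tendsto_zero:
  fixes e :: "nat \<Rightarrow> real \<Rightarrow> 'k"
  assumes e: "\<And>i. e i \<in> L2r"
    and on: "\<And>i j. L2c_inner (of_real_fun (e i)) (of_real_fun (e j)) = (if i = j then 1 else 0)"
  shows "(\<lambda>i. an (of_real_fun (e i)) x) \<longlonglongrightarrow> 0"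
proof -
  have E: "of_real_fun (e i) \<in> L2c" for i using e by (rule L2c_of_real_fun)
  have lim: "(\<lambda>i. L2c_inner f (of_real_fun (e i))) \<longlonglongrightarrow> 0" if "f \<in> L2c" for f
    using bessel[of "\<lambda>i. w [of_real_fun (e i)]" "w [f]"] that E by (simp add: cinner_w_single on)
  have bound: "norm (an (of_real_fun (e i)) y) \<le> norm y" for i y
  proof -
    have "(norm (cr (of_real_fun (e i)) y))\<^sup>2 + (norm (an (of_real_fun (e i)) y))\<^sup>2 = (norm y)\<^sup>2"
      using norm_cr_an[OF E, of i 1 y] on by simp
    then have "(norm (an (of_real_fun (e i)) y))\<^sup>2 \<le> (norm y)\<^sup>2"
      using zero_le_power2[of "norm (cr (of_real_fun (e i)) y)"] by linarith
    then show ?thesis by (rule power2_le_imp_le) simp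
  qed
  show ?thesis
  proof (rule bounded_tendsto_on_dense[OF clin_an[OF E] semilin_zero _ total])
    show "norm (an (of_real_fun (e i)) y) \<le> 1 * norm y" for i y using bound by simp
    fix x assume "x \<in> w ` lists L2c"
    then obtain gs where gs: "gs \<in> lists L2c" "x = w gs" by blast
    have "(\<lambda>i. \<Sum>j<length gs. scaleC ((-1) ^ j * L2c_inner (gs ! j) (of_real_fun (e i))) (w (delete_nth j gs)))
      \<longlonglongrightarrow> (\<Sum>j<length gs. 0)"
    proof (rule tendsto_sum)
      fix j assume "j \<in> {..<length gs}"
      then have "gs ! j \<in> L2c" using gs(1) by (auto simp: in_lists_conv_set)
      then have "(\<lambda>i. (-1) ^ j * L2c_inner (gs ! j) (of_real_fun (e i))) \<longlonglongrightarrow> 0"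
        using lim by (intro tendsto_mult_right_zero)
      then have "(\<lambda>i. cmod ((-1) ^ j * L2c_inner (gs ! j) (of_real_fun (e i))) * norm (w (delete_nth j gs))) \<longlonglongrightarrow> 0"
        by (intro tendsto_mult_left_zero tendsto_norm_zero)
      then show "(\<lambda>i. scaleC ((-1) ^ j * L2c_inner (gs ! j) (of_real_fun (e i))) (w (delete_nth j gs))) \<longlonglongrightarrow> 0"
        by (intro tendsto_norm_zero_cancel[of "\<lambda>i. scaleC (_ i) _"]) (simp only: norm_scaleC)
    qed
    then show "(\<lambda>i. an (of_real_fun (e i)) x) \<longlonglongrightarrow> 0"
      by (simp add: gs(2) an_w[OF E gs(1)] contract_def)
  qed
qed

text \<open>Stated for any set of functions that contains an orthonormal sequence, since it is
  applied to shifted functions for the intertwiners and to all unit functions for the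
  averaging.\<close>

lemma left_right_fixed:
  fixes e :: "nat \<Rightarrow> real \<Rightarrow> 'k"
  assumes S: "S \<subseteq> L2r" and e: "\<And>i. e i \<in> S"
    and on: "\<And>i j. L2c_inner (of_real_fun (e i)) (of_real_fun (e j)) = (if i = j then 1 else 0)"
    and fix_S: "\<And>f. f \<in> S \<Longrightarrow> u f \<xi> = ru f \<xi>"
  shows "parity \<xi> = \<xi>" and "\<And>f. f \<in> S \<Longrightarrow> an (of_real_fun f) \<xi> = 0"
proof -
  let ?p = "\<xi> + parity \<xi>" and ?q = "\<xi> - parity \<xi>"
  have key: "an (of_real_fun f) ?p = 0 \<and> cr (of_real_fun f) ?q = 0" if "f \<in> S" for f
  proof -
    have fr: "f \<in> L2r" using S that by blast
    then have fc: "of_real_fun f \<in> L2c" by (rule L2c_of_real_fun)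
    note lin = semilinD[OF clin_an[OF fc]] semilinD[OF clin_cr[OF fc]]
    have "an (of_real_fun f) \<xi> + cr (of_real_fun f) \<xi>
       = cr (of_real_fun f) (parity \<xi>) - an (of_real_fun f) (parity \<xi>)"
      using fix_S[OF that] by (simp add: u_eq ru_eq[OF fr])
    then have 1: "an (of_real_fun f) ?p = - cr (of_real_fun f) ?q"
      by (simp add: lin algebra_simps)
    \<comment> \<open>The left side of equation \<open>1\<close> is odd and its right side even, so
      both vanish.\<close>
    have "parity (an (of_real_fun f) ?p) = - an (of_real_fun f) ?p"
      by (simp add: parity_an[OF fc] add.commute)
    moreover have "parity (- cr (of_real_fun f) ?q) = - cr (of_real_fun f) ?q"
      by (simp add: parity_cr[OF fc] lin)
    ultimately have "- an (of_real_fun f) ?p = - cr (of_real_fun f) ?q" using 1 by simp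
    then have "an (of_real_fun f) ?p = - an (of_real_fun f) ?p" using 1 by simp
    then have "2 *\<^sub>R an (of_real_fun f) ?p = 0" by (simp only: scaleR_2 eq_neg_iff_add_eq_0)
    then show ?thesis using 1 by simp
  qed
  have eL: "e i \<in> L2r" for i using e S by blast
  have "norm (an (of_real_fun (e i)) ?q) = norm ?q" for i
    using norm_cr_an[OF L2c_of_real_fun[OF eL], of i 1 ?q] key[OF e[of i]] on
    by (simp add: power2_eq_iff_nonneg)
  then have "(\<lambda>i::nat. norm ?q) \<longlonglongrightarrow> 0"
    using tendsto_norm_zero[OF an_tendsto_zero[OF eL on, of ?q]] by simp
  then have "?q = 0" using LIMSEQ_unique[OF tendsto_const[of "norm ?q"]] by fastforce
  then show p: "parity \<xi> = \<xi>" by simp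
  show "an (of_real_fun f) \<xi> = 0" if "f \<in> S" for f
  proof -
    have "2 *\<^sub>R an (of_real_fun f) \<xi> = 0"
      using key[OF that] p S that by (simp add: scaleR_2 semilinD[OF clin_an] L2c_of_real_fun subset_eq)
    then show ?thesis by simp
  qed
qed

lemma left_right_fixed_even:
  fixes e :: "nat \<Rightarrow> real \<Rightarrow> 'k"
  assumes S: "S \<subseteq> L2r" and e: "\<And>i. e i \<in> S"
    and on: "\<And>i j. L2c_inner (of_real_fun (e i)) (of_real_fun (e j)) = (if i = j then 1 else 0)"
    and p: "parity \<xi> = \<xi>"
    and fix_S: "\<And>f g. f \<in> S \<Longrightarrow> g \<in> S \<Longrightarrow> ru f (ru g \<xi>) = u g (u f \<xi>)"
    and g: "g \<in> S"
  shows "an (of_real_fun g) \<xi> = 0"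
proof -
  have key: "cr (of_real_fun f) (an (of_real_fun g) \<xi>) = cr (of_real_fun g) (an (of_real_fun f) \<xi>)" if "f \<in> S" for f
  proof -
    let ?f = "of_real_fun f" and ?g = "of_real_fun g"
    have fr: "f \<in> L2r" and gr: "g \<in> L2r" using S that g by auto
    then have fg: "?f \<in> L2c" "?g \<in> L2c" by (auto intro: L2c_of_real_fun)
    note lin = semilinD[OF clin_an[OF fg(1)]] semilinD[OF clin_an[OF fg(2)]]
      semilinD[OF clin_cr[OF fg(1)]] semilinD[OF clin_cr[OF fg(2)]]
    have "ru f (ru g \<xi>) = - ((cr ?f (cr ?g \<xi> - an ?g \<xi>) - an ?f (cr ?g \<xi> - an ?g \<xi>)) /\<^sub>R 2)"
      unfolding ru_eq[OF gr] ru_half[OF fr] p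
      by (simp add: p lin parity_cr parity_an fg scaleR_diff_right)
    moreover have "u g (u f \<xi>) = (an ?g (an ?f \<xi> + cr ?f \<xi>) + cr ?g (an ?f \<xi> + cr ?f \<xi>)) /\<^sub>R 2"
      unfolding u_eq[of f \<xi>] u_half[OF gr] ..
    ultimately have "- ((cr ?f (cr ?g \<xi> - an ?g \<xi>) - an ?f (cr ?g \<xi> - an ?g \<xi>)) /\<^sub>R 2)
      = (an ?g (an ?f \<xi> + cr ?f \<xi>) + cr ?g (an ?f \<xi> + cr ?f \<xi>)) /\<^sub>R 2"
      using fix_S[OF that g] by simp
    then have "- (cr ?f (cr ?g \<xi> - an ?g \<xi>) - an ?f (cr ?g \<xi> - an ?g \<xi>))
      = an ?g (an ?f \<xi> + cr ?f \<xi>) + cr ?g (an ?f \<xi> + cr ?f \<xi>)"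
      by (simp only: scaleR_minus_right[symmetric] scaleR_cancel_left) simp
    \<comment> \<open>Pairs of creation and pairs of annihilation operators contribute equally to
      both sides, and the scalars agree for real functions; what remains is a vector equal to its
      own negative.\<close>
    then have "cr ?f (an ?g \<xi>) - cr ?g (an ?f \<xi>) = - (cr ?f (an ?g \<xi>) - cr ?g (an ?f \<xi>))"
      by (simp add: lin an_cr[OF fg] an_cr[OF fg(2,1)] cr_cr[OF fg] an_an[OF fg]
        L2c_inner_of_real_fun_commute[of g f] algebra_simps)
    then have "2 *\<^sub>R (cr ?f (an ?g \<xi>) - cr ?g (an ?f \<xi>)) = 0"
      by (simp only: scaleR_2 eq_neg_iff_add_eq_0)
    then show ?thesis by simp
  qed
  let ?y = "an (of_real_fun g) \<xi>"
  have eL: "e i \<in> L2r" for i using e S by blast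
  have gc: "of_real_fun g \<in> L2c" using S g by (auto intro: L2c_of_real_fun)
  \<comment> \<open>Exchanging the roles through \<open>key\<close> puts the varying index on the
    creation operator. Then both \<open>cr\<close> and \<open>an\<close> of the sequence tend to 0
    on \<open>?y\<close>, against \<open>norm_cr_an\<close>.\<close>
  have "(\<lambda>i. cr (of_real_fun g) (an (of_real_fun (e i)) \<xi>)) \<longlonglongrightarrow> 0"
    using semilin_tendsto[OF clin_cr[OF gc] an_tendsto_zero[OF eL on, of \<xi>]] by (simp add: semilinD[OF clin_cr[OF gc]])
  then have "(\<lambda>i. cr (of_real_fun (e i)) ?y) \<longlonglongrightarrow> 0" using key e by simp
  moreover have "(\<lambda>i. an (of_real_fun (e i)) ?y) \<longlonglongrightarrow> 0" by (rule an_tendsto_zero[OF eL on])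
  ultimately have "(\<lambda>i. (norm (cr (of_real_fun (e i)) ?y))\<^sup>2 + (norm (an (of_real_fun (e i)) ?y))\<^sup>2) \<longlonglongrightarrow> 0\<^sup>2 + 0\<^sup>2"
    by (intro tendsto_add tendsto_power tendsto_norm_zero)
  moreover have "(norm (cr (of_real_fun (e i)) ?y))\<^sup>2 + (norm (an (of_real_fun (e i)) ?y))\<^sup>2 = (norm ?y)\<^sup>2" for i
    using norm_cr_an[OF L2c_of_real_fun[OF eL], of i 1 ?y] on by simp
  ultimately have "(\<lambda>i::nat. (norm ?y)\<^sup>2) \<longlonglongrightarrow> 0" by simp
  then show ?thesis using LIMSEQ_unique[OF tendsto_const[of "(norm ?y)\<^sup>2"]] by fastforce
qed

lemma u_eq_ru:
  assumes "f \<in> L2r" "parity \<xi> = \<xi>" "an (of_real_fun f) \<xi> = 0"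
  shows "u f \<xi> = ru f \<xi>"
  using assms by (simp add: u_eq ru_eq)

text \<open>A vector killed by annihilation operators is orthogonal to the range of the creation
  operators, hence to every nonempty wedge. Unit functions suffice: others are rescaled, and a
  function of norm 0 has zero creation operator.\<close>

lemma vac_multiple:
  assumes "\<And>f. f \<in> L2r \<Longrightarrow> L2c_inner (of_real_fun f) (of_real_fun f) = 1 \<Longrightarrow> an (of_real_fun f) \<xi> = 0"
  shows "\<xi> = scaleC (cinner \<xi> \<Omega>) \<Omega>"
proof -
  have real: "cinner \<xi> (cr (of_real_fun f) y) = 0" if f: "f \<in> L2r" for f y
  proof -
    have fc: "of_real_fun f \<in> L2c" using f by (rule L2c_of_real_fun)
    obtain N where N: "N \<ge> 0" "L2c_inner (of_real_fun f) (of_real_fun f) = of_real N" by (rule L2c_inner_self)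
    show ?thesis
    proof (cases "N = 0")
      case True
      then have "cr (of_real_fun f) y = 0" using norm_cr_an[OF fc N(2), of y]
        by (simp add: add_nonneg_eq_0_iff)
      then show ?thesis by simp
    next
      case False
      define g where "g s = (1 / sqrt N) *\<^sub>R f s" for s
      have g: "g \<in> L2r" unfolding g_def[abs_def] by (rule L2r_scaleR[OF f])
      have "L2c_inner (of_real_fun g) (of_real_fun g) = of_real (1 / sqrt N) * L2c_inner (of_real_fun f) (of_real_fun g)"
        unfolding g_def[abs_def] by (rule L2c_inner_scaleR)
      also have "L2c_inner (of_real_fun f) (of_real_fun g) = L2c_inner (of_real_fun g) (of_real_fun f)"
        by (rule L2c_inner_of_real_fun_commute)
      also have "L2c_inner (of_real_fun g) (of_real_fun f) = of_real (1 / sqrt N) * L2c_inner (of_real_fun f) (of_real_fun f)"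
        unfolding g_def[abs_def] by (rule L2c_inner_scaleR)
      also have "of_real (1 / sqrt N) * (of_real (1 / sqrt N) * L2c_inner (of_real_fun f) (of_real_fun f)) = (of_real ((1 / sqrt N) * (1 / sqrt N) * N) :: complex)"
        by (simp only: N(2) of_real_mult mult.assoc)
      also have "(1 / sqrt N) * (1 / sqrt N) * N = 1" using False N(1) by (simp add: field_simps)
      finally have "an (of_real_fun g) \<xi> = 0" using assms[OF g] by simp
      then have "cinner \<xi> (cr (of_real_fun g) y) = 0"
        using cinner_an_left[OF L2c_of_real_fun[OF g], of \<xi> y] by simp
      moreover have "cr (of_real_fun g) y = (1 / sqrt N) *\<^sub>R cr (of_real_fun f) y"
        unfolding g_def[abs_def] by (rule cr_scaleR[OF f])
      ultimately show ?thesis using False N(1) by (simp add: cinner_scaleR_right)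
    qed
  qed
  have eq: "cinner \<xi> (w gs) = cinner (scaleC (cinner \<xi> \<Omega>) \<Omega>) (w gs)" if "gs \<in> lists L2c" for gs
  proof (cases gs)
    case Nil
    then show ?thesis by (simp add: cinner_scaleC_left)
  next
    case (Cons f hs)
    then have f: "f \<in> L2c" "hs \<in> lists L2c" using that by auto
    have "cinner \<xi> (w gs) = cinner \<xi> (cr f (w hs))" using f Cons by (simp add: cr_w)
    also have "\<dots> = 0"
      unfolding cr_re_im[OF f(1), of "w hs"] cinner_add_right cinner_scaleC_right
      using real[OF L2r_re_part[OF f(1)]] real[OF L2r_im_part[OF f(1)]] by simp
    finally have "cinner \<xi> (w gs) = 0" .
    moreover have "cinner \<Omega> (w gs) = 0" using Cons that by (intro gram_zero) auto
    ultimately show ?thesis by (simp add: cinner_scaleC_left)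
  qed
  show ?thesis by (rule cinner_eq_on_dense[OF total], erule imageE) (simp only: eq)
qed

end

section \<open>The Clifford algebra and its even part\<close>

context fock
begin

abbreviation "fp \<equiv> field_prod w"

definition rp :: "(real \<Rightarrow> 'k) list \<Rightarrow> 'h \<Rightarrow> 'h" where
  "rp fs = foldr (\<lambda>f A. ru f \<circ> A) fs id"

lemma fp_simps [simp]: "fp [] x = x" "fp (f # fs) x = u f (fp fs x)" "fp (fs @ gs) x = fp fs (fp gs x)"
proof -
  show "fp [] x = x" "fp (f # fs) x = u f (fp fs x)" by (simp_all add: field_prod_def)
  show "fp (fs @ gs) x = fp fs (fp gs x)" by (induction fs) (simp_all add: field_prod_def)
qed

lemma rp_simps [simp]: "rp [] x = x" "rp (f # fs) x = ru f (rp fs x)" "rp (fs @ gs) x = rp fs (rp gs x)"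
proof -
  show "rp [] x = x" "rp (f # fs) x = ru f (rp fs x)" by (simp_all add: rp_def)
  show "rp (fs @ gs) x = rp fs (rp gs x)" by (induction fs) (simp_all add: rp_def)
qed

lemma clin_fp: "fs \<in> lists L2r \<Longrightarrow> clin (fp fs)"
proof (induction fs)
  case Nil
  have "fp [] = (\<lambda>x. x)" by (rule ext) simp
  then show ?case by (simp add: semilin_id)
next
  case (Cons f fs)
  then have "clin (\<lambda>x. u f (fp fs x))" by (intro semilin_comp[OF clin_u]) auto
  moreover have "fp (f # fs) = (\<lambda>x. u f (fp fs x))" by (rule ext) simp
  ultimately show ?case by simp
qed

lemma cinner_fp: "fs \<in> lists L2r \<Longrightarrow> cinner (fp fs x) y = cinner x (fp (rev fs) y)"
  by (induction fs arbitrary: y) (auto simp: cinner_u)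

lemma cinner_rp: "fs \<in> lists L2r \<Longrightarrow> cinner (rp fs x) y = cinner x (rp (rev fs) y)"
  by (induction fs arbitrary: y) (auto simp: cinner_ru)

lemma rev_lists: "fs \<in> lists A \<Longrightarrow> rev fs \<in> lists A"
  by (auto simp: in_lists_conv_set)

lemma cadj_fp: "fs \<in> lists L2r \<Longrightarrow> cadj (fp fs) = fp (rev fs)"
  by (rule cadj_eqI) (rule cinner_fp)

lemma J_fp: "fs \<in> lists L2r \<Longrightarrow> J (fp fs x) = rp fs (J x)"
proof (induction fs)
  case (Cons f fs)
  have "J (fp (f # fs) x) = ru f (J (fp fs x))" by (simp add: ru_def)
  then show ?case using Cons by simp
qed simp

lemma u_rp: "f \<in> L2r \<Longrightarrow> fs \<in> lists L2r \<Longrightarrow> u f (rp fs x) = rp fs (u f x)"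
  by (induction fs) (simp_all add: u_ru_commute)

lemma fp_rp: "fs \<in> lists L2r \<Longrightarrow> gs \<in> lists L2r \<Longrightarrow> fp fs (rp gs x) = rp gs (fp fs x)"
  by (induction fs) (simp_all add: u_rp)

lemma rp_rev_vac: "fs \<in> lists L2r \<Longrightarrow> rp (rev fs) \<Omega> = fp fs \<Omega>"
  by (induction fs) (simp_all add: ru_vac u_rp[symmetric] rev_lists)

lemma parity_fp: "fs \<in> lists L2r \<Longrightarrow> parity (fp fs x) = scaleC ((-1) ^ length fs) (fp fs (parity x))"
  by (induction fs) (simp_all add: parity_u semilinD[OF clin_u] scaleC_minus_left)

definition fp_span :: "bool \<Rightarrow> 'h set" where
  "fp_span p = cspan {fp fs \<Omega> | fs. fs \<in> lists L2r \<and> even (length fs) = p}"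

lemma csubspace_fp_span: "csubspace (fp_span p)"
  unfolding fp_span_def by (rule csubspace_cspan)

lemma u_fp_span:
  assumes "f \<in> L2r" "x \<in> fp_span p" shows "u f x \<in> fp_span (\<not> p)"
proof -
  have "fp_span p \<subseteq> {x. u f x \<in> fp_span (\<not> p)}"
    unfolding fp_span_def[of p]
  proof (rule cspan_subset)
    show "csubspace {x. u f x \<in> fp_span (\<not> p)}"
      using csubspace_fp_span[of "\<not> p"] by (simp add: csubspace_def semilinD[OF clin_u[OF assms(1)]])
    show "{fp fs \<Omega> | fs. fs \<in> lists L2r \<and> even (length fs) = p} \<subseteq> {x. u f x \<in> fp_span (\<not> p)}"
    proof clarify
      fix fs :: "(real \<Rightarrow> 'k) list" assume fs: "fs \<in> lists L2r" "p = even (length fs)"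
      have "fp (f # fs) \<Omega> \<in> fp_span (\<not> even (length fs))"
        unfolding fp_span_def
        by (rule subsetD[OF cspan_superset], rule CollectI, rule exI[of _ "f # fs"]) (use fs assms in simp)
      then show "u f (fp fs \<Omega>) \<in> fp_span (\<not> even (length fs))" by simp
    qed
  qed
  then show ?thesis using assms(2) by blast
qed

text \<open>For real functions the creation operator is \<open>sqrt 2 u f - an f\<close>. The
  annihilation part produces wedges two letters shorter than \<open>gs\<close>, hence the strong
  induction; complex functions split into real and imaginary parts.\<close>

lemma w_fp_span: "gs \<in> lists L2c \<Longrightarrow> w gs \<in> fp_span (even (length gs))"
proof (induction "length gs" arbitrary: gs rule: less_induct)
  case less
  show ?case
  proof (cases gs)
    case Nil
    have "fp [] \<Omega> \<in> fp_span True"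
      unfolding fp_span_def by (rule subsetD[OF cspan_superset], rule CollectI, rule exI[of _ "[]"]) simp
    then show ?thesis using Nil by simp
  next
    case (Cons f hs)
    have f: "f \<in> L2c" and hs: "hs \<in> lists L2c" using less.prems Cons by auto
    let ?p = "even (length hs)"
    have cs: "x + y \<in> fp_span p" "scaleC c x \<in> fp_span p" if "x \<in> fp_span p" "y \<in> fp_span p" for c x y p
      using that csubspace_fp_span[of p] by (auto simp: csubspace_def)
    have real: "cr (of_real_fun g) (w hs) \<in> fp_span (\<not> ?p)" if g: "g \<in> L2r" for g
    proof -
      have "w hs \<in> fp_span ?p" using less.hyps[of hs] Cons hs by simp
      then have "u g (w hs) \<in> fp_span (\<not> ?p)" by (rule u_fp_span[OF g])
      moreover have "contract (of_real_fun g) hs \<in> fp_span (\<not> ?p)"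
        unfolding contract_def
      proof (rule csubspace_sum[OF csubspace_fp_span])
        fix j assume j: "j \<in> {..<length hs}"
        then have "w (delete_nth j hs) \<in> fp_span (even (length (delete_nth j hs)))"
          using Cons by (intro less.hyps delete_nth_lists hs) auto
        moreover have "even (length (delete_nth j hs)) = (\<not> ?p)" using j by (cases hs) auto
        ultimately show "scaleC ((-1) ^ j * L2c_inner (hs ! j) (of_real_fun g)) (w (delete_nth j hs)) \<in> fp_span (\<not> ?p)"
          using cs by simp
      qed
      moreover have "sqrt 2 *\<^sub>R u g (w hs) = contract (of_real_fun g) hs + cr (of_real_fun g) (w hs)"
        using an_w[OF L2c_of_real_fun[OF g] hs] by (simp add: u_eq)
      then have "cr (of_real_fun g) (w hs) = scaleC (of_real (sqrt 2)) (u g (w hs)) - contract (of_real_fun g) hs"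
        by (simp add: scaleR_scaleC[symmetric])
      ultimately show ?thesis using cs csubspace_diff[OF csubspace_fp_span] by simp
    qed
    have "w gs = cr f (w hs)" using Cons f hs by (simp add: cr_w)
    also have "\<dots> \<in> fp_span (\<not> ?p)"
      unfolding cr_re_im[OF f, of "w hs"] using cs real L2r_re_part[OF f] L2r_im_part[OF f] by blast
    finally show ?thesis using Cons by simp
  qed
qed

lemma total_fp: "closure (cspan {fp fs \<Omega> | fs. fs \<in> lists L2r}) = UNIV"
proof -
  have "fp_span p \<subseteq> cspan {fp fs \<Omega> | fs. fs \<in> lists L2r}" for p
    unfolding fp_span_def by (rule cspan_subset[OF csubspace_cspan], rule order_trans[OF _ cspan_superset]) blast
  then have "w ` lists L2c \<subseteq> cspan {fp fs \<Omega> | fs. fs \<in> lists L2r}" using w_fp_span by blast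
  then have "cspan (w ` lists L2c) \<subseteq> cspan {fp fs \<Omega> | fs. fs \<in> lists L2r}"
    by (rule cspan_subset[OF csubspace_cspan])
  then show ?thesis using closure_mono total by blast
qed

section \<open>The Clifford algebra, its commutant and the commutation theorem\<close>

abbreviation "R \<equiv> cliff_alg w"
abbreviation "R\<^sub>e \<equiv> even_cliff_alg w"
abbreviation "R\<^sub>c \<equiv> commutant UNIV (u ` L2r)"

lemma u_clin: "u ` L2r \<subseteq> Collect clin"
  using clin_u by auto

lemma fp_even_clin: "fp ` {fs \<in> lists L2r. even (length fs)} \<subseteq> Collect clin"
  using clin_fp by auto

lemma cliff_clin: "m \<in> R \<Longrightarrow> clin m"
  by (simp add: cliff_alg_def commutant_UNIV)

lemma cliff_commutes: "m \<in> R \<Longrightarrow> y \<in> R\<^sub>c \<Longrightarrow> m (y x) = y (m x)"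
  by (auto simp: cliff_alg_def commutant_UNIV)

lemma commutant_cliff: "commutant UNIV R = R\<^sub>c"
  unfolding cliff_alg_def by (rule triple_commutant[OF u_clin])

lemma cliff_comp: "m \<in> R \<Longrightarrow> n \<in> R \<Longrightarrow> m \<circ> n \<in> R"
  unfolding cliff_alg_def by (rule commutant_comp)

lemma cliff_add: "m \<in> R \<Longrightarrow> n \<in> R \<Longrightarrow> (\<lambda>x. m x + n x) \<in> R"
  unfolding cliff_alg_def by (intro commutant_add commutant_clin)

lemma cliff_scaleC: "m \<in> R \<Longrightarrow> (\<lambda>x. scaleC c (m x)) \<in> R"
  unfolding cliff_alg_def by (intro commutant_scaleC commutant_clin)

lemma cliff_id: "id \<in> R"
  unfolding cliff_alg_def by (rule commutant_id)

lemma cadj_u: "f \<in> L2r \<Longrightarrow> cadj (u f) = u f"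
  by (rule cadj_eqI) (rule cinner_u)

lemma cliff_cadj: "m \<in> R \<Longrightarrow> cadj m \<in> R"
  unfolding cliff_alg_def
  by (intro commutant_cadj commutant_clin u_clin) (auto simp: cadj_u)

lemma commutant_cliff_cadj: "y \<in> R\<^sub>c \<Longrightarrow> cadj y \<in> R\<^sub>c"
  by (intro commutant_cadj u_clin) (auto simp: cadj_u)

lemma u_cliff: "f \<in> L2r \<Longrightarrow> u f \<in> R"
  using bicommutant_superset[OF u_clin] by (auto simp: cliff_alg_def)

lemma fp_cliff: "fs \<in> lists L2r \<Longrightarrow> fp fs \<in> R"
proof (induction fs)
  case Nil
  have "fp [] = id" by (rule ext) simp
  then show ?case by (simp only: cliff_id)
next
  case (Cons f fs)
  have "fp (f # fs) = u f \<circ> fp fs" by (rule ext) simp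
  moreover have "u f \<circ> fp fs \<in> R" using Cons by (intro cliff_comp u_cliff) auto
  ultimately show ?case by (simp only:)
qed

lemma ru_commutant: "f \<in> L2r \<Longrightarrow> ru f \<in> R\<^sub>c"
  by (auto simp: commutant_UNIV clin_ru u_ru_commute)

lemma cliff_rp: "m \<in> R \<Longrightarrow> fs \<in> lists L2r \<Longrightarrow> m (rp fs x) = rp fs (m x)"
  by (induction fs) (simp_all add: cliff_commutes ru_commutant)

lemma J_cliff_J: "m \<in> R \<Longrightarrow> (\<lambda>x. J (m (J x))) \<in> R\<^sub>c"
  unfolding commutant_UNIV
proof (intro conjI ballI allI)
  assume m: "m \<in> R"
  show "clin (\<lambda>x. J (m (J x)))"
    by (rule semilin_comp[OF semilin_J semilin_comp[OF cliff_clin[OF m] semilin_J refl]]) simp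
  fix v x assume "v \<in> u ` L2r"
  then obtain f where f: "f \<in> L2r" "v = u f" by blast
  have "m (ru f (J x)) = ru f (m (J x))" by (rule cliff_commutes[OF m ru_commutant[OF f(1)]])
  then show "J (m (J (v x))) = v (J (m (J x)))" by (simp add: f ru_def)
qed

text \<open>Tested on \<open>fp fs \<Omega> = rp (rev fs) \<Omega>\<close>: right products commute
  with \<open>m\<close>. It identifies the concrete involution on wedges as the modular
  conjugation.\<close>

lemma J_vac_cliff:
  assumes m: "m \<in> R" shows "J (m \<Omega>) = cadj m \<Omega>"
proof (rule cinner_eq_on_dense[OF total_fp])
  fix y assume "y \<in> {fp fs \<Omega> | fs. fs \<in> lists L2r}"
  then obtain fs where fs: "fs \<in> lists L2r" "y = fp fs \<Omega>" by blast
  have "cinner (J (m \<Omega>)) y = cinner (J y) (m \<Omega>)" by (rule cinner_J)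
  also have "\<dots> = cinner \<Omega> (rp (rev fs) (m \<Omega>))" using fs by (simp add: J_fp cinner_rp)
  also have "\<dots> = cinner \<Omega> (m y)" using fs m by (simp add: rp_rev_vac flip: cliff_rp[OF _ rev_lists])
  also have "\<dots> = cinner (cadj m \<Omega>) y" by (simp add: cinner_cadj_left[OF cliff_clin[OF m]])
  finally show "cinner (J (m \<Omega>)) y = cinner (cadj m \<Omega>) y" .
qed

text \<open>The dense set of vectors \<open>fp fs \<Omega>\<close> arises from \<Omega> by right
  products, which commute with the algebra.\<close>

lemma cliff_separating:
  assumes "m \<in> R" "n \<in> R" "m \<Omega> = n \<Omega>" shows "m = n"
proof
  fix x show "m x = n x"
  proof (rule semilin_eq_on_dense[OF cliff_clin[OF assms(1)] cliff_clin[OF assms(2)] total_fp])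
    fix y assume "y \<in> {fp fs \<Omega> | fs. fs \<in> lists L2r}"
    then obtain fs where "fs \<in> lists L2r" "y = rp (rev fs) \<Omega>" using rp_rev_vac by force
    then show "m y = n y" using assms by (simp add: cliff_rp rev_lists)
  qed
qed

lemma total_cliff: "closure (cspan ((\<lambda>m. m \<Omega>) ` R)) = UNIV"
proof -
  have "{fp fs \<Omega> | fs. fs \<in> lists L2r} \<subseteq> (\<lambda>m. m \<Omega>) ` R" using fp_cliff by blast
  then have "cspan {fp fs \<Omega> | fs. fs \<in> lists L2r} \<subseteq> cspan ((\<lambda>m. m \<Omega>) ` R)"
    by (intro cspan_subset csubspace_cspan order_trans[OF _ cspan_superset])
  then show ?thesis using closure_mono total_fp by blast
qed

lemma J_vac_commutant:
  assumes y: "y \<in> R\<^sub>c" shows "J (y \<Omega>) = cadj y \<Omega>"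
proof (rule cinner_eq_on_dense[OF total_cliff])
  have cy: "clin y" using y by (simp add: commutant_UNIV)
  fix z assume "z \<in> (\<lambda>m. m \<Omega>) ` R"
  then obtain m where m: "m \<in> R" "z = m \<Omega>" by blast
  have "cinner (J (y \<Omega>)) z = cinner (J z) (y \<Omega>)" by (rule cinner_J)
  also have "\<dots> = cinner \<Omega> (m (y \<Omega>))"
    by (simp add: m J_vac_cliff cinner_cadj_left[OF cliff_clin[OF m(1)]])
  also have "\<dots> = cinner (cadj y \<Omega>) z"
    by (simp add: cinner_cadj_left[OF cy] m(2) cliff_commutes[OF m(1) y])
  finally show "cinner (J (y \<Omega>)) z = cinner (cadj y \<Omega>) z" .
qed

lemma total_commutant: "closure (cspan ((\<lambda>y. y \<Omega>) ` R\<^sub>c)) = UNIV"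
proof -
  have "{fp fs \<Omega> | fs. fs \<in> lists L2r} \<subseteq> (\<lambda>y. y \<Omega>) ` R\<^sub>c"
  proof clarify
    fix fs :: "(real \<Rightarrow> 'k) list" assume fs: "fs \<in> lists L2r"
    have "(\<lambda>x. J (fp (rev fs) (J x))) \<in> R\<^sub>c" by (intro J_cliff_J fp_cliff rev_lists fs)
    moreover have "J (fp (rev fs) (J \<Omega>)) = fp fs \<Omega>" using fs by (simp add: J_fp rev_lists rp_rev_vac)
    ultimately show "fp fs \<Omega> \<in> (\<lambda>y. y \<Omega>) ` R\<^sub>c" by (metis (no_types, lifting) image_eqI)
  qed
  then have "cspan {fp fs \<Omega> | fs. fs \<in> lists L2r} \<subseteq> cspan ((\<lambda>y. y \<Omega>) ` R\<^sub>c)"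
    by (intro cspan_subset csubspace_cspan order_trans[OF _ cspan_superset])
  then show ?thesis using closure_mono total_fp by blast
qed

text \<open>The nontrivial half of the commutation theorem. On \<open>z \<Omega>\<close> with
  \<open>z\<close> in the commutant, \<open>J x J\<close> gives \<open>z (cadj x \<Omega>)\<close>,
  a formula that is visibly compatible with a further factor on the left of
  \<open>z\<close>.\<close>

lemma J_commutant_J:
  assumes x: "x \<in> R\<^sub>c" shows "(\<lambda>v. J (x (J v))) \<in> R"
  unfolding cliff_alg_def commutant_UNIV[of _ R\<^sub>c]
proof (intro conjI ballI allI)
  have cx: "clin x" using x by (simp add: commutant_UNIV)
  show lin: "clin (\<lambda>v. J (x (J v)))"
    by (rule semilin_comp[OF semilin_J semilin_comp[OF cx semilin_J refl]]) simp
  fix y v assume y: "y \<in> R\<^sub>c"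
  then have cy: "clin y" by (simp add: commutant_UNIV)
  have vec: "J (x (J (z \<Omega>))) = z (cadj x \<Omega>)" if z: "z \<in> R\<^sub>c" for z
  proof -
    have cz: "clin z" using z by (simp add: commutant_UNIV)
    have "x (cadj z \<Omega>) = (x \<circ> cadj z) \<Omega>" by simp
    moreover have "J ((x \<circ> cadj z) \<Omega>) = cadj (x \<circ> cadj z) \<Omega>"
      by (intro J_vac_commutant commutant_comp x commutant_cliff_cadj z)
    ultimately show ?thesis
      by (simp add: J_vac_commutant[OF z] cadj_comp[OF cx clin_cadj[OF cz]] cadj_cadj[OF cz])
  qed
  show "J (x (J (y v))) = y (J (x (J v)))"
  proof (rule semilin_eq_on_dense[OF semilin_comp[OF lin cy] semilin_comp[OF cy lin] total_commutant])
    fix v assume "v \<in> (\<lambda>y. y \<Omega>) ` R\<^sub>c"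
    then obtain z where z: "z \<in> R\<^sub>c" "v = z \<Omega>" by blast
    have "J (x (J (y v))) = J (x (J ((y \<circ> z) \<Omega>)))" using z by simp
    also have "\<dots> = (y \<circ> z) (cadj x \<Omega>)" by (rule vec[OF commutant_comp[OF y z(1)]])
    also have "\<dots> = y (J (x (J v)))" using vec[OF z(1)] z(2) by simp
    finally show "J (x (J (y v))) = y (J (x (J v)))" .
  qed simp_all
qed

text \<open>The commutant of the even algebra is tested on even products only; conjugation by \<open>u f\<close>
  preserves these.\<close>

definition commutes_even :: "('h \<Rightarrow> 'h) \<Rightarrow> bool" where
  "commutes_even y \<longleftrightarrow> clin y \<and> (\<forall>fs\<in>lists L2r. even (length fs) \<longrightarrow> (\<forall>x. y (fp fs x) = fp fs (y x)))"

lemma commutes_evenD: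
  "commutes_even y \<Longrightarrow> fs \<in> lists L2r \<Longrightarrow> even (length fs) \<Longrightarrow> y (fp fs x) = fp fs (y x)"
  by (simp add: commutes_even_def)

lemma commutes_even_iff: "y \<in> commutant UNIV (fp ` {fs \<in> lists L2r. even (length fs)}) \<longleftrightarrow> commutes_even y"
  by (auto simp: commutes_even_def commutant_UNIV)

lemma even_cliff_iff: "m \<in> R\<^sub>e \<longleftrightarrow> clin m \<and> (\<forall>y. commutes_even y \<longrightarrow> (\<forall>x. m (y x) = y (m x)))"
  unfolding even_cliff_alg_def commutant_UNIV[of m] Ball_def commutes_even_iff by simp

lemma commutes_even_parity: "commutes_even parity"
  by (simp add: commutes_even_def clin_parity parity_fp)

lemma even_cliff_parity: "m \<in> R\<^sub>e \<Longrightarrow> m (parity x) = parity (m x)"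
  using commutes_even_parity even_cliff_iff by blast

lemma even_cliff_subset: "R\<^sub>e \<subseteq> R"
proof -
  have "commutes_even y" if "y \<in> R\<^sub>c" for y
    using that cliff_commutes[OF fp_cliff that] by (simp add: commutes_even_def commutant_UNIV)
  then show ?thesis
    by (auto simp: even_cliff_iff cliff_alg_def commutant_UNIV[of _ R\<^sub>c])
qed

lemma fp_even_cliff: "fs \<in> lists L2r \<Longrightarrow> even (length fs) \<Longrightarrow> fp fs \<in> R\<^sub>e"
  using bicommutant_superset[OF fp_even_clin] by (auto simp: even_cliff_alg_def)

lemma even_cliff_add: "m \<in> R\<^sub>e \<Longrightarrow> n \<in> R\<^sub>e \<Longrightarrow> (\<lambda>x. m x + n x) \<in> R\<^sub>e"
  unfolding even_cliff_alg_def by (intro commutant_add commutant_clin)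

lemma even_cliff_scaleC: "m \<in> R\<^sub>e \<Longrightarrow> (\<lambda>x. scaleC c (m x)) \<in> R\<^sub>e"
  unfolding even_cliff_alg_def by (intro commutant_scaleC commutant_clin)

lemma even_cliff_cadj: "m \<in> R\<^sub>e \<Longrightarrow> cadj m \<in> R\<^sub>e"
  unfolding even_cliff_alg_def
  by (intro commutant_cadj commutant_clin fp_even_clin) (auto simp: cadj_fp rev_lists)

lemma commutes_even_add: "commutes_even y \<Longrightarrow> commutes_even z \<Longrightarrow> commutes_even (\<lambda>x. y x + z x)"
  by (auto simp: commutes_even_def semilinD[OF clin_fp] intro: semilin_add)

lemma commutes_even_diff: "commutes_even y \<Longrightarrow> commutes_even z \<Longrightarrow> commutes_even (\<lambda>x. y x - z x)"
  by (auto simp: commutes_even_def semilinD[OF clin_fp] intro: semilin_diff)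

section \<open>The even algebra as the parity-invariant part, by means of one odd unitary\<close>

context
  fixes f :: "real \<Rightarrow> 'k"
  assumes f: "f \<in> L2r" and unit: "L2c_inner (of_real_fun f) (of_real_fun f) = 1"
begin

lemma uu: "2 *\<^sub>R u f (u f x) = x"
  using u_u[OF f unit, of x] by simp

lemma commutes_even_conj:
  assumes y: "commutes_even y" shows "commutes_even (\<lambda>x. 2 *\<^sub>R u f (y (u f x)))"
  unfolding commutes_even_def
proof (intro conjI ballI impI allI)
  have cy: "clin y" using y by (simp add: commutes_even_def)
  show "clin (\<lambda>x. 2 *\<^sub>R u f (y (u f x)))"
    by (rule semilin_scaleR, rule semilin_comp[OF clin_u[OF f] semilin_comp[OF cy clin_u[OF f]]]) simp_all
  fix fs :: "(real \<Rightarrow> 'k) list" and x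
  assume fs: "fs \<in> lists L2r" "even (length fs)"
  note lin = semilinD(7)[OF clin_u[OF f]] semilinD(7)[OF cy] semilinD(7)[OF clin_fp[OF fs(1)]]
  \<comment> \<open>The list \<open>f # fs @ [f]\<close> has even length, so \<open>y\<close> passes
    the two odd factors as a pair.\<close>
  have c: "y (u f (fp fs (u f z))) = u f (fp fs (u f (y z)))" for z
    using commutes_evenD[OF y, of "f # fs @ [f]" z] fs f by simp
  have "2 *\<^sub>R u f (y (u f (fp fs x))) = 2 *\<^sub>R u f (y (u f (fp fs (2 *\<^sub>R u f (u f x)))))" by (simp only: uu)
  also have "\<dots> = 2 *\<^sub>R (2 *\<^sub>R u f (y (u f (fp fs (u f (u f x))))))" by (simp only: lin)
  also have "\<dots> = 2 *\<^sub>R (2 *\<^sub>R u f (u f (fp fs (u f (y (u f x))))))" by (simp only: c)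
  also have "\<dots> = fp fs (2 *\<^sub>R u f (y (u f x)))" by (simp only: uu lin)
  finally show "2 *\<^sub>R u f (y (u f (fp fs x))) = fp fs (2 *\<^sub>R u f (y (u f x)))" .
qed

text \<open>Every \<open>u g\<close> equals \<open>2 u g u f u f\<close>, an even product followed
  by \<open>u f\<close>.\<close>

lemma commutes_even_imp_commutant:
  assumes y: "commutes_even y" and yu: "\<And>x. y (u f x) = u f (y x)"
  shows "y \<in> R\<^sub>c"
  unfolding commutant_UNIV
proof (intro conjI ballI allI)
  show cy: "clin y" using y by (simp add: commutes_even_def)
  fix v x assume "v \<in> u ` L2r"
  then obtain g where g: "g \<in> L2r" "v = u g" by blast
  have c: "y (u g (u f z)) = u g (u f (y z))" for z
    using commutes_evenD[OF y, of "[g, f]" z] g f by simp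
  have "y (u g x) = y (u g (2 *\<^sub>R u f (u f x)))" by (simp only: uu)
  also have "\<dots> = 2 *\<^sub>R y (u g (u f (u f x)))"
    by (simp only: semilinD(7)[OF clin_u[OF g(1)]] semilinD(7)[OF cy])
  also have "\<dots> = u g (2 *\<^sub>R u f (u f (y x)))"
    by (simp only: c yu semilinD(7)[OF clin_u[OF g(1)]])
  finally show "y (v x) = v (y x)" by (simp only: uu g)
qed

text \<open>Conjugation by the involution \<open>sqrt 2 u f\<close> interchanges the two summands,
  so the sum commutes with \<open>u f\<close>.\<close>

lemma conj_sum_commutant:
  assumes y: "commutes_even y" shows "(\<lambda>x. y x + 2 *\<^sub>R u f (y (u f x))) \<in> R\<^sub>c"
proof (rule commutes_even_imp_commutant[OF commutes_even_add[OF y commutes_even_conj[OF y]]])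
  have cy: "clin y" using y by (simp add: commutes_even_def)
  fix x
  have "2 *\<^sub>R u f (y (u f (u f x))) = u f (y (2 *\<^sub>R u f (u f x)))"
    by (simp only: semilinD(7)[OF cy] semilinD(7)[OF clin_u[OF f]])
  moreover have "u f (2 *\<^sub>R u f (y (u f x))) = 2 *\<^sub>R u f (u f (y (u f x)))"
    by (simp only: semilinD(7)[OF clin_u[OF f]])
  ultimately show "y (u f x) + 2 *\<^sub>R u f (y (u f (u f x))) = u f (y x + 2 *\<^sub>R u f (y (u f x)))"
    by (simp only: uu semilinD(2)[OF clin_u[OF f]] add.commute)
qed

text \<open>Let \<open>y\<close> commute with even products. Both \<open>y + 2 u f y u f\<close> and
  the difference \<open>y - 2 u f y u f\<close> composed with the parity lie in
  \<open>R\<^sub>c\<close>. As \<open>m\<close> commutes with these and with the parity, it commutes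
  with \<open>2 y\<close>.\<close>

lemma even_cliffI:
  assumes m: "m \<in> R" and par: "\<And>x. m (parity x) = parity (m x)"
  shows "m \<in> R\<^sub>e"
  unfolding even_cliff_iff
proof (intro conjI allI impI)
  show cm: "clin m" by (rule cliff_clin[OF m])
  fix y x assume y: "commutes_even y"
  then have cy: "clin y" by (simp add: commutes_even_def)
  let ?c = "\<lambda>x. 2 *\<^sub>R u f (y (u f x))"
  \<comment> \<open>The difference anticommutes with \<open>u f\<close>; composing it with the
    parity, which also anticommutes with \<open>u f\<close>, repairs the sign.\<close>
  define z where "z x = y (parity x) - ?c (parity x)" for x
  have "commutes_even (\<lambda>x. y x - ?c x)" by (rule commutes_even_diff[OF y commutes_even_conj[OF y]])
  then have ze: "commutes_even z"
    using commutes_even_parity unfolding z_def[abs_def] commutes_even_def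
    by (auto intro!: semilin_comp[of "\<lambda>c. c" "\<lambda>x. y x - ?c x", OF _ clin_parity])
  have z: "z \<in> R\<^sub>c"
  proof (rule commutes_even_imp_commutant[OF ze])
    fix x
    let ?p = "parity x"
    have 1: "2 *\<^sub>R u f (y (u f (u f ?p))) = u f (y ?p)"
      using arg_cong[OF uu[of ?p], of "\<lambda>v. u f (y v)"]
      by (simp only: semilinD(7)[OF cy] semilinD(7)[OF clin_u[OF f]])
    have 2: "u f (2 *\<^sub>R u f (y (u f ?p))) = y (u f ?p)"
      by (simp only: semilinD(7)[OF clin_u[OF f]] uu)
    have "z (u f x) = - (y (u f ?p) - 2 *\<^sub>R u f (y (u f (u f ?p))))"
      by (simp add: z_def parity_u[OF f] semilinD[OF clin_u[OF f]] semilinD[OF cy])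
    also have "\<dots> = u f (y ?p) - y (u f ?p)" by (simp add: 1)
    also have "\<dots> = u f (z x)" by (simp only: z_def semilinD(3)[OF clin_u[OF f]] 2)
    finally show "z (u f x) = u f (z x)" .
  qed
  have mz: "m (z (parity x)) = z (parity (m x))" by (simp add: cliff_commutes[OF m z] par)
  have "m (y x + ?c x) = y (m x) + ?c (m x)"
    by (rule cliff_commutes[OF m conj_sum_commutant[OF y]])
  moreover have "m (y x - ?c x) = y (m x) - ?c (m x)" using mz by (simp add: z_def)
  ultimately have "m (y x + ?c x) + m (y x - ?c x) = 2 *\<^sub>R y (m x)" by (simp add: scaleR_2)
  then have "2 *\<^sub>R m (y x) = 2 *\<^sub>R y (m x)"
    by (simp add: semilinD(2,3)[OF cm] scaleR_2)
  then show "m (y x) = y (m x)" by simp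
qed

end

section \<open>The standard space of the even algebra\<close>

definition even_proj :: "'h \<Rightarrow> 'h" where
  "even_proj x = (x + parity x) /\<^sub>R 2"

abbreviation "P \<equiv> even_proj"
abbreviation "K \<equiv> even_space w"

lemma clin_P: "clin P"
  unfolding even_proj_def[abs_def] by (intro semilin_scaleR semilin_add semilin_id clin_parity)

lemma parity_P [simp]: "parity (P x) = P x" "P (parity x) = P x"
  by (simp_all add: even_proj_def semilinD(7)[OF clin_parity] add.commute)

lemma P_fixed: "parity x = x \<Longrightarrow> P x = x"
  by (simp add: even_proj_def flip: scaleR_2)

lemma P_P [simp]: "P (P x) = P x"
  by (simp add: P_fixed)

lemma cinner_P: "cinner (P x) y = cinner x (P y)"
  by (simp add: even_proj_def cinner_scaleR_left cinner_scaleR_right cinner_add_left cinner_add_right cinner_parity)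

lemma J_P: "J (P x) = P (J x)"
  by (simp add: even_proj_def semilinD(7)[OF semilin_J] J_parity)

text \<open>One inclusion holds because the fixed vectors of the parity form a closed set. For the
  other, \<open>P\<close> maps a wedge to itself or to 0, and even wedges are spanned by even field
  products on \<Omega>.\<close>

lemma even_space_eq: "K = {x. parity x = x}"
proof
  have cl: "closed {x. parity x = x}"
    by (intro closed_Collect_eq semilin_continuous_on[OF clin_parity] continuous_intros)
  have "(\<lambda>m. m \<Omega>) ` R\<^sub>e \<subseteq> {x. parity x = x}" using even_cliff_parity[of _ \<Omega>] by auto
  then show "K \<subseteq> {x. parity x = x}" unfolding even_space_def vac_def using cl by (rule closure_minimal)
next
  have "csubspace ((\<lambda>m. m \<Omega>) ` R\<^sub>e)"
    unfolding csubspace_def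
  proof (intro conjI ballI allI)
    have id: "fp [] \<in> R\<^sub>e" by (rule fp_even_cliff) auto
    show "0 \<in> (\<lambda>m. m \<Omega>) ` R\<^sub>e" using even_cliff_scaleC[OF id, of 0] by (intro image_eqI) auto
    show "x + y \<in> (\<lambda>m. m \<Omega>) ` R\<^sub>e" if xy: "x \<in> (\<lambda>m. m \<Omega>) ` R\<^sub>e" "y \<in> (\<lambda>m. m \<Omega>) ` R\<^sub>e" for x y
    proof -
      obtain m n where "m \<in> R\<^sub>e" "n \<in> R\<^sub>e" "x = m \<Omega>" "y = n \<Omega>" using xy by auto
      then show ?thesis using even_cliff_add[of m n] by (intro image_eqI[of _ _ "\<lambda>x. m x + n x"]) auto
    qed
    show "scaleC c x \<in> (\<lambda>m. m \<Omega>) ` R\<^sub>e" if x: "x \<in> (\<lambda>m. m \<Omega>) ` R\<^sub>e" for c x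
    proof -
      obtain m where "m \<in> R\<^sub>e" "x = m \<Omega>" using x by auto
      then show ?thesis using even_cliff_scaleC[of m c] by (intro image_eqI[of _ _ "\<lambda>x. scaleC c (m x)"]) auto
    qed
  qed
  then have csK: "csubspace K" and csM: "csubspace ((\<lambda>m. m \<Omega>) ` R\<^sub>e)"
    unfolding even_space_def vac_def by (auto intro: csubspace_closure)
  have ev: "fp_span True \<subseteq> K"
  proof -
    have "{fp fs \<Omega> | fs. fs \<in> lists L2r \<and> even (length fs) = True} \<subseteq> (\<lambda>m. m \<Omega>) ` R\<^sub>e"
      using fp_even_cliff by auto
    from cspan_subset[OF csM this] show ?thesis
      unfolding fp_span_def even_space_def vac_def using closure_subset by blast
  qed
  show "{x. parity x = x} \<subseteq> K"
  proof
    fix x assume "x \<in> {x. parity x = x}"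
    moreover have "x \<in> P -` K"
    proof (rule cspan_closure_induct[OF total])
      show "csubspace (P -` K)" using csK by (simp add: csubspace_def semilinD[OF clin_P])
      show "closed (P -` K)"
        by (rule closed_vimage) (auto simp: even_space_def intro: semilin_continuous_on[OF clin_P])
      show "w ` lists L2c \<subseteq> P -` K"
      proof clarify
        fix gs :: "(real \<Rightarrow> 'k \<times> 'k) list" assume gs: "gs \<in> lists L2c"
        show "w gs \<in> P -` K"
        proof (cases "even (length gs)")
          case True
          then have "P (w gs) = w gs" using gs by (intro P_fixed) (simp add: parity_w)
          then show ?thesis using w_fp_span[OF gs] True ev by auto
        next
          case False
          then have "P (w gs) = 0" using gs by (simp add: even_proj_def parity_w scaleC_minus_left)
          then show ?thesis using csK by (simp add: csubspace_def)
        qed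
      qed
    qed
    ultimately show "x \<in> K" by (simp add: P_fixed)
  qed
qed

lemma mem_K: "x \<in> K \<longleftrightarrow> parity x = x"
  by (simp add: even_space_eq)

lemma csubspace_K: "csubspace K"
  by (simp add: csubspace_def mem_K)

lemma P_complement: "x - P x \<in> ocomp K"
  unfolding ocomp_def by (auto simp: mem_K cinner_diff_left cinner_P P_fixed)

lemma oproj_K: "oproj K = P"
  by (rule ext, rule oproj_eqI[OF csubspace_K]) (simp_all add: mem_K P_complement)

lemma ocomp_K: "x \<in> ocomp K \<longleftrightarrow> P x = 0"
proof
  assume "x \<in> ocomp K"
  then have "cinner x (P x) = 0" by (auto simp: ocomp_def mem_K)
  then have "cinner (P x) (P x) = 0" by (simp add: cinner_P)
  then show "P x = 0" by (simp add: cinner_self)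
next
  assume "P x = 0" then show "x \<in> ocomp K" using P_complement[of x] by simp
qed

lemma bops_K: "T \<in> bops K \<longleftrightarrow> clin T \<and> (\<forall>x. P (T x) = T x) \<and> (\<forall>x. T (P x) = T x)"
proof
  assume T: "T \<in> bops K"
  then have lin: "clin T" unfolding bops_def semilin_def by blast
  have "T x \<in> K" for x using T unfolding bops_def by blast
  moreover have "T (x - P x) = 0" for x using T P_complement[of x] unfolding bops_def by blast
  ultimately show "clin T \<and> (\<forall>x. P (T x) = T x) \<and> (\<forall>x. T (P x) = T x)"
    using lin by (simp add: mem_K P_fixed semilinD(3)[OF lin])
next
  assume T: "clin T \<and> (\<forall>x. P (T x) = T x) \<and> (\<forall>x. T (P x) = T x)"
  then have "T x = 0" if "x \<in> ocomp K" for x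
    using that semilinD(5)[of _ T] by (metis ocomp_K)
  moreover have "T x \<in> K" for x using T by (metis mem_K parity_P(1))
  ultimately show "T \<in> bops K" using T unfolding bops_def semilin_def by auto
qed

end

section \<open>Bounded strong convergence and the weak-* topology\<close>

lemma limitin_topology_generated_by:
  assumes "l \<in> \<Union>\<S>" "\<And>U. U \<in> \<S> \<Longrightarrow> l \<in> U \<Longrightarrow> eventually (\<lambda>k. f k \<in> U) F"
  shows "limitin (topology_generated_by \<S>) f l F"
  unfolding limitin_def
proof (intro conjI allI impI)
  show "l \<in> topspace (topology_generated_by \<S>)" using assms(1) by simp
  fix U assume "openin (topology_generated_by \<S>) U \<and> l \<in> U"
  then have "generate_topology_on \<S> U" "l \<in> U" by (auto simp: openin_topology_generated_by_iff)
  then show "eventually (\<lambda>k. f k \<in> U) F"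
  proof (induction rule: generate_topology_on.induct)
    case (UN K)
    then obtain k where "k \<in> K" "l \<in> k" by blast
    then have "eventually (\<lambda>i. f i \<in> k) F" using UN by blast
    then show ?case by eventually_elim (use \<open>k \<in> K\<close> in blast)
  qed (auto simp: assms(2) eventually_conj_iff)
qed

text \<open>Dominated convergence for series: the common norm bound supplies a summable
  majorant.\<close>

lemma weak_star_limitI:
  fixes c :: "nat \<Rightarrow> 'h::chilbert_space \<Rightarrow> 'h"
  assumes c: "\<And>k. clin (c k)" and l: "clin l" and B: "\<And>k x. norm (c k x) \<le> B * norm x"
    and lim: "\<And>x. (\<lambda>k. c k x) \<longlonglongrightarrow> l x"
  shows "limitin (weak_star UNIV) c l sequentially"
  unfolding weak_star_def
proof (rule limitin_topology_generated_by)
  let ?S = "{{T \<in> bops UNIV. (\<Sum>n. cinner (T (x n)) (y n)) \<in> U} | (x :: nat \<Rightarrow> 'h) y U.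
        range x \<subseteq> UNIV \<and> range y \<subseteq> UNIV \<and> summable (\<lambda>n. (norm (x n))\<^sup>2)
        \<and> summable (\<lambda>n. (norm (y n))\<^sup>2) \<and> open U}"
  \<comment> \<open>Zero sequences give the subbasic set of all bounded operators, which puts
    \<open>l\<close> into the carrier of the topology.\<close>
  have "{T \<in> bops UNIV. (\<Sum>n. cinner (T ((\<lambda>n. 0) n)) ((\<lambda>n. 0) n)) \<in> UNIV} \<in> ?S"
    by (rule CollectI, intro exI conjI, rule refl) auto
  moreover have "l \<in> {T \<in> bops UNIV. (\<Sum>n. cinner (T ((\<lambda>n. 0) n)) ((\<lambda>n. 0) n)) \<in> UNIV}"
    using l by (simp add: bops_UNIV)
  ultimately show "l \<in> \<Union>?S" by (rule UnionI)
  fix V assume "V \<in> ?S" "l \<in> V"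
  then obtain x y :: "nat \<Rightarrow> 'h" and U where V: "V = {T \<in> bops UNIV. (\<Sum>n. cinner (T (x n)) (y n)) \<in> U}"
    and xy: "summable (\<lambda>n. (norm (x n))\<^sup>2)" "summable (\<lambda>n. (norm (y n))\<^sup>2)" and U: "open U"
    and lU: "(\<Sum>n. cinner (l (x n)) (y n)) \<in> U" by auto
  have "((\<lambda>k. \<Sum>n. cinner (c k (x n)) (y n)) \<longlongrightarrow> (\<Sum>n. cinner (l (x n)) (y n))) sequentially"
  proof (rule tannerys_theorem[THEN conjunct2, THEN conjunct2])
    show "((\<lambda>k. cinner (c k (x n)) (y n)) \<longlongrightarrow> cinner (l (x n)) (y n)) sequentially" for n
      by (intro tendsto_cinner lim tendsto_const)
    show "summable (\<lambda>n. \<bar>B\<bar> * ((norm (x n))\<^sup>2 + (norm (y n))\<^sup>2))"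
      by (intro summable_mult summable_add xy)
    have "cmod (cinner (c k (x n)) (y n)) \<le> \<bar>B\<bar> * ((norm (x n))\<^sup>2 + (norm (y n))\<^sup>2)" for n k
    proof -
      have "0 \<le> (norm (x n) - norm (y n))\<^sup>2" by simp
      then have "2 * (norm (x n) * norm (y n)) \<le> (norm (x n))\<^sup>2 + (norm (y n))\<^sup>2"
        by (simp add: power2_diff)
      moreover have "0 \<le> norm (x n) * norm (y n)" by simp
      ultimately have *: "norm (x n) * norm (y n) \<le> (norm (x n))\<^sup>2 + (norm (y n))\<^sup>2" by linarith
      have "norm (c k (x n)) \<le> \<bar>B\<bar> * norm (x n)"
        by (rule order_trans[OF B]) (intro mult_right_mono, auto)
      then have "cmod (cinner (c k (x n)) (y n)) \<le> \<bar>B\<bar> * norm (x n) * norm (y n)"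
        by (intro order_trans[OF norm_cinner_le] mult_right_mono) auto
      also have "\<dots> \<le> \<bar>B\<bar> * ((norm (x n))\<^sup>2 + (norm (y n))\<^sup>2)"
        unfolding mult.assoc by (intro mult_left_mono *) auto
      finally show ?thesis .
    qed
    then show "eventually (\<lambda>(n, k). norm (cinner (c k (x n)) (y n)) \<le> \<bar>B\<bar> * ((norm (x n))\<^sup>2 + (norm (y n))\<^sup>2)) (at_top \<times>\<^sub>F sequentially)"
      by (intro always_eventually) auto
  qed simp
  then have "eventually (\<lambda>k. (\<Sum>n. cinner (c k (x n)) (y n)) \<in> U) sequentially"
    using U lU by (rule topological_tendstoD)
  then show "eventually (\<lambda>k. c k \<in> V) sequentially"
    by eventually_elim (simp add: V bops_UNIV c)
qed

text \<open>Sequences concentrated at index 0 turn the functionals of the topology into single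
  matrix coefficients.\<close>

lemma weak_star_limitD:
  fixes c :: "nat \<Rightarrow> 'h::chilbert_space \<Rightarrow> 'h"
  assumes lim: "limitin (weak_star UNIV) c l sequentially" and l: "clin l"
  shows "(\<lambda>k. cinner (c k \<xi>) \<eta>) \<longlonglongrightarrow> cinner (l \<xi>) \<eta>"
proof (rule topological_tendstoI)
  fix U assume U: "open U" "cinner (l \<xi>) \<eta> \<in> U"
  define x where "x n = (if n = 0 then \<xi> else 0)" for n :: nat
  define y where "y n = (if n = 0 then \<eta> else 0)" for n :: nat
  have sum: "(\<Sum>n. cinner (T (x n)) (y n)) = cinner (T \<xi>) \<eta>" for T
    by (subst suminf_finite[of "{0}"]) (auto simp: x_def y_def)
  let ?V = "{T \<in> bops UNIV. (\<Sum>n. cinner (T (x n)) (y n)) \<in> U}"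
  have "summable (\<lambda>n. (norm (x n))\<^sup>2)" "summable (\<lambda>n. (norm (y n))\<^sup>2)"
    by (auto intro!: summable_finite[of "{0}"] simp: x_def y_def split: if_splits)
  then have "openin (weak_star UNIV) ?V"
    unfolding weak_star_def using U(1)
    by (intro topology_generated_by_Basis CollectI exI[of _ x] exI[of _ y] exI[of _ U]) auto
  moreover have "l \<in> ?V" using l U(2) by (simp add: sum bops_UNIV)
  ultimately have "eventually (\<lambda>k. c k \<in> ?V) sequentially" using lim by (auto simp: limitin_def)
  then show "eventually (\<lambda>k. cinner (c k \<xi>) \<eta> \<in> U) sequentially"
    by eventually_elim (simp add: sum)
qed

section \<open>The modular conjugation\<close>

text \<open>Two candidates agree on a dense span in \<open>K\<close>, hence on \<open>K\<close>, and
  both vanish on its complement.\<close>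

lemma modular_conj_eq:
  assumes K: "closure (cspan ((\<lambda>m. m \<omega>) ` M)) = K"
    and Jo: "(\<forall>x y. Jo (x + y) = Jo x + Jo y)" "(\<forall>c x. Jo (scaleC c x) = scaleC (cnj c) (Jo x))"
      "(\<forall>x\<in>K. Jo x \<in> K \<and> norm (Jo x) = norm x)" "(\<forall>x\<in>ocomp K. Jo x = 0)" "(\<forall>m\<in>M. Jo (m \<omega>) = cadj m \<omega>)"
  shows "modular_conj K M \<omega> = Jo"
  unfolding modular_conj_def
proof (rule the_equality)
  fix Jp
  assume "(\<forall>x y. Jp (x + y) = Jp x + Jp y) \<and> (\<forall>c x. Jp (scaleC c x) = scaleC (cnj c) (Jp x)) \<and>
     (\<forall>x\<in>K. Jp x \<in> K \<and> norm (Jp x) = norm x) \<and> (\<forall>x\<in>ocomp K. Jp x = 0) \<and> (\<forall>m\<in>M. Jp (m \<omega>) = cadj m \<omega>)"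
  then have Jp: "(\<forall>x y. Jp (x + y) = Jp x + Jp y)" "(\<forall>c x. Jp (scaleC c x) = scaleC (cnj c) (Jp x))"
     "(\<forall>x\<in>K. Jp x \<in> K \<and> norm (Jp x) = norm x)" "(\<forall>x\<in>ocomp K. Jp x = 0)" "(\<forall>m\<in>M. Jp (m \<omega>) = cadj m \<omega>)"
    by simp_all
  have csK: "csubspace K" unfolding K[symmetric] by (intro csubspace_closure csubspace_cspan)
  have cl: "closed K" unfolding K[symmetric] by (rule closed_closure)
  \<comment> \<open>Continuity is no part of the characterisation; it follows on \<open>K\<close>
    from additivity, antilinearity and preservation of norms.\<close>
  have lim: "(\<lambda>n. A (f n)) \<longlonglongrightarrow> A x"
    if A: "(\<forall>x y. A (x + y) = A x + A y)" "(\<forall>c x. A (scaleC c x) = scaleC (cnj c) (A x))"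
      "(\<forall>x\<in>K. A x \<in> K \<and> norm (A x) = norm x)" and f: "\<And>n. f n \<in> K" "x \<in> K" "f \<longlonglongrightarrow> x" for A f x
  proof -
    have "A (f n + scaleC (-1) x) = A (f n) + scaleC (cnj (-1)) (A x)" for n
      using A(1,2) by (simp only:)
    then have "A (f n - x) = A (f n) - A x" for n by (simp add: scaleC_minus_left)
    then have "norm (A (f n) - A x) = norm (f n - x)" for n
      using A(3)[rule_format, OF csubspace_diff[OF csK f(1) f(2)]] by simp
    moreover have "(\<lambda>n. norm (f n - x)) \<longlonglongrightarrow> 0" by (intro tendsto_norm_zero LIM_zero f(3))
    ultimately have "(\<lambda>n. norm (A (f n) - A x)) \<longlonglongrightarrow> 0" by simp
    then show ?thesis by (rule LIM_zero_cancel[OF tendsto_norm_zero_cancel])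
  qed
  have zero: "Jp 0 = 0" "Jo 0 = 0"
    using Jp(2)[rule_format, of 0 0] Jo(2)[rule_format, of 0 0] by simp_all
  have eqK: "Jp x = Jo x" if x: "x \<in> K" for x
  proof -
    have span: "cspan ((\<lambda>m. m \<omega>) ` M) \<subseteq> {x. Jp x = Jo x}"
      by (rule cspan_subset) (use Jp Jo zero in \<open>auto simp: csubspace_def\<close>)
    obtain f where f: "\<And>n. f n \<in> cspan ((\<lambda>m. m \<omega>) ` M)" "f \<longlonglongrightarrow> x"
      using x unfolding K[symmetric] closure_sequential by blast
    have fK: "f n \<in> K" for n using f(1)[of n] closure_subset unfolding K[symmetric] by blast
    have "Jp (f n) = Jo (f n)" for n using f(1) span by blast
    then show ?thesis
      using LIMSEQ_unique[OF lim[OF Jp(1-3) fK x f(2)]] lim[OF Jo(1-3) fK x f(2)] by simp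
  qed
  show "Jp = Jo"
  proof
    fix x
    obtain p where p: "p \<in> K" "x - p \<in> ocomp K" using ex_oproj[OF cl csK, of x] by blast
    have "Jp (p + (x - p)) = Jp p" "Jo (p + (x - p)) = Jo p"
      using Jp(1)[rule_format, of p "x - p"] Jp(4)[rule_format, OF p(2)]
        Jo(1)[rule_format, of p "x - p"] Jo(4)[rule_format, OF p(2)] by simp_all
    then show "Jp x = Jo x" using eqK[OF p(1)] by simp
  qed
qed (use Jo in blast)

section \<open>The flow and its intertwiners\<close>

locale clifford = fock w for w :: "(real \<Rightarrow> 'k::{real_inner,banach,second_countable_topology} \<times> 'k) list \<Rightarrow> 'h::chilbert_space" +
  fixes \<alpha> :: "real \<Rightarrow> ('h \<Rightarrow> 'h) \<Rightarrow> 'h \<Rightarrow> 'h" and t :: real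
  assumes flow: "clifford_flow w \<alpha>" and t: "t \<ge> 0" and unit_vector: "\<exists>e::'k. norm e = 1"
begin

lemma endo: "normal_unital_endo UNIV R (\<alpha> t)"
  using flow t by (simp add: clifford_flow_def endo_semigroup_def)

lemma flow_cliff: "m \<in> R \<Longrightarrow> \<alpha> t m \<in> R"
  using endo unfolding normal_unital_endo_def by blast

lemma flow_id: "\<alpha> t id = id"
  using endo unfolding normal_unital_endo_def oproj_UNIV by blast

lemma flow_add: "m \<in> R \<Longrightarrow> n \<in> R \<Longrightarrow> \<alpha> t (\<lambda>x. m x + n x) = (\<lambda>x. \<alpha> t m x + \<alpha> t n x)"
  using endo unfolding normal_unital_endo_def by blast

lemma flow_scaleC: "m \<in> R \<Longrightarrow> \<alpha> t (\<lambda>x. scaleC c (m x)) = (\<lambda>x. scaleC c (\<alpha> t m x))"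
  using endo unfolding normal_unital_endo_def by blast

lemma flow_comp: "m \<in> R \<Longrightarrow> n \<in> R \<Longrightarrow> \<alpha> t (m \<circ> n) = \<alpha> t m \<circ> \<alpha> t n"
  using endo unfolding normal_unital_endo_def by blast

lemma flow_cadj: "m \<in> R \<Longrightarrow> \<alpha> t (cadj m) = cadj (\<alpha> t m)"
  using endo unfolding normal_unital_endo_def by blast

lemma flow_continuous: "continuous_map (subtopology (weak_star UNIV) R) (subtopology (weak_star UNIV) R) (\<alpha> t)"
  using endo unfolding normal_unital_endo_def by blast

lemma flow_fp: "fs \<in> lists L2r \<Longrightarrow> \<alpha> t (fp fs) = fp (map (shift t) fs)"
  using flow t by (simp add: clifford_flow_def)

lemma fp_single: "fp [f] = u f"
  by (rule ext) simp

lemma flow_u: "f \<in> L2r \<Longrightarrow> \<alpha> t (u f) = u (shift t f)"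
  using flow_fp[of "[f]"] by (simp only: fp_single list.map) simp

lemma shift_lists: "fs \<in> lists L2r \<Longrightarrow> map (shift t) fs \<in> lists L2r"
  using shift_L2r[OF _ t] by (auto simp: in_lists_conv_set)

lemma sequence:
  obtains e :: "nat \<Rightarrow> real \<Rightarrow> 'k" where "\<And>i. e i \<in> L2r"
    "\<And>i j. L2c_inner (of_real_fun (shift t (e i))) (of_real_fun (shift t (e j))) = (if i = j then 1 else 0)"
proof -
  obtain e0 :: 'k where e0: "norm e0 = 1" using unit_vector by blast
  show thesis by (rule shifted_orthonormal_sequence[OF e0 t], rule that)
qed

lemma unit_sequence:
  obtains e :: "nat \<Rightarrow> real \<Rightarrow> 'k" where "\<And>i. e i \<in> L2r"
    "\<And>i j. L2c_inner (of_real_fun (e i)) (of_real_fun (e j)) = (if i = j then 1 else 0)"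
  by (rule sequence, rule that) (rule shift_L2r[OF _ t])

section \<open>Central vectors, the trace, and the operators that they define\<close>

definition central :: "'h \<Rightarrow> bool" where
  "central \<xi> \<longleftrightarrow> parity \<xi> = \<xi> \<and> (\<forall>f\<in>L2r. an (of_real_fun (shift t f)) \<xi> = 0)"

lemma central_u: "central \<xi> \<Longrightarrow> f \<in> L2r \<Longrightarrow> u (shift t f) \<xi> = ru (shift t f) \<xi>"
  unfolding central_def by (intro u_eq_ru shift_L2r t) auto

lemma norm_u:
  assumes "f \<in> L2r" "L2c_inner (of_real_fun f) (of_real_fun f) = 1"
  shows "norm (u f x) = norm x / sqrt 2"
proof -
  have "cinner (u f x) (u f x) = of_real ((norm x)\<^sup>2 / 2)"
    by (simp add: cinner_u assms u_u cinner_scaleR_right cinner_self[of x])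
  then have "(norm (u f x))\<^sup>2 = (norm x / sqrt 2)\<^sup>2"
    by (simp only: cinner_self of_real_eq_iff power_divide) simp
  then show ?thesis by (simp add: power2_eq_iff_nonneg)
qed

lemma norm_ru:
  assumes "f \<in> L2r" "L2c_inner (of_real_fun f) (of_real_fun f) = 1"
  shows "norm (ru f x) = norm x / sqrt 2"
  by (simp add: ru_def norm_J norm_u[OF assms])

text \<open>Applying the unital endomorphism to the Clifford relation of \<open>f\<close> replaces
  the computation of an integral for the shifted function.\<close>

lemma shift_u_u:
  assumes f: "f \<in> L2r" "L2c_inner (of_real_fun f) (of_real_fun f) = 1"
  shows "u (shift t f) (u (shift t f) x) = x /\<^sub>R 2"
proof -
  have eq: "u f \<circ> u f = (\<lambda>x. scaleC (1 / 2) (id x))"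
    by (rule ext) (simp add: u_u[OF f] scaleR_scaleC)
  have "\<alpha> t (u f \<circ> u f) = (\<lambda>x. scaleC (1 / 2) (\<alpha> t id x))"
    unfolding eq by (rule flow_scaleC[OF cliff_id])
  then have "u (shift t f) \<circ> u (shift t f) = (\<lambda>x. scaleC (1 / 2) (id x))"
    by (simp only: flow_comp[OF u_cliff[OF f(1)] u_cliff[OF f(1)]] flow_u[OF f(1)] flow_id)
  from fun_cong[OF this, of x] show ?thesis by (simp add: scaleR_scaleC)
qed

text \<open>Averaging: \<open>m\<close> is moved by convex combinations of conjugations with the unitaries
  \<open>sqrt 2 u f\<close> into the scalars, and neither the trace nor the vector state of \<open>\<xi>\<close> notices.\<close>

lemma central_trace:
  assumes c: "central \<xi>" and m: "m \<in> R"
  shows "cinner (\<alpha> t m \<xi>) \<xi> = cinner (m \<Omega>) \<Omega> * of_real ((norm \<xi>)\<^sup>2)"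
proof -
  obtain B where B: "\<And>x. norm (m x) \<le> B * norm x" using semilin_bound[OF cliff_clin[OF m]] by blast
  define \<tau> where "\<tau> = cinner (m \<Omega>) \<Omega>"
  \<comment> \<open>All operators that averaging may reach: they share the norm bound, the trace and
    the vector state of \<open>m\<close>. Closure under convex combinations and conjugations takes
    the place of explicit averages.\<close>
  define C where "C = {c \<in> R. (\<forall>x. norm (c x) \<le> B * norm x) \<and> cinner (c \<Omega>) \<Omega> = \<tau>
    \<and> cinner (\<alpha> t c \<xi>) \<xi> = cinner (\<alpha> t m \<xi>) \<xi>}"
  define D where "D = (\<lambda>c. c \<Omega>) ` C"
  have "m \<in> C" using m B by (simp add: C_def \<tau>_def)
  then have "closure D \<noteq> {}" by (auto simp: D_def)
  have comb: "(\<lambda>x. scaleC (of_real a) (c x) + scaleC (of_real b) (d x)) \<in> C"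
    if cd: "c \<in> C" "d \<in> C" and ab: "a \<ge> 0" "b \<ge> 0" "a + b = 1" for c d a b
  proof -
    have R: "c \<in> R" "d \<in> R" using cd by (auto simp: C_def)
    have "norm (scaleC (of_real a) (c x) + scaleC (of_real b) (d x)) \<le> B * norm x" for x
    proof -
      have "norm (scaleC (of_real a) (c x) + scaleC (of_real b) (d x)) \<le> a * norm (c x) + b * norm (d x)"
        using ab by (intro order_trans[OF norm_triangle_ineq]) (simp add: norm_scaleC)
      also have "\<dots> \<le> a * (B * norm x) + b * (B * norm x)"
        using cd ab by (intro add_mono mult_left_mono) (auto simp: C_def)
      also have "\<dots> = B * norm x" using ab(3) by (metis distrib_right mult_1)
      finally show ?thesis .
    qed
    moreover have "of_real a * z + of_real b * z = (z :: complex)" for z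
      using ab(3) by (metis distrib_right mult_1 of_real_1 of_real_add)
    ultimately show ?thesis using cd R
      by (simp add: C_def cliff_add cliff_scaleC flow_add flow_scaleC cinner_add_left cinner_scaleC_left)
  qed
  have "convex D"
    unfolding convex_def
  proof (intro ballI allI impI)
    fix x y and a b :: real assume "x \<in> D" "y \<in> D" and ab: "0 \<le> a" "0 \<le> b" "a + b = 1"
    then obtain c d where cd: "c \<in> C" "d \<in> C" "x = c \<Omega>" "y = d \<Omega>" unfolding D_def by blast
    have "(\<lambda>x. scaleC (of_real a) (c x) + scaleC (of_real b) (d x)) \<Omega> \<in> D"
      unfolding D_def by (rule imageI) (rule comb[OF cd(1,2) ab])
    then show "a *\<^sub>R x + b *\<^sub>R y \<in> D" by (simp add: cd scaleR_scaleC)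
  qed
  then have "convex (closure D)" by simp
  \<comment> \<open>Only uniqueness of the shortest vector is kept; as a point of the closure,
    \<open>p\<close> is merely a limit of vectors \<open>c \<Omega>\<close>.\<close>
  then obtain p where p: "p \<in> closure D" "\<And>q. q \<in> closure D \<Longrightarrow> norm q = norm p \<Longrightarrow> q = p"
    using \<open>closure D \<noteq> {}\<close> ex_min_norm[OF closed_closure, of D] by metis
  have conj_C: "(\<lambda>x. 2 *\<^sub>R u f (c (u f x))) \<in> C"
    if cC: "c \<in> C" and f: "f \<in> L2r" "L2c_inner (of_real_fun f) (of_real_fun f) = 1" for c f
  proof -
    have cR: "c \<in> R" using cC by (simp add: C_def)
    have R: "u f \<circ> (c \<circ> u f) \<in> R" by (intro cliff_comp u_cliff f cR)
    have eq: "(\<lambda>x. 2 *\<^sub>R u f (c (u f x))) = (\<lambda>x. scaleC 2 ((u f \<circ> (c \<circ> u f)) x))"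
      by (simp add: scaleR_scaleC)
    have "norm (2 *\<^sub>R u f (c (u f x))) \<le> B * norm x" for x
    proof -
      have "norm (c (u f x)) \<le> B * (norm x / sqrt 2)" using cC norm_u[OF f, of x] by (metis (mono_tags, lifting) C_def mem_Collect_eq)
      then have "2 * (norm (c (u f x)) / sqrt 2) \<le> 2 * (B * (norm x / sqrt 2) / sqrt 2)"
        by (intro mult_left_mono divide_right_mono) auto
      then show ?thesis by (simp add: norm_u[OF f])
    qed
    moreover have "cinner (2 *\<^sub>R u f (c (u f \<Omega>))) \<Omega> = \<tau>"
    proof -
      have "c (u f \<Omega>) = ru f (c \<Omega>)"
        using cliff_commutes[OF cR ru_commutant[OF f(1)], of \<Omega>] by (simp add: ru_vac[OF f(1)])
      then have "cinner (u f (c (u f \<Omega>))) \<Omega> = cinner (c \<Omega>) (ru f (ru f \<Omega>))"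
        by (simp add: cinner_u cinner_ru f ru_vac)
      then show ?thesis using cC by (simp add: ru_ru[OF f] cinner_scaleR_right cinner_scaleR_left C_def mult.commute)
    qed
    moreover have "cinner (\<alpha> t (\<lambda>x. 2 *\<^sub>R u f (c (u f x))) \<xi>) \<xi> = cinner (\<alpha> t m \<xi>) \<xi>"
    proof -
      let ?g = "shift t f"
      have g: "?g \<in> L2r" by (rule shift_L2r[OF f(1) t])
      have "\<alpha> t (\<lambda>x. 2 *\<^sub>R u f (c (u f x))) \<xi> = scaleC 2 (u ?g (\<alpha> t c (u ?g \<xi>)))"
        unfolding eq flow_scaleC[OF R]
        by (simp add: flow_comp u_cliff cliff_comp cR f flow_u)
      \<comment> \<open>Centrality of \<xi> plays here the part that \<open>ru_vac\<close> plays for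
        the trace: the field is turned into a right multiplication, which commutes with the image of
        \<open>c\<close>.\<close>
      also have "\<alpha> t c (u ?g \<xi>) = ru ?g (\<alpha> t c \<xi>)"
        using cliff_commutes[OF flow_cliff[OF cR] ru_commutant[OF g], of \<xi>] by (simp add: central_u[OF c f(1)])
      finally have "cinner (\<alpha> t (\<lambda>x. 2 *\<^sub>R u f (c (u f x))) \<xi>) \<xi>
        = 2 * cinner (\<alpha> t c \<xi>) (ru ?g (u ?g \<xi>))"
        by (simp add: cinner_scaleC_left cinner_u[OF g] cinner_ru[OF g])
      also have "ru ?g (u ?g \<xi>) = \<xi> /\<^sub>R 2"
        unfolding central_u[OF c f(1)] ru_def by (simp add: shift_u_u[OF f] semilinD(7)[OF semilin_J])
      finally show ?thesis using cC by (simp add: cinner_scaleR_right C_def)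
    qed
    moreover have "(\<lambda>x. 2 *\<^sub>R u f (c (u f x))) \<in> R" unfolding eq by (rule cliff_scaleC[OF R])
    ultimately show ?thesis by (simp add: C_def)
  qed
  have fixed: "u f p = ru f p" if f: "f \<in> L2r" "L2c_inner (of_real_fun f) (of_real_fun f) = 1" for f
  proof -
    \<comment> \<open>Since \<open>u f \<Omega> = ru f \<Omega>\<close>, this isometry implements
      the conjugation of \<open>c\<close> by \<open>sqrt 2 u f\<close> on the vectors
      \<open>c \<Omega>\<close>.\<close>
    let ?V = "\<lambda>y. 2 *\<^sub>R u f (ru f y)"
    have linV: "clin ?V" by (rule semilin_scaleR, rule semilin_comp[OF clin_u[OF f(1)] clin_ru[OF f(1)]]) simp
    have "?V ` D \<subseteq> D"
    proof
      fix z assume "z \<in> ?V ` D"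
      then obtain c where cC: "c \<in> C" "z = ?V (c \<Omega>)" by (auto simp: D_def)
      then have "c \<in> R" by (simp add: C_def)
      then have "z = 2 *\<^sub>R u f (c (u f \<Omega>))"
        using cliff_commutes[OF _ ru_commutant[OF f(1)], of c \<Omega>] by (simp add: cC ru_vac[OF f(1)])
      then show "z \<in> D" unfolding D_def using imageI[OF conj_C[OF cC(1) f], of "\<lambda>c. c \<Omega>"] by simp
    qed
    then have "?V ` closure D \<subseteq> closure D"
      by (intro image_closure_subset semilin_continuous_on[OF linV] closed_closure order_trans[OF _ closure_subset])
    then have "?V p \<in> closure D" using p(1) by blast
    moreover have "norm (?V p) = norm p" by (simp add: norm_u[OF f] norm_ru[OF f])
    ultimately have "?V p = p" by (rule p(2))
    then have "u f p = u f (2 *\<^sub>R u f (ru f p))" by simp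
    also have "\<dots> = ru f p" by (simp add: semilinD(7)[OF clin_u[OF f(1)]] u_u[OF f])
    finally show ?thesis .
  qed
  obtain e :: "nat \<Rightarrow> real \<Rightarrow> 'k" where e: "\<And>i. e i \<in> L2r"
    "\<And>i j. L2c_inner (of_real_fun (e i)) (of_real_fun (e j)) = (if i = j then 1 else 0)"
    by (rule unit_sequence, rule that)
  have "an (of_real_fun f) p = 0" if "f \<in> L2r" "L2c_inner (of_real_fun f) (of_real_fun f) = 1" for f
    using left_right_fixed(2)[of "{f \<in> L2r. L2c_inner (of_real_fun f) (of_real_fun f) = 1}" e p f] e fixed that by auto
  then have p_eq: "p = scaleC (cinner p \<Omega>) \<Omega>" by (rule vac_multiple)
  obtain q where q: "\<And>k. q k \<in> D" "q \<longlonglongrightarrow> p" using p(1) unfolding closure_sequential by blast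
  then have "\<forall>k. \<exists>c. c \<in> C \<and> q k = c \<Omega>" by (auto simp: D_def)
  then obtain c where cC: "\<And>k. c k \<in> C" and qc: "\<And>k. q k = c k \<Omega>" by metis
  have cR: "c k \<in> R" and cB: "norm (c k x) \<le> B * norm x" and c\<tau>: "cinner (c k \<Omega>) \<Omega> = \<tau>"
    and c\<xi>: "cinner (\<alpha> t (c k) \<xi>) \<xi> = cinner (\<alpha> t m \<xi>) \<xi>" for k x
    using cC[of k] by (auto simp: C_def)
  have "(\<lambda>k. cinner (q k) \<Omega>) \<longlonglongrightarrow> cinner p \<Omega>" by (intro tendsto_cinner q tendsto_const)
  then have "cinner p \<Omega> = \<tau>" using LIMSEQ_unique[OF tendsto_const] by (auto simp: qc c\<tau>)
  then have c_lim: "(\<lambda>k. c k \<Omega>) \<longlonglongrightarrow> scaleC \<tau> \<Omega>" using q(2) p_eq by (simp add: qc[symmetric])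
  have lin: "clin (scaleC \<tau>)" using semilin_scaleC[OF semilin_id, of \<tau>] by simp
  \<comment> \<open>Convergence is known at \<Omega> only. Each \<open>y\<close> in the commutant
    carries it to \<open>y \<Omega>\<close>, and these vectors are total.\<close>
  have "(\<lambda>k. c k x) \<longlonglongrightarrow> scaleC \<tau> x" for x
  proof (rule bounded_tendsto_on_dense[OF cliff_clin[OF cR] lin cB total_commutant])
    fix z assume "z \<in> (\<lambda>y. y \<Omega>) ` R\<^sub>c"
    then obtain y where y: "y \<in> R\<^sub>c" "z = y \<Omega>" by blast
    then have ly: "clin y" by (simp add: commutant_UNIV)
    have "(\<lambda>k. y (c k \<Omega>)) \<longlonglongrightarrow> y (scaleC \<tau> \<Omega>)" by (rule semilin_tendsto[OF ly c_lim])
    then show "(\<lambda>k. c k z) \<longlonglongrightarrow> scaleC \<tau> z"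
      by (simp add: y(2) cliff_commutes[OF cR y(1)] semilinD(6)[OF ly])
  qed
  then have "limitin (weak_star UNIV) c (scaleC \<tau>) sequentially"
    by (intro weak_star_limitI[OF cliff_clin[OF cR] lin cB])
  moreover have \<tau>R: "scaleC \<tau> \<in> R" using cliff_scaleC[OF cliff_id, of \<tau>] by simp
  ultimately have "limitin (subtopology (weak_star UNIV) R) c (scaleC \<tau>) sequentially"
    by (simp add: limitin_subtopology cR)
  from continuous_map_limit[OF flow_continuous this]
  have "limitin (weak_star UNIV) (\<lambda>k. \<alpha> t (c k)) (\<alpha> t (scaleC \<tau>)) sequentially"
    by (simp add: limitin_subtopology comp_def)
  moreover have "\<alpha> t (scaleC \<tau>) = scaleC \<tau>"
    using flow_scaleC[OF cliff_id, of \<tau>] by (simp add: flow_id)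
  ultimately have "(\<lambda>k. cinner (\<alpha> t (c k) \<xi>) \<xi>) \<longlonglongrightarrow> cinner (scaleC \<tau> \<xi>) \<xi>"
    using weak_star_limitD[OF _ lin] by simp
  then have "cinner (\<alpha> t m \<xi>) \<xi> = cinner (scaleC \<tau> \<xi>) \<xi>"
    using LIMSEQ_unique[OF tendsto_const] by (simp add: c\<xi>)
  then show ?thesis by (simp add: cinner_scaleC_left \<tau>_def cinner_self)
qed

text \<open>\<open>central_trace\<close> for \<open>cadj n \<circ> m\<close> says that the vectors
  \<open>\<alpha> t m \<xi>\<close> have the Gram matrix of the \<open>m \<Omega>\<close> scaled by
  the squared norm of \<xi>, so the extension lemma applies.\<close>

lemma central_operator:
  assumes c: "central \<xi>"
  obtains T where "clin T" "\<And>m. m \<in> R \<Longrightarrow> T (m \<Omega>) = \<alpha> t m \<xi>"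
proof -
  have gram: "cinner (\<alpha> t m \<xi>) (\<alpha> t n \<xi>) + cinner 0 (0::'h) = of_real ((norm \<xi>)\<^sup>2) * cinner (m \<Omega>) (n \<Omega>)"
    if "m \<in> R" "n \<in> R" for m n
  proof -
    have n: "cadj n \<in> R" by (rule cliff_cadj[OF that(2)])
    have "cinner (\<alpha> t m \<xi>) (\<alpha> t n \<xi>) = cinner (\<alpha> t (cadj n \<circ> m) \<xi>) \<xi>"
      using that by (simp add: flow_comp[OF n] flow_cadj cinner_cadj_left[OF cliff_clin[OF flow_cliff]])
    also have "\<dots> = of_real ((norm \<xi>)\<^sup>2) * cinner (m \<Omega>) (n \<Omega>)"
      using central_trace[OF c cliff_comp[OF n that(1)]] that
      by (simp add: cinner_cadj_left[OF cliff_clin])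
    finally show ?thesis by simp
  qed
  show thesis
    by (rule ex_semilin_extension[OF total_cliff, of "\<lambda>c. c" "(norm \<xi>)\<^sup>2" "\<lambda>m. \<alpha> t m \<xi>" "\<lambda>_. 0"])
      (use gram that in auto)
qed

lemma central_J: "central \<xi> \<Longrightarrow> central (J \<xi>)"
  unfolding central_def
proof (intro conjI ballI; elim conjE)
  assume p: "parity \<xi> = \<xi>" and a: "\<forall>f\<in>L2r. an (of_real_fun (shift t f)) \<xi> = 0"
  show "parity (J \<xi>) = J \<xi>" using p by (simp flip: J_parity)
  fix f :: "real \<Rightarrow> 'k" assume f: "f \<in> L2r"
  have "J (an (of_real_fun (shift t f)) (J \<xi>)) = 0" using a f by (simp add: J_an shift_L2r t)
  then show "an (of_real_fun (shift t f)) (J \<xi>) = 0" by (metis J_J J_simps(4))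
qed

lemma rp_central:
  assumes "central \<xi>"
  shows "fs \<in> lists L2r \<Longrightarrow> rp (map (shift t) fs) \<xi> = fp (rev (map (shift t) fs)) \<xi>"
proof (induction fs)
  case (Cons f fs)
  then have f: "f \<in> L2r" "shift t f \<in> L2r" and fs: "rev (map (shift t) fs) \<in> lists L2r"
    using shift_L2r[OF _ t] by (auto intro: rev_lists shift_lists)
  have "rp (map (shift t) (f # fs)) \<xi> = ru (shift t f) (fp (rev (map (shift t) fs)) \<xi>)" using Cons by simp
  also have "\<dots> = fp (rev (map (shift t) fs)) (ru (shift t f) \<xi>)"
    using fp_rp[OF fs, of "[shift t f]" \<xi>] f by simp
  also have "\<dots> = fp (rev (map (shift t) (f # fs))) \<xi>" by (simp add: central_u[OF assms f(1)])
  finally show ?case .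
qed simp

text \<open>On field products the flow is explicit and the identity is \<open>rp_central\<close>. It
  reaches every \<open>m\<close> through the bounded operators attached to \<xi> and
  \<open>J \<xi>\<close>, which are compared on a total set.\<close>

lemma central_star:
  assumes c: "central \<xi>" and m: "m \<in> R"
  shows "J (\<alpha> t m (J \<xi>)) = \<alpha> t (cadj m) \<xi>"
proof -
  obtain T where T: "clin T" "\<And>m. m \<in> R \<Longrightarrow> T (m \<Omega>) = \<alpha> t m \<xi>" by (rule central_operator[OF c], rule that)
  obtain T' where T': "clin T'" "\<And>m. m \<in> R \<Longrightarrow> T' (m \<Omega>) = \<alpha> t m (J \<xi>)"
    by (rule central_operator[OF central_J[OF c]], rule that)
  have "J (T' x) = T (J x)" for x
  proof (rule semilin_eq_on_dense[OF semilin_comp[OF semilin_J T'(1) refl] semilin_comp[OF T(1) semilin_J refl] total_fp])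
    fix y assume "y \<in> {fp fs \<Omega> | fs. fs \<in> lists L2r}"
    then obtain fs where fs: "fs \<in> lists L2r" "y = fp fs \<Omega>" by blast
    have "J (T' y) = J (fp (map (shift t) fs) (J \<xi>))" using fs by (simp add: T' fp_cliff flow_fp)
    also have "\<dots> = fp (rev (map (shift t) fs)) \<xi>"
      using fs by (simp add: J_fp shift_lists rp_central[OF c])
    also have "\<dots> = T (fp (rev fs) \<Omega>)" using fs by (simp add: T fp_cliff rev_lists flow_fp rev_map)
    also have "\<dots> = T (J y)" using fs by (simp add: J_vac_cliff fp_cliff cadj_fp)
    finally show "J (T' y) = T (J y)" .
  qed
  from this[of "m \<Omega>"] show ?thesis using m by (simp add: T T' J_vac_cliff cliff_cadj)
qed

end

section \<open>The modular conjugations of both algebras\<close>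

context fock
begin

lemma modular_conj_cliff: "modular_conj UNIV R \<Omega> = J"
  by (rule modular_conj_eq[OF total_cliff]) (auto simp: norm_J ocomp_UNIV J_vac_cliff)

lemma P_vac [simp]: "P \<Omega> = \<Omega>"
  by (rule P_fixed) simp

lemma P_even_cliff: "m \<in> R\<^sub>e \<Longrightarrow> P (m x) = m (P x)"
  using cliff_clin[of m] even_cliff_subset
  by (auto simp: even_proj_def semilinD even_cliff_parity subset_eq)

lemma clin_even_cliff: "m \<in> R\<^sub>e \<Longrightarrow> clin m"
  using cliff_clin even_cliff_subset by blast

lemma even_cliff_std_eq: "even_cliff_std w = (\<lambda>m. m \<circ> P) ` R\<^sub>e"
  by (simp add: even_cliff_std_def restrict_op_def[abs_def] oproj_K)

lemma even_cliff_std_vac: "(\<lambda>m. m \<Omega>) ` even_cliff_std w = (\<lambda>m. m \<Omega>) ` R\<^sub>e"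
  by (simp add: even_cliff_std_eq image_image)

lemma total_even_cliff: "closure (cspan ((\<lambda>m. m \<Omega>) ` even_cliff_std w)) = K"
proof
  have "(\<lambda>m. m \<Omega>) ` R\<^sub>e \<subseteq> K" unfolding even_space_def vac_def by (rule closure_subset)
  then have "cspan ((\<lambda>m. m \<Omega>) ` R\<^sub>e) \<subseteq> K" by (rule cspan_subset[OF csubspace_K])
  then show "closure (cspan ((\<lambda>m. m \<Omega>) ` even_cliff_std w)) \<subseteq> K"
    unfolding even_cliff_std_vac by (rule closure_minimal) (simp add: even_space_def)
  show "K \<subseteq> closure (cspan ((\<lambda>m. m \<Omega>) ` even_cliff_std w))"
    unfolding even_cliff_std_vac unfolding even_space_def vac_def by (rule closure_mono[OF cspan_superset])
qed

text \<open>\<open>J\<close> commutes with the parity and so preserves even vectors; composing with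
  \<open>P\<close> gives the extension by zero.\<close>

lemma modular_conj_even: "modular_conj K (even_cliff_std w) \<Omega> = J \<circ> P"
proof (rule modular_conj_eq[OF total_even_cliff])
  show "\<forall>x\<in>K. (J \<circ> P) x \<in> K \<and> norm ((J \<circ> P) x) = norm x"
    by (auto simp: mem_K P_fixed norm_J simp flip: J_parity)
  show "\<forall>x\<in>ocomp K. (J \<circ> P) x = 0" by (simp add: ocomp_K)
  show "\<forall>m\<in>even_cliff_std w. (J \<circ> P) (m \<Omega>) = cadj m \<Omega>"
  proof
    fix n assume "n \<in> even_cliff_std w"
    then obtain m where m: "m \<in> R\<^sub>e" "n = m \<circ> P" by (auto simp: even_cliff_std_eq)
    have cm: "clin m" by (rule clin_even_cliff[OF m(1)])
    have "cadj n = P \<circ> cadj m"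
      by (rule cadj_eqI) (simp add: m cinner_P cinner_cadj_right[OF cm] flip: cinner_P)
    then show "(J \<circ> P) (n \<Omega>) = cadj n \<Omega>"
      using m(1) even_cliff_subset
      by (auto simp: m(2) J_P P_even_cliff even_cliff_cadj J_vac_cliff subset_eq)
  qed
qed (simp_all add: semilinD[OF clin_P])

end

context clifford
begin

section \<open>The intertwiner spaces of the two flows\<close>

abbreviation "sps \<equiv> sps_space UNIV R \<Omega> \<alpha> t"
abbreviation "sps_even \<equiv> sps_space K (even_cliff_std w) \<Omega> (even_flow w \<alpha>) t"

lemma sps_iff: "T \<in> sps \<longleftrightarrow> clin T \<and> (\<forall>m\<in>R. \<forall>x. \<alpha> t m (T x) = T (m x)) \<and>
    (\<forall>y\<in>R\<^sub>c. \<forall>x. J (\<alpha> t (J \<circ> y \<circ> J) (J (T x))) = T (y x))"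
  unfolding sps_space_def dual_flow_def modular_conj_cliff commutant_cliff bops_UNIV Let_def
  by (auto simp: fun_eq_iff)

lemma sps_inj: "inj_on (\<lambda>X. X \<Omega>) sps"
proof (rule inj_onI)
  fix X Y assume X: "X \<in> sps" and Y: "Y \<in> sps" and eq: "X \<Omega> = Y \<Omega>"
  then have "clin X" "clin Y" by (auto simp: sps_iff)
  have "X (m \<Omega>) = Y (m \<Omega>)" if "m \<in> R" for m
    using X Y eq that by (metis sps_iff)
  then show "X = Y"
    by (intro ext) (rule semilin_eq_on_dense[OF \<open>clin X\<close> \<open>clin Y\<close> total_cliff], auto)
qed

text \<open>The dual relation is tested on \<open>ru f\<close>, where
  \<open>J \<circ> ru f \<circ> J = u f\<close>. Because
  \<open>ru f \<Omega> = u f \<Omega>\<close>, both relations evaluate the same vector.\<close>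

lemma sps_central:
  assumes X: "X \<in> sps" shows "central (X \<Omega>)"
proof -
  obtain e :: "nat \<Rightarrow> real \<Rightarrow> 'k" where e: "\<And>i. e i \<in> L2r"
    "\<And>i j. L2c_inner (of_real_fun (shift t (e i))) (of_real_fun (shift t (e j))) = (if i = j then 1 else 0)"
    by (rule sequence, rule that)
  have X1: "\<alpha> t m (X x) = X (m x)" if "m \<in> R" for m x using X that by (simp add: sps_iff)
  have X2: "J (\<alpha> t (J \<circ> y \<circ> J) (J (X x))) = X (y x)" if "y \<in> R\<^sub>c" for y x using X that by (simp add: sps_iff)
  have "u g (X \<Omega>) = ru g (X \<Omega>)" if g: "g \<in> shift t ` L2r" for g
  proof -
    obtain f where f: "f \<in> L2r" "g = shift t f" using g by blast
    have "J \<circ> ru f \<circ> J = u f" by (rule ext) (simp add: ru_def)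
    then have "ru g (X \<Omega>) = X (ru f \<Omega>)"
      using X2[OF ru_commutant[OF f(1)], of \<Omega>] by (simp add: f flow_u ru_def)
    also have "\<dots> = u g (X \<Omega>)" using X1[OF u_cliff[OF f(1)], of \<Omega>] f by (simp add: flow_u ru_vac)
    finally show ?thesis by simp
  qed
  then have "parity (X \<Omega>) = X \<Omega>" "\<And>g. g \<in> shift t ` L2r \<Longrightarrow> an (of_real_fun g) (X \<Omega>) = 0"
    using left_right_fixed[where S = "shift t ` L2r" and e = "\<lambda>i. shift t (e i)" and \<xi> = "X \<Omega>",
        OF image_subsetI[OF shift_L2r[OF _ t]]] e by auto
  then show ?thesis by (simp add: central_def)
qed

lemma central_sps:
  assumes c: "central \<xi>"
  obtains X where "X \<in> sps" "X \<Omega> = \<xi>"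
proof -
  obtain T where T: "clin T" "\<And>m. m \<in> R \<Longrightarrow> T (m \<Omega>) = \<alpha> t m \<xi>" by (rule central_operator[OF c], rule that)
  have "T \<in> sps"
    unfolding sps_iff
  proof (intro conjI ballI allI)
    show "clin T" by (rule T)
    fix m x assume m: "m \<in> R"
    show "\<alpha> t m (T x) = T (m x)"
    proof (rule semilin_eq_on_dense[OF semilin_comp[OF cliff_clin[OF flow_cliff[OF m]] T(1) refl]
          semilin_comp[OF T(1) cliff_clin[OF m] refl] total_cliff])
      fix v assume "v \<in> (\<lambda>m. m \<Omega>) ` R"
      then obtain n where n: "n \<in> R" "v = n \<Omega>" by blast
      have "\<alpha> t m (T v) = \<alpha> t (m \<circ> n) \<xi>" using m n by (simp add: T flow_comp)
      also have "\<dots> = T ((m \<circ> n) \<Omega>)" by (rule T(2)[symmetric, OF cliff_comp[OF m n(1)]])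
      finally show "\<alpha> t m (T v) = T (m v)" by (simp add: n)
    qed
  next
    fix y x assume y: "y \<in> R\<^sub>c"
    \<comment> \<open>By the commutation theorem \<open>m\<close> belongs to \<open>R\<close>, and
      \<open>y \<Omega> = cadj m \<Omega>\<close>; thus \<open>y\<close> is right multiplication by
      \<open>cadj m\<close>.\<close>
    define m where "m = J \<circ> y \<circ> J"
    have m: "m \<in> R" using J_commutant_J[OF y] by (simp add: m_def comp_def)
    have cy: "clin y" using y by (simp add: commutant_UNIV)
    have am: "(\<lambda>x. J (\<alpha> t m (J x))) \<in> R\<^sub>c" by (rule J_cliff_J[OF flow_cliff[OF m]])
    then have cam: "clin (\<lambda>x. J (\<alpha> t m (J x)))" by (simp add: commutant_UNIV)
    have "J (\<alpha> t m (J (T x))) = T (y x)"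
    proof (rule semilin_eq_on_dense[OF semilin_comp[OF cam T(1) refl] semilin_comp[OF T(1) cy refl] total_cliff])
      fix v assume "v \<in> (\<lambda>m. m \<Omega>) ` R"
      then obtain n where n: "n \<in> R" "v = n \<Omega>" by blast
      have "J (\<alpha> t m (J (T v))) = J (\<alpha> t m (J (\<alpha> t n \<xi>)))" by (simp add: n T)
      also have "\<dots> = \<alpha> t n (J (\<alpha> t m (J \<xi>)))" by (rule cliff_commutes[OF flow_cliff[OF n(1)] am, symmetric])
      also have "\<dots> = \<alpha> t n (\<alpha> t (cadj m) \<xi>)" by (simp add: central_star[OF c m])
      also have "\<dots> = \<alpha> t (n \<circ> cadj m) \<xi>" using m n by (simp add: flow_comp cliff_cadj)
      also have "\<dots> = T ((n \<circ> cadj m) \<Omega>)" by (rule T(2)[symmetric, OF cliff_comp[OF n(1) cliff_cadj[OF m]]])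
      also have "cadj m \<Omega> = y \<Omega>" using J_vac_cliff[OF m] by (simp add: m_def)
      then have "(n \<circ> cadj m) \<Omega> = n (y \<Omega>)" by simp
      also have "\<dots> = y v" using cliff_commutes[OF n(1) y] n(2) by simp
      finally show "J (\<alpha> t m (J (T v))) = T (y v)" .
    qed
    then show "J (\<alpha> t (J \<circ> y \<circ> J) (J (T x))) = T (y x)" by (simp only: m_def)
  qed
  moreover have "T \<Omega> = \<xi>" using T(2)[OF cliff_id] by (simp add: flow_id)
  ultimately show thesis by (rule that)
qed

text \<open>\<open>X\<close> shifts each factor of a field product and keeps their number, and
  \<open>X \<Omega>\<close> is even. Hence \<open>X\<close> preserves the even space.\<close>

lemma sps_parity:
  assumes X: "X \<in> sps" shows "X (parity x) = parity (X x)"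
proof -
  have cX: "clin X" using X by (simp add: sps_iff)
  have p: "parity (X \<Omega>) = X \<Omega>" using sps_central[OF X] by (simp add: central_def)
  show ?thesis
  proof (rule semilin_eq_on_dense[OF semilin_comp[OF cX clin_parity refl] semilin_comp[OF clin_parity cX refl] total_fp])
    fix v assume "v \<in> {fp fs \<Omega> | fs. fs \<in> lists L2r}"
    then obtain fs where fs: "fs \<in> lists L2r" "v = fp fs \<Omega>" by blast
    have "X v = fp (map (shift t) fs) (X \<Omega>)"
      using X fs fp_cliff[OF fs(1)] by (metis flow_fp sps_iff)
    then show "X (parity v) = parity (X v)"
      using fs by (simp add: parity_fp shift_lists p semilinD(6)[OF cX])
  qed
qed

lemma sps_P: "X \<in> sps \<Longrightarrow> X (P x) = P (X x)"
  using sps_parity[of X x] by (auto simp: even_proj_def sps_iff semilinD)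

text \<open>The even space contains the separating vector \<Omega>, so restriction to it loses
  nothing and can be inverted.\<close>

lemma even_flow_eq:
  assumes "m \<in> R\<^sub>e" shows "even_flow w \<alpha> t (m \<circ> P) = \<alpha> t m \<circ> P"
proof -
  have "inj_on (restrict_op K) R\<^sub>e"
  proof (rule inj_onI)
    fix m n assume mn: "m \<in> R\<^sub>e" "n \<in> R\<^sub>e" "restrict_op K m = restrict_op K n"
    then have "m (P \<Omega>) = n (P \<Omega>)" by (metis comp_apply oproj_K restrict_op_def)
    then show "m = n" using mn even_cliff_subset by (intro cliff_separating) auto
  qed
  from the_inv_into_f_f[OF this assms] show ?thesis
    by (simp add: even_flow_def restrict_op_def oproj_K)
qed

lemma commutant_even_cliff:
  "y \<in> commutant K (even_cliff_std w) \<longleftrightarrow> y \<in> bops K \<and> (\<forall>m\<in>R\<^sub>e. \<forall>x. y (m x) = m (y x))"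
proof -
  have "(y \<circ> (m \<circ> P) = (m \<circ> P) \<circ> y) \<longleftrightarrow> (\<forall>x. y (m x) = m (y x))" if "y \<in> bops K" "m \<in> R\<^sub>e" for m
  proof -
    have y: "P (y x) = y x" "y (P x) = y x" for x using that(1) by (auto simp: bops_K)
    have "y (m (P x)) = y (m x)" for x using y(2)[of "m x"] P_even_cliff[OF that(2), of x] by simp
    then show ?thesis by (simp add: fun_eq_iff y)
  qed
  then show ?thesis unfolding commutant_def even_cliff_std_eq by auto
qed

text \<open>An operator \<open>y\<close> in the commutant on the even space extends to \<open>y + 2 u f y u f\<close>, which commutes with all of the Clifford algebra.\<close>

lemma even_commutant_J:
  assumes y: "y \<in> commutant K (even_cliff_std w)"
  obtains m where "m \<in> R\<^sub>e" "(J \<circ> P) \<circ> y \<circ> (J \<circ> P) = m \<circ> P"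
proof -
  obtain e :: "nat \<Rightarrow> real \<Rightarrow> 'k" where e: "\<And>i. e i \<in> L2r"
    "\<And>i j. L2c_inner (of_real_fun (e i)) (of_real_fun (e j)) = (if i = j then 1 else 0)"
    by (rule unit_sequence, rule that)
  define f where "f = e 0"
  have f: "f \<in> L2r" "L2c_inner (of_real_fun f) (of_real_fun f) = 1" using e by (auto simp: f_def)
  have cy: "clin y" and Py: "\<And>x. P (y x) = y x" and yP: "\<And>x. y (P x) = y x"
    and ym: "\<And>m x. m \<in> R\<^sub>e \<Longrightarrow> y (m x) = m (y x)"
    using y by (auto simp: commutant_even_cliff bops_K)
  have py: "parity (y x) = y x" "y (parity x) = y x" for x
    using parity_P[of "y x"] Py[of x] yP[of x] yP[of "parity x"] by simp_all
  have "commutes_even y" using cy ym[OF fp_even_cliff] by (simp add: commutes_even_def)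
  then have T: "(\<lambda>x. y x + 2 *\<^sub>R u f (y (u f x))) \<in> R\<^sub>c" by (rule conj_sum_commutant[OF f])
  \<comment> \<open>The extended operator lies in \<open>R\<^sub>c\<close>, hence \<open>m\<close>
    lies in \<open>R\<close>; invariance under the parity then places it in the even
    algebra.\<close>
  define m where "m x = J (y (J x) + 2 *\<^sub>R u f (y (u f (J x))))" for x
  have mR: "m \<in> R" using J_commutant_J[OF T] by (simp add: m_def[abs_def])
  \<comment> \<open>\<open>u f\<close> turns even vectors into odd ones, which \<open>y\<close>
    kills; so the added summand disappears on the even space.\<close>
  have yu: "y (u f (P x)) = 0" for x
  proof -
    have "y (u f (P x)) = y (parity (u f (P x)))" by (simp add: py)
    also have "\<dots> = - y (u f (P x))" by (simp add: parity_u[OF f(1)] semilinD[OF cy])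
    finally have "2 *\<^sub>R y (u f (P x)) = 0" by (simp only: scaleR_2 eq_neg_iff_add_eq_0)
    then show ?thesis by simp
  qed
  have "m (parity x) = parity (m x)" for x
  proof -
    have up: "u f (parity z) = - parity (u f z)" for z by (simp add: parity_u[OF f(1)])
    have "m (parity x) = J (y (parity (J x)) + 2 *\<^sub>R u f (y (- parity (u f (J x)))))"
      by (simp only: m_def J_parity up)
    also have "\<dots> = J (y (J x) - 2 *\<^sub>R u f (y (u f (J x))))"
      by (simp add: py semilinD(4)[OF cy] semilinD(4)[OF clin_u[OF f(1)]])
    also have "\<dots> = J (parity (y (J x) + 2 *\<^sub>R u f (y (u f (J x)))))"
      by (simp add: py semilinD(7)[OF clin_parity] parity_u[OF f(1)])
    also have "\<dots> = parity (m x)" by (simp only: m_def J_parity)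
    finally show ?thesis .
  qed
  then have "m \<in> R\<^sub>e" by (rule even_cliffI[OF f mR])
  moreover have "(J \<circ> P) \<circ> y \<circ> (J \<circ> P) = m \<circ> P"
    by (rule ext) (simp add: m_def Py yu semilinD(5)[OF clin_u[OF f(1)]] J_P)
  ultimately show thesis by (rule that)
qed

lemma sps_even_iff: "X \<in> sps_even \<longleftrightarrow> X \<in> bops K \<and> (\<forall>m\<in>R\<^sub>e. \<forall>x. \<alpha> t m (X x) = X (m x)) \<and>
    (\<forall>y\<in>commutant K (even_cliff_std w). \<forall>x.
       J (P (even_flow w \<alpha> t ((J \<circ> P) \<circ> y \<circ> (J \<circ> P)) (J (P (X x))))) = X (y x))"
proof -
  have "(even_flow w \<alpha> t (m \<circ> P) \<circ> X = X \<circ> (m \<circ> P)) \<longleftrightarrow> (\<forall>x. \<alpha> t m (X x) = X (m x))"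
    if "X \<in> bops K" "m \<in> R\<^sub>e" for m
  proof -
    have X: "P (X x) = X x" "X (P x) = X x" for x using that(1) by (auto simp: bops_K)
    have "X (m (P x)) = X (m x)" for x using X(2)[of "m x"] P_even_cliff[OF that(2), of x] by simp
    then show ?thesis by (simp add: fun_eq_iff even_flow_eq[OF that(2)] X)
  qed
  moreover have "(\<forall>m\<in>even_cliff_std w. Q m) \<longleftrightarrow> (\<forall>m\<in>R\<^sub>e. Q (m \<circ> P))" for Q
    by (simp add: even_cliff_std_eq)
  ultimately show ?thesis
    unfolding sps_space_def dual_flow_def modular_conj_even Let_def by (auto simp: fun_eq_iff)
qed

lemma sps_even_inj: "inj_on (\<lambda>X. X \<Omega>) sps_even"
proof (rule inj_onI)
  fix X Y assume X: "X \<in> sps_even" and Y: "Y \<in> sps_even" and eq: "X \<Omega> = Y \<Omega>"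
  then have lin: "clin X" "clin Y" and XP: "\<And>x. X (P x) = X x" "\<And>x. Y (P x) = Y x"
    by (auto simp: sps_even_iff bops_K)
  have "(\<lambda>m. m \<Omega>) ` R\<^sub>e \<subseteq> {x. X x = Y x}"
    using X Y eq by (auto simp: sps_even_iff) (metis)
  moreover have "closed {x. X x = Y x}"
    by (intro closed_Collect_eq semilin_continuous_on[OF lin(1)] semilin_continuous_on[OF lin(2)])
  ultimately have "K \<subseteq> {x. X x = Y x}" unfolding even_space_def vac_def by (rule closure_minimal)
  then have "X (P x) = Y (P x)" for x by (auto simp: mem_K subset_eq)
  then show "X = Y" using XP by (intro ext) metis
qed

lemma sps_even_central:
  assumes X: "X \<in> sps_even" shows "central (X \<Omega>)"
proof -
  obtain e :: "nat \<Rightarrow> real \<Rightarrow> 'k" where e: "\<And>i. e i \<in> L2r"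
    "\<And>i j. L2c_inner (of_real_fun (shift t (e i))) (of_real_fun (shift t (e j))) = (if i = j then 1 else 0)"
    by (rule sequence, rule that)
  have lin: "clin X" and PX: "\<And>x. P (X x) = X x" and XP: "\<And>x. X (P x) = X x"
    and X1: "\<And>m x. m \<in> R\<^sub>e \<Longrightarrow> \<alpha> t m (X x) = X (m x)"
    and X2: "\<And>y x. y \<in> commutant K (even_cliff_std w) \<Longrightarrow>
       J (P (even_flow w \<alpha> t ((J \<circ> P) \<circ> y \<circ> (J \<circ> P)) (J (P (X x))))) = X (y x)"
    using X by (auto simp: sps_even_iff bops_K)
  have p: "parity (X \<Omega>) = X \<Omega>" using parity_P(1)[of "X \<Omega>"] PX by simp
  have key: "ru (shift t f) (ru (shift t g) (X \<Omega>)) = u (shift t g) (u (shift t f) (X \<Omega>))"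
    if f: "f \<in> L2r" and g: "g \<in> L2r" for f g
  proof -
    define m where "m = fp [f, g]"
    have fg: "[f, g] \<in> lists L2r" "[g, f] \<in> lists L2r" using f g by auto
    have m: "m \<in> R\<^sub>e" unfolding m_def by (rule fp_even_cliff[OF fg(1)]) simp
    then have mR: "m \<in> R" using even_cliff_subset by blast
    have cm: "clin m" by (rule cliff_clin[OF mR])
    \<comment> \<open>Right multiplication by the adjoint of \<open>u f u g\<close>, cut down to the
      even space: the simplest element of the commutant that sees two fields.\<close>
    define y where "y x = J (m (J (P x)))" for x
    have cy: "clin y"
      unfolding y_def[abs_def]
      by (rule semilin_comp[OF semilin_J semilin_comp[OF cm semilin_comp[OF semilin_J clin_P refl] refl]]) simp
    have "y \<in> commutant K (even_cliff_std w)"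
      unfolding commutant_even_cliff bops_K
    proof (intro conjI ballI allI)
      show "clin y" by (rule cy)
      show "P (y x) = y x" for x by (simp add: y_def P_even_cliff[OF m] flip: J_P)
      show "y (P x) = y x" for x by (simp add: y_def)
      fix n x assume n: "n \<in> R\<^sub>e"
      then have "n (J (m (J (P x)))) = J (m (J (n (P x))))"
        using cliff_commutes[OF _ J_cliff_J[OF mR], of n "P x"] even_cliff_subset by blast
      then show "y (n x) = n (y x)" by (simp add: y_def P_even_cliff[OF n])
    qed
    from X2[OF this, of \<Omega>]
    have "J (P (even_flow w \<alpha> t ((J \<circ> P) \<circ> y \<circ> (J \<circ> P)) (J (P (X \<Omega>))))) = X (y \<Omega>)" .
    moreover have "(J \<circ> P) \<circ> y \<circ> (J \<circ> P) = m \<circ> P"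
      by (rule ext) (simp add: y_def J_P P_even_cliff[OF m])
    ultimately have "J (P (\<alpha> t m (P (J (P (X \<Omega>)))))) = X (y \<Omega>)"
      by (simp add: even_flow_eq[OF m])
    moreover have "P (J (P (X \<Omega>))) = J (X \<Omega>)" by (simp add: PX flip: J_P)
    moreover have am: "\<alpha> t m = fp [shift t f, shift t g]"
      unfolding m_def using flow_fp[OF fg(1)] by simp
    have s: "[shift t f, shift t g] \<in> lists L2r" using f g shift_L2r[OF _ t] by auto
    have "P (\<alpha> t m z) = \<alpha> t m (P z)" for z
      unfolding am by (rule P_even_cliff[OF fp_even_cliff[OF s]]) simp
    moreover have "P (J (X \<Omega>)) = J (X \<Omega>)" by (simp add: PX flip: J_P)
    ultimately have "J (\<alpha> t m (J (X \<Omega>))) = X (y \<Omega>)" by simp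
    then have "ru (shift t f) (ru (shift t g) (X \<Omega>)) = X (y \<Omega>)"
      using J_fp[OF s, of "J (X \<Omega>)"] by (simp add: am)
    also have "y \<Omega> = cadj m \<Omega>" by (simp add: y_def J_vac_cliff[OF mR])
    also have "cadj m = fp [g, f]" unfolding m_def using cadj_fp[OF fg(1)] by simp
    also have "X (fp [g, f] \<Omega>) = \<alpha> t (fp [g, f]) (X \<Omega>)"
      by (rule X1[symmetric, OF fp_even_cliff[OF fg(2)]]) simp
    also have "\<dots> = u (shift t g) (u (shift t f) (X \<Omega>))" using flow_fp[OF fg(2)] by simp
    finally show ?thesis .
  qed
  have "an (of_real_fun h) (X \<Omega>) = 0" if "h \<in> shift t ` L2r" for h
    by (rule left_right_fixed_even[of "shift t ` L2r" "\<lambda>i. shift t (e i)"])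
      (use e shift_L2r[OF _ t] p key that in auto)
  then show ?thesis using p by (simp add: central_def)
qed

text \<open>By \<open>even_commutant_J\<close> each \<open>y\<close> in the even commutant is
  \<open>J m J P\<close> with \<open>m\<close> in \<open>R\<^sub>e\<close>. Since
  \<open>J m J\<close> lies in \<open>R\<^sub>c\<close>, the dual relation of \<open>X\<close>
  applies to it and commutes with \<open>P\<close>.\<close>

lemma sps_imp_sps_even:
  assumes X: "X \<in> sps" shows "X \<circ> P \<in> sps_even"
  unfolding sps_even_iff bops_K
proof (intro conjI ballI allI)
  have cX: "clin X" using X by (simp add: sps_iff)
  have XP: "X (P x) = P (X x)" for x by (rule sps_P[OF X])
  show "clin (X \<circ> P)" unfolding comp_def by (rule semilin_comp[OF cX clin_P refl])
  show "P ((X \<circ> P) x) = (X \<circ> P) x" "(X \<circ> P) (P x) = (X \<circ> P) x" for x by (simp_all flip: XP)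
  show "\<alpha> t m ((X \<circ> P) x) = (X \<circ> P) (m x)" if "m \<in> R\<^sub>e" for m x
    using X that even_cliff_subset by (auto simp: sps_iff P_even_cliff)
  fix y x assume y: "y \<in> commutant K (even_cliff_std w)"
  obtain m where m: "m \<in> R\<^sub>e" "(J \<circ> P) \<circ> y \<circ> (J \<circ> P) = m \<circ> P" by (rule even_commutant_J[OF y])
  have mR: "m \<in> R" using m even_cliff_subset by blast
  have yx: "y x = J (m (J (P x)))"
  proof -
    have y': "P (y x) = y x" "y (P x) = y x" for x using y by (auto simp: commutant_even_cliff bops_K)
    have "J (P (y (J (P (J (P x)))))) = m (P (J (P x)))" using fun_cong[OF m(2), of "J (P x)"] by simp
    then have "J (y x) = m (J (P x))" by (simp add: J_P y' flip: J_P)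
    then show ?thesis by (metis J_J)
  qed
  have "J \<circ> (\<lambda>x. J (m (J x))) \<circ> J = m" by (rule ext) simp
  then have 2: "J (\<alpha> t m (J (X z))) = X (J (m (J z)))" for z
    using X J_cliff_J[OF mR] by (auto simp: sps_iff)
  have "J (P (even_flow w \<alpha> t ((J \<circ> P) \<circ> y \<circ> (J \<circ> P)) (J (P ((X \<circ> P) x)))))
    = P (J (\<alpha> t m (J (X (P x)))))"
    by (simp add: m(2) even_flow_eq[OF m(1)] J_P XP)
  also have "\<dots> = X (P (J (m (J (P x)))))" by (simp only: 2 XP[of "J _"])
  also have "\<dots> = (X \<circ> P) (y x)" by (simp add: yx)
  finally show "J (P (even_flow w \<alpha> t ((J \<circ> P) \<circ> y \<circ> (J \<circ> P)) (J (P ((X \<circ> P) x))))) = (X \<circ> P) (y x)" .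
qed

lemma sps_vectors_eq:
  "sps_vectors K (even_cliff_std w) \<Omega> (even_flow w \<alpha>) t = sps_vectors UNIV R \<Omega> \<alpha> t"
proof -
  have "sps_vectors UNIV R \<Omega> \<alpha> t = Collect central"
    unfolding sps_vectors_def using sps_central central_sps by (auto simp: image_iff) metis
  moreover have "sps_vectors K (even_cliff_std w) \<Omega> (even_flow w \<alpha>) t = Collect central"
  proof
    show "sps_vectors K (even_cliff_std w) \<Omega> (even_flow w \<alpha>) t \<subseteq> Collect central"
      unfolding sps_vectors_def using sps_even_central by auto
    show "Collect central \<subseteq> sps_vectors K (even_cliff_std w) \<Omega> (even_flow w \<alpha>) t"
    proof clarify
      fix \<xi> assume "central \<xi>"
      then obtain X where X: "X \<in> sps" "X \<Omega> = \<xi>" by (rule central_sps)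
      then have "\<xi> = (X \<circ> P) \<Omega>" by simp
      then show "\<xi> \<in> sps_vectors K (even_cliff_std w) \<Omega> (even_flow w \<alpha>) t"
        unfolding sps_vectors_def using sps_imp_sps_even[OF X(1)] by blast
    qed
  qed
  ultimately show ?thesis by simp
qed

lemma sps_op_sps:
  assumes X: "X \<in> sps"
  shows "sps_op UNIV R \<Omega> \<alpha> t (X \<Omega>) = X"
    and "sps_op K (even_cliff_std w) \<Omega> (even_flow w \<alpha>) t (X \<Omega>) = X \<circ> P"
proof -
  show "sps_op UNIV R \<Omega> \<alpha> t (X \<Omega>) = X"
    unfolding sps_op_def by (rule the_inv_into_f_f[OF sps_inj X])
  show "sps_op K (even_cliff_std w) \<Omega> (even_flow w \<alpha>) t (X \<Omega>) = X \<circ> P"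
    unfolding sps_op_def using the_inv_into_f_f[OF sps_even_inj sps_imp_sps_even[OF X]] by simp
qed

end

theorem proposition8p16:
  fixes w :: "(real \<Rightarrow> 'k::{real_inner,banach,second_countable_topology} \<times> 'k) list \<Rightarrow> 'h::chilbert_space"
    and n :: enat
    and \<alpha> :: "real \<Rightarrow> ('h \<Rightarrow> 'h) \<Rightarrow> 'h \<Rightarrow> 'h"
  assumes "hilbert_dim TYPE('k) n" and "n \<ge> 1"
    and "antisym_fock w"
    and "clifford_flow w \<alpha>"
  shows "(\<forall>t>0. sps_vectors (even_space w) (even_cliff_std w) (vac w) (even_flow w \<alpha>) t
              = sps_vectors UNIV (cliff_alg w) (vac w) \<alpha> t) \<and>
         (\<forall>s>0. \<forall>t>0. \<forall>x \<in> sps_vectors UNIV (cliff_alg w) (vac w) \<alpha> s.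
            \<forall>y \<in> sps_vectors UNIV (cliff_alg w) (vac w) \<alpha> t.
              sps_mult (even_space w) (even_cliff_std w) (vac w) (even_flow w \<alpha>) s t x y
              = sps_mult UNIV (cliff_alg w) (vac w) \<alpha> s t x y)"
proof -
  have unit: "\<exists>e::'k. norm e = 1" using ex_unit_vector[OF assms(1,2)] by blast
  have loc: "clifford w \<alpha> t" if "t > 0" for t
    using that assms(3,4) unit by unfold_locales auto
  show ?thesis
    unfolding vac_def
  proof (intro conjI allI impI ballI)
    fix t :: real assume "t > 0"
    then interpret clifford w \<alpha> t by (rule loc)
    show "sps_vectors (even_space w) (even_cliff_std w) (w []) (even_flow w \<alpha>) t
        = sps_vectors UNIV (cliff_alg w) (w []) \<alpha> t"
      by (rule sps_vectors_eq)
  next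
    fix s t :: real and x y
    assume s: "s > 0" and t: "t > 0"
      and x: "x \<in> sps_vectors UNIV (cliff_alg w) (w []) \<alpha> s" and y: "y \<in> sps_vectors UNIV (cliff_alg w) (w []) \<alpha> t"
    interpret S: clifford w \<alpha> s by (rule loc[OF s])
    interpret T: clifford w \<alpha> t by (rule loc[OF t])
    obtain X where X: "X \<in> sps_space UNIV (cliff_alg w) (w []) \<alpha> s" "x = X (w [])"
      using x unfolding sps_vectors_def by blast
    obtain Y where Y: "Y \<in> sps_space UNIV (cliff_alg w) (w []) \<alpha> t" "y = Y (w [])"
      using y unfolding sps_vectors_def by blast
    \<comment> \<open>The even product is \<open>X P Y P\<close> at \<Omega>; both projections act
      trivially there.\<close>
    have "S.even_proj (Y (w [])) = Y (w [])" using T.sps_P[OF Y(1), of "w []"] by simp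
    then show "sps_mult (even_space w) (even_cliff_std w) (w []) (even_flow w \<alpha>) s t x y
        = sps_mult UNIV (cliff_alg w) (w []) \<alpha> s t x y"
      unfolding sps_mult_def X(2) Y(2) S.sps_op_sps[OF X(1)] T.sps_op_sps[OF Y(1)] by simp
  qed
qed

end
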